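(* Let $\Omega\subset\mathbb{R}^2$ be a simply connected open set, and let $\alpha$ be a smooth $1$-form on $\Omega$ with values in $\mathfrak g(I)$. Then: - $\alpha$ is the Maurer–Cartan form of an $\omega_I$-isotropic lift if and only if $$d\alpha+\alpha\wedge\alpha=0,\qquad\alpha_{-1}''=0\quad\text{and}\quad\alpha_{-1}'\text{ does not vanish at any point};$$ - in this case, $\alpha$ corresponds to a conformal $\omega_I$-isotropic, $\rho$-harmonic immersion if and only if the extended Maurer–Cartan form $$\alpha_\lambda=\lambda^{-2}\alpha_2'+\lambda^{-1}\alpha_{-1}'+\alpha_0+\lambda\alpha_1''+\lambda^2\alpha_2''$$ satisfies $$d\alpha_\lambda+\alpha_\lambda\wedge\alpha_\lambda=0\qquad\forall\lambda\in\mathbb{C}^*.$$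
   Context: $\mathbb{H}$ denotes the quaternions and $\mathbb{O}=\mathbb{H}^2=\mathbb{R}^8$ the octonions with product $(x,y)\cdot(x',y')=(xx'-y'\bar y,\ x'y+\bar x y')$, conjugation $\overline{(x,y)}=(\bar x,-y)$, unit $1=(1,0)$ and Euclidean inner product $\langle\cdot,\cdot\rangle$; $\operatorname{Im}\mathbb{O}=1^\perp=\mathbb{R}^7$. The canonical basis is $e_0=1$, $e_1=(i,0)$, $e_2=(j,0)$, $e_3=(k,0)$, $e_4=(0,1)$, $e_5=(0,i)$, $e_6=(0,j)$, $e_7=(0,k)$. $L_u$ is left octonion multiplication by $u$, $\omega_i(q,q')=\langle q,e_i\cdot q'\rangle$ for $1\le i\le7$. $Gr_2(\mathbb{O})$ is the Grassmannian of oriented $2$-planes; $\rho\colon Gr_2(\mathbb{O})\to S^6=S(\operatorname{Im}\mathbb{O})$ sends the plane with oriented orthonormal basis $(q,q')$ to $q\times q'=-\operatorname{Im}(q\cdot\overline{q'})=-\sum_{i=1}^7\omega_i(q,q')e_i$. $I\subsetneq\{1,\dots,7\}$ (possibly empty) with, by the convention fixed once and for all, $I=\{1,\dots,|I|\}$, and $e=e_{|I|+1}$. $Q_I=\{P\in Gr_2(\mathbb{O}):\ \omega_i|_P=0\ \forall i\in I\}$; on $Q_I$, $\rho$ takes values in $S^I=S(\bigoplus_{i\notin I,\,i>0}\mathbb{R}e_i)$. $Spin(7)\subset SO(8)$ is the group generated by $\{L_u:u\in\operatorname{Im}\mathbb{O},|u|=1\}$; $\chi\colon Spin(7)\to SO(7)$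 is defined by $L_{\chi_g(u)}=gL_ug^{-1}$ for $u\in\operatorname{Im}\mathbb{O}$. $G_I=\{g\in Spin(7):\ gL_{e_i}=L_{e_i}g\ \forall i\in I\}$, $\tilde\rho_I\colon G_I\to S^I$, $\tilde\rho_I(g)=\chi_g(e)$. $\mathcal{G}_I=G_I\ltimes\mathbb{O}$ (affine isometries with linear part in $G_I$), product $(g,T)(g',T')=(gg',gT'+T)$; its Lie algebra is $\mathfrak g(I)=\mathfrak g_I\oplus\mathbb{O}$, $\mathfrak g_I=\mathrm{Lie}(G_I)$, with bracket $[(\eta,t),(\eta',t')]=([\eta,\eta'],\eta t'-\eta't)$; $(\alpha\wedge\alpha)(\xi,\zeta)=[\alpha(\xi),\alpha(\zeta)]$, extended $\mathbb{C}$-bilinearly. $\tau_e$ is the automorphism of $\mathcal{G}_I$ given by conjugation by $(-L_e,0)$; it induces an automorphism of $\mathfrak g^{\mathbb{C}}(I)=\mathfrak g(I)\otimes\mathbb{C}$ with $\tau_e^4=\mathrm{Id}$, whose eigenspace for the eigenvalue $i^k$ is denoted $\mathfrak g_k^{\mathbb{C}}(I)$, $k\in\{-1,0,1,2\}$; explicitly $\mathfrak g_{\mp1}^{\mathbb{C}}=\ker(L_e\mp i\,\mathrm{Id})\subset\mathbb{O}\otimes\mathbb{C}$, and $\mathfrak g_0^{\mathbb{C}}(I)$, $\mathfrak g_2^{\mathbb{C}}(I)$ are the complexifications of the $+1$ and $-1$ eigenspaces of $\mathrm{Ad}\,L_e$ on $\mathfrak g_I$. For a $\mathfrak g(I)$-valued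 $1$-form $\alpha$, $\alpha_k$ is its component in $\mathfrak g_k^{\mathbb{C}}(I)$; with $z=u+iv$ on $\Omega$, $\alpha_k'=\alpha_k(\frac{\partial}{\partial z})dz$, $\alpha_k''=\alpha_k(\frac{\partial}{\partial\bar z})d\bar z$. For an immersion $X\colon\Omega\to\mathbb{O}$, $\rho_X(z)=\rho$ of the oriented tangent plane of $X$ at $z$. $X$ is $\rho$-harmonic if $\rho_X\colon\Omega\to S^6$ is harmonic, and $\omega_I$-isotropic if all its tangent planes lie in $Q_I$ (no condition if $I=\varnothing$). An $\omega_I$-isotropic lift is a map $U=(F,X)\colon\Omega\to\mathcal{G}_I$ such that $X$ is a conformal $\omega_I$-isotropic immersion and $\tilde\rho_I\circ F=\rho_X$; its Maurer–Cartan form is $U^{-1}dU=(F^{-1}dF,F^{-1}dX)$. *)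

theory Defs
  imports "HOL-Analysis.Analysis"
begin

section \<open>Octonions\<close>

type_synonym quat = "real \<times> real \<times> real \<times> real"

fun qmult :: "quat \<Rightarrow> quat \<Rightarrow> quat" where
  "qmult (a, b, c, d) (a', b', c', d') =
     (a * a' - b * b' - c * c' - d * d',
      a * b' + b * a' + c * d' - d * c',
      a * c' - b * d' + c * a' + d * b',
      a * d' + b * c' - c * b' + d * a')"

fun qcnj :: "quat \<Rightarrow> quat" where
  "qcnj (a, b, c, d) = (a, - b, - c, - d)"

text \<open>The index type \<open>8\<close> is the ring of integers modulo 8, so the coordinates of an octonion are
  indexed by \<open>0, \<dots>, 7\<close>, in the order of the canonical basis.\<close>

type_synonym oct = "real ^ 8"

type_synonym 'a aff8 = "(('a ^ 8) ^ 8) \<times> ('a ^ 8)"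

definition oct_unit :: "nat \<Rightarrow> oct" where
  "oct_unit i = axis (of_nat i) 1"

definition oct_pair :: "quat \<times> quat \<Rightarrow> oct" where
  "oct_pair = (\<lambda>((a, b, c, d), (a', b', c', d')).
     a *\<^sub>R oct_unit 0 + b *\<^sub>R oct_unit 1 + c *\<^sub>R oct_unit 2 + d *\<^sub>R oct_unit 3 +
     a' *\<^sub>R oct_unit 4 + b' *\<^sub>R oct_unit 5 + c' *\<^sub>R oct_unit 6 + d' *\<^sub>R oct_unit 7)"

definition oct_fst :: "oct \<Rightarrow> quat" where
  "oct_fst x = (x $ 0, x $ 1, x $ 2, x $ 3)"

definition oct_snd :: "oct \<Rightarrow> quat" where
  "oct_snd x = (x $ 4, x $ 5, x $ 6, x $ 7)"

definition oct_mult :: "oct \<Rightarrow> oct \<Rightarrow> oct" where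
  "oct_mult p q =
     (let x = oct_fst p; y = oct_snd p; x' = oct_fst q; y' = oct_snd q
      in oct_pair (qmult x x' - qmult y' (qcnj y), qmult x' y + qmult (qcnj x) y'))"

definition oct_cnj :: "oct \<Rightarrow> oct" where
  "oct_cnj p = oct_pair (qcnj (oct_fst p), - oct_snd p)"

definition oct_Im :: "oct \<Rightarrow> oct" where
  "oct_Im p = p - (p \<bullet> oct_unit 0) *\<^sub>R oct_unit 0"

definition ImO :: "oct set" where
  "ImO = {u. u \<bullet> oct_unit 0 = 0}"

definition oct_cross :: "oct \<Rightarrow> oct \<Rightarrow> oct" where
  "oct_cross q q' = - oct_Im (oct_mult q (oct_cnj q'))"

definition omega :: "nat \<Rightarrow> oct \<Rightarrow> oct \<Rightarrow> real" where
  "omega i q q' = q \<bullet> oct_mult (oct_unit i) q'"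

definition Lmat :: "oct \<Rightarrow> real ^ 8 ^ 8" where
  "Lmat u = matrix (oct_mult u)"


section \<open>Oriented planes\<close>

text \<open>An oriented plane is represented by the set of its oriented orthonormal bases.\<close>

type_synonym oplane = "(oct \<times> oct) set"

definition oriented_plane :: "oct \<Rightarrow> oct \<Rightarrow> oplane" where
  "oriented_plane p p' =
     {(q, q'). norm q = 1 \<and> norm q' = 1 \<and> q \<bullet> q' = 0 \<and>
        (\<exists>a b c d. q = a *\<^sub>R p + b *\<^sub>R p' \<and> q' = c *\<^sub>R p + d *\<^sub>R p' \<and> a * d - b * c > 0)}"

definition Gr2 :: "oplane set" where
  "Gr2 = {oriented_plane p p' | p p'. p \<noteq> p' \<and> independent {p, p'}}"

definition plane_space :: "oplane \<Rightarrow> oct set" where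
  "plane_space P = span (fst ` P)"

text \<open>The value \<open>oct_cross q q'\<close> is the same for all oriented orthonormal bases of an oriented plane.\<close>

definition rho :: "oplane \<Rightarrow> oct" where
  "rho P = (THE r. \<exists>(q, q')\<in>P. r = oct_cross q q')"

definition Q_planes :: "nat set \<Rightarrow> oplane set" where
  "Q_planes I = {P \<in> Gr2. \<forall>i\<in>I. \<forall>x\<in>plane_space P. \<forall>y\<in>plane_space P. omega i x y = 0}"


section \<open>The groups\<close>

inductive_set Spin7 :: "(real ^ 8 ^ 8) set" where
  gen: "u \<in> ImO \<Longrightarrow> norm u = 1 \<Longrightarrow> Lmat u \<in> Spin7"
| one: "mat 1 \<in> Spin7"
| mult: "g \<in> Spin7 \<Longrightarrow> h \<in> Spin7 \<Longrightarrow> g ** h \<in> Spin7"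
| inv: "g \<in> Spin7 \<Longrightarrow> matrix_inv g \<in> Spin7"

definition chi :: "real ^ 8 ^ 8 \<Rightarrow> oct \<Rightarrow> oct" where
  "chi g u = (THE w. w \<in> ImO \<and> Lmat w = g ** Lmat u ** matrix_inv g)"

definition G_grp :: "nat set \<Rightarrow> (real ^ 8 ^ 8) set" where
  "G_grp I = {g \<in> Spin7. \<forall>i\<in>I. g ** Lmat (oct_unit i) = Lmat (oct_unit i) ** g}"

definition e_vec :: "nat set \<Rightarrow> oct" where
  "e_vec I = oct_unit (card I + 1)"

definition rho_tilde :: "nat set \<Rightarrow> real ^ 8 ^ 8 \<Rightarrow> oct" where
  "rho_tilde I g = chi g (e_vec I)"

definition aff_grp :: "nat set \<Rightarrow> real aff8 set" where
  "aff_grp I = G_grp I \<times> UNIV"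

fun aff_mult :: "real aff8 \<Rightarrow> real aff8 \<Rightarrow> real aff8" where
  "aff_mult (g, T) (g', T') = (g ** g', g *v T' + T)"

fun aff_inv :: "real aff8 \<Rightarrow> real aff8" where
  "aff_inv (g, T) = (matrix_inv g, - (matrix_inv g *v T))"

definition tau :: "nat set \<Rightarrow> real aff8 \<Rightarrow> real aff8" where
  "tau I U = aff_mult (aff_mult (- Lmat (e_vec I), 0) U) (aff_inv (- Lmat (e_vec I), 0))"


section \<open>Smooth maps\<close>

text \<open>Both notions are meant for open sets \<open>S\<close>.\<close>

primrec Ck_on :: "nat \<Rightarrow> 'a::real_normed_vector set \<Rightarrow> ('a \<Rightarrow> 'b::real_normed_vector) \<Rightarrow> bool" where
  "Ck_on 0 S f \<longleftrightarrow> continuous_on S f"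
| "Ck_on (Suc k) S f \<longleftrightarrow> (\<forall>x\<in>S. f differentiable (at x)) \<and>
     (\<forall>v. Ck_on k S (\<lambda>x. frechet_derivative f (at x) v))"

definition smooth_on :: "'a::real_normed_vector set \<Rightarrow> ('a \<Rightarrow> 'b::real_normed_vector) \<Rightarrow> bool" where
  "smooth_on S f \<longleftrightarrow> (\<forall>k. Ck_on k S f)"


section \<open>The Lie algebras\<close>

text \<open>The Lie algebra of a closed matrix group: its tangent space at the identity.\<close>

definition lie_algebra :: "(real ^ 8 ^ 8) set \<Rightarrow> (real ^ 8 ^ 8) set" where
  "lie_algebra G =
     {\<eta>. \<exists>\<gamma> :: real \<Rightarrow> real ^ 8 ^ 8. smooth_on UNIV \<gamma> \<and> range \<gamma> \<subseteq> G \<and> \<gamma> 0 = mat 1 \<and>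
        (\<gamma> has_vector_derivative \<eta>) (at 0)}"

definition g_lin :: "nat set \<Rightarrow> (real ^ 8 ^ 8) set" where
  "g_lin I = lie_algebra (G_grp I)"

definition g_aff :: "nat set \<Rightarrow> real aff8 set" where
  "g_aff I = g_lin I \<times> UNIV"

fun lie_bracket :: "'a::comm_ring_1 aff8 \<Rightarrow> 'a aff8 \<Rightarrow> 'a aff8" where
  "lie_bracket (\<eta>, t) (\<eta>', t') = (\<eta> ** \<eta>' - \<eta>' ** \<eta>, \<eta> *v t' - \<eta>' *v t)"

fun cplx :: "real aff8 \<Rightarrow> complex aff8" where
  "cplx (\<eta>, t) = (\<chi> i j. complex_of_real (\<eta> $ i $ j), \<chi> i. complex_of_real (t $ i))"

fun Re_part :: "complex aff8 \<Rightarrow> real aff8" where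
  "Re_part (\<eta>, t) = (\<chi> i j. Re (\<eta> $ i $ j), \<chi> i. Re (t $ i))"

fun Im_part :: "complex aff8 \<Rightarrow> real aff8" where
  "Im_part (\<eta>, t) = (\<chi> i j. Im (\<eta> $ i $ j), \<chi> i. Im (t $ i))"

fun cscale :: "complex \<Rightarrow> complex aff8 \<Rightarrow> complex aff8" where
  "cscale c (\<eta>, t) = (\<chi> i j. c * \<eta> $ i $ j, c *s t)"

definition g_cplx :: "nat set \<Rightarrow> complex aff8 set" where
  "g_cplx I = {cplx a + cscale \<i> (cplx b) | a b. a \<in> g_aff I \<and> b \<in> g_aff I}"

text \<open>The formula for \<open>tau\<close> makes sense on the whole space of pairs (matrix, vector), where the
  differential at the identity is taken; \<open>dtau_cplx\<close> is its complex linear extension.\<close>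

definition dtau :: "nat set \<Rightarrow> real aff8 \<Rightarrow> real aff8" where
  "dtau I = frechet_derivative (tau I) (at (mat 1, 0))"

definition dtau_cplx :: "nat set \<Rightarrow> complex aff8 \<Rightarrow> complex aff8" where
  "dtau_cplx I v = cplx (dtau I (Re_part v)) + cscale \<i> (cplx (dtau I (Im_part v)))"

definition g_eig :: "nat set \<Rightarrow> int \<Rightarrow> complex aff8 set" where
  "g_eig I k = {v \<in> g_cplx I. dtau_cplx I v = cscale (\<i> powi k) v}"

text \<open>The component of \<open>v\<close> in \<open>g_eig I k\<close>, for \<open>k \<in> {-1, 0, 1, 2}\<close>, with respect to the
  eigenspace decomposition of \<open>g_cplx I\<close>.\<close>

definition g_comp :: "nat set \<Rightarrow> int \<Rightarrow> complex aff8 \<Rightarrow> complex aff8" where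
  "g_comp I k v =
     (THE w. \<exists>c. (\<forall>j\<in>{-1, 0, 1, 2}. c j \<in> g_eig I j) \<and> v = (\<Sum>j\<in>{-1, 0, 1, 2}. c j) \<and> w = c k)"


section \<open>Differential forms on a plane domain\<close>

text \<open>A 1-form maps a point and a tangent vector to a value.\<close>

definition smooth_one_form ::
    "(real \<times> real) set \<Rightarrow> 'v::real_normed_vector set \<Rightarrow> (real \<times> real \<Rightarrow> real \<times> real \<Rightarrow> 'v) \<Rightarrow> bool" where
  "smooth_one_form \<Omega> V \<alpha> \<longleftrightarrow>
     (\<forall>z\<in>\<Omega>. linear (\<alpha> z) \<and> range (\<alpha> z) \<subseteq> V) \<and> (\<forall>\<xi>. smooth_on \<Omega> (\<lambda>z. \<alpha> z \<xi>))"

definition ext_d ::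
    "(real \<times> real \<Rightarrow> real \<times> real \<Rightarrow> 'v::real_normed_vector) \<Rightarrow>
     real \<times> real \<Rightarrow> real \<times> real \<Rightarrow> real \<times> real \<Rightarrow> 'v" where
  "ext_d \<alpha> z \<xi> \<zeta> =
     frechet_derivative (\<lambda>w. \<alpha> w \<zeta>) (at z) \<xi> - frechet_derivative (\<lambda>w. \<alpha> w \<xi>) (at z) \<zeta>"

definition wedge_self ::
    "(real \<times> real \<Rightarrow> real \<times> real \<Rightarrow> 'a::comm_ring_1 aff8) \<Rightarrow>
     real \<times> real \<Rightarrow> real \<times> real \<Rightarrow> real \<times> real \<Rightarrow> 'a aff8" where
  "wedge_self \<alpha> z \<xi> \<zeta> = lie_bracket (\<alpha> z \<xi>) (\<alpha> z \<zeta>)"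

definition MC_equation ::
    "(real \<times> real) set \<Rightarrow>
     (real \<times> real \<Rightarrow> real \<times> real \<Rightarrow> 'a::real_normed_field aff8) \<Rightarrow> bool" where
  "MC_equation \<Omega> \<alpha> \<longleftrightarrow> (\<forall>z\<in>\<Omega>. \<forall>\<xi> \<zeta>. ext_d \<alpha> z \<xi> \<zeta> + wedge_self \<alpha> z \<xi> \<zeta> = 0)"

definition form_comp ::
    "nat set \<Rightarrow> int \<Rightarrow> (real \<times> real \<Rightarrow> real \<times> real \<Rightarrow> real aff8) \<Rightarrow>
     real \<times> real \<Rightarrow> real \<times> real \<Rightarrow> complex aff8" where
  "form_comp I k \<alpha> z \<xi> = g_comp I k (cplx (\<alpha> z \<xi>))"

text \<open>The parts \<open>\<beta>(\<partial>/\<partial>z) dz\<close> and \<open>\<beta>(\<partial>/\<partial>\<bar>z) d\<bar>z\<close> of a complex-valued 1-form \<open>\<beta>\<close>, with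
  \<open>\<partial>/\<partial>z = (\<partial>/\<partial>u - i \<partial>/\<partial>v)/2\<close> and \<open>\<partial>/\<partial>\<bar>z = (\<partial>/\<partial>u + i \<partial>/\<partial>v)/2\<close>.\<close>

definition dz_part ::
    "(real \<times> real \<Rightarrow> real \<times> real \<Rightarrow> complex aff8) \<Rightarrow>
     real \<times> real \<Rightarrow> real \<times> real \<Rightarrow> complex aff8" where
  "dz_part \<beta> z \<xi> =
     cscale (Complex (fst \<xi>) (snd \<xi>)) (cscale (1 / 2) (\<beta> z (1, 0) - cscale \<i> (\<beta> z (0, 1))))"

definition dzbar_part ::
    "(real \<times> real \<Rightarrow> real \<times> real \<Rightarrow> complex aff8) \<Rightarrow>
     real \<times> real \<Rightarrow> real \<times> real \<Rightarrow> complex aff8" where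
  "dzbar_part \<beta> z \<xi> =
     cscale (cnj (Complex (fst \<xi>) (snd \<xi>))) (cscale (1 / 2) (\<beta> z (1, 0) + cscale \<i> (\<beta> z (0, 1))))"

definition extended_form ::
    "nat set \<Rightarrow> (real \<times> real \<Rightarrow> real \<times> real \<Rightarrow> real aff8) \<Rightarrow> complex \<Rightarrow>
     real \<times> real \<Rightarrow> real \<times> real \<Rightarrow> complex aff8" where
  "extended_form I \<alpha> l z \<xi> =
     cscale (l powi (-2)) (dz_part (form_comp I 2 \<alpha>) z \<xi>) +
     cscale (l powi (-1)) (dz_part (form_comp I (-1) \<alpha>) z \<xi>) +
     form_comp I 0 \<alpha> z \<xi> +
     cscale l (dzbar_part (form_comp I 1 \<alpha>) z \<xi>) +
     cscale (l powi 2) (dzbar_part (form_comp I 2 \<alpha>) z \<xi>)"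


section \<open>Immersions and lifts\<close>

definition du :: "(real \<times> real \<Rightarrow> 'b::real_normed_vector) \<Rightarrow> real \<times> real \<Rightarrow> 'b" where
  "du f z = frechet_derivative f (at z) (1, 0)"

definition dv :: "(real \<times> real \<Rightarrow> 'b::real_normed_vector) \<Rightarrow> real \<times> real \<Rightarrow> 'b" where
  "dv f z = frechet_derivative f (at z) (0, 1)"

definition immersion_on :: "(real \<times> real) set \<Rightarrow> (real \<times> real \<Rightarrow> oct) \<Rightarrow> bool" where
  "immersion_on \<Omega> X \<longleftrightarrow> smooth_on \<Omega> X \<and> (\<forall>z\<in>\<Omega>. inj (frechet_derivative X (at z)))"

definition conformal_on :: "(real \<times> real) set \<Rightarrow> (real \<times> real \<Rightarrow> oct) \<Rightarrow> bool" where
  "conformal_on \<Omega> X \<longleftrightarrow> (\<forall>z\<in>\<Omega>. norm (du X z) = norm (dv X z) \<and> du X z \<bullet> dv X z = 0)"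

definition tangent_plane :: "(real \<times> real \<Rightarrow> oct) \<Rightarrow> real \<times> real \<Rightarrow> oplane" where
  "tangent_plane X z = oriented_plane (du X z) (dv X z)"

definition rho_map :: "(real \<times> real \<Rightarrow> oct) \<Rightarrow> real \<times> real \<Rightarrow> oct" where
  "rho_map X z = rho (tangent_plane X z)"

definition isotropic_on :: "nat set \<Rightarrow> (real \<times> real) set \<Rightarrow> (real \<times> real \<Rightarrow> oct) \<Rightarrow> bool" where
  "isotropic_on I \<Omega> X \<longleftrightarrow> (\<forall>z\<in>\<Omega>. tangent_plane X z \<in> Q_planes I)"

text \<open>The Levi-Civita connection of the sphere, pulled back by a sphere-valued map \<open>\<phi>\<close>, is the
  tangential part of the flat derivative. The tension field is the trace of the covariant derivative
  of the differential of \<open>\<phi>\<close> for the flat metric on the plane; \<open>\<phi>\<close> is harmonic if it vanishes.\<close>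

definition tangential :: "oct \<Rightarrow> oct \<Rightarrow> oct" where
  "tangential p w = w - (w \<bullet> p) *\<^sub>R p"

definition tension :: "(real \<times> real \<Rightarrow> oct) \<Rightarrow> real \<times> real \<Rightarrow> oct" where
  "tension \<phi> z = tangential (\<phi> z) (du (du \<phi>) z) + tangential (\<phi> z) (dv (dv \<phi>) z)"

definition harmonic_to_sphere_on :: "(real \<times> real) set \<Rightarrow> (real \<times> real \<Rightarrow> oct) \<Rightarrow> bool" where
  "harmonic_to_sphere_on \<Omega> \<phi> \<longleftrightarrow>
     smooth_on \<Omega> \<phi> \<and> \<phi> ` \<Omega> \<subseteq> ImO \<inter> sphere 0 1 \<and> (\<forall>z\<in>\<Omega>. tension \<phi> z = 0)"

definition rho_harmonic_on :: "(real \<times> real) set \<Rightarrow> (real \<times> real \<Rightarrow> oct) \<Rightarrow> bool" where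
  "rho_harmonic_on \<Omega> X \<longleftrightarrow> harmonic_to_sphere_on \<Omega> (rho_map X)"

definition isotropic_lift ::
    "nat set \<Rightarrow> (real \<times> real) set \<Rightarrow> (real \<times> real \<Rightarrow> real ^ 8 ^ 8) \<Rightarrow> (real \<times> real \<Rightarrow> oct) \<Rightarrow> bool" where
  "isotropic_lift I \<Omega> F X \<longleftrightarrow>
     smooth_on \<Omega> F \<and> (\<forall>z\<in>\<Omega>. (F z, X z) \<in> aff_grp I) \<and>
     immersion_on \<Omega> X \<and> conformal_on \<Omega> X \<and> isotropic_on I \<Omega> X \<and>
     (\<forall>z\<in>\<Omega>. rho_tilde I (F z) = rho_map X z)"

definition MC_form ::
    "(real \<times> real \<Rightarrow> real ^ 8 ^ 8) \<Rightarrow> (real \<times> real \<Rightarrow> oct) \<Rightarrow>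
     real \<times> real \<Rightarrow> real \<times> real \<Rightarrow> real aff8" where
  "MC_form F X z \<xi> =
     (matrix_inv (F z) ** frechet_derivative F (at z) \<xi>,
      matrix_inv (F z) *v frechet_derivative X (at z) \<xi>)"

definition is_MC_form_of ::
    "(real \<times> real) set \<Rightarrow> (real \<times> real \<Rightarrow> real \<times> real \<Rightarrow> real aff8) \<Rightarrow>
     (real \<times> real \<Rightarrow> real ^ 8 ^ 8) \<Rightarrow> (real \<times> real \<Rightarrow> oct) \<Rightarrow> bool" where
  "is_MC_form_of \<Omega> \<alpha> F X \<longleftrightarrow> (\<forall>z\<in>\<Omega>. \<alpha> z = MC_form F X z)"

end

theory Submission
  imports Defs "HOL-Complex_Analysis.Riemann_Mapping"
begin

text \<open>
  Write \<open>\<alpha> = (A, t)\<close> and \<open>J = L\<^sub>e\<close>. A pair \<open>(F, X)\<close> has Maurer-Cartan form \<open>\<alpha>\<close> when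
  \<open>dF = F A\<close> and \<open>dX = F t\<close>, and the symmetry of the second derivatives of \<open>F\<close> and \<open>X\<close> is then the
  equation \<open>d\<alpha> + \<alpha> \<and> \<alpha> = 0\<close>. An orthonormal pair \<open>q, q'\<close> satisfies \<open>q' = r q\<close> for exactly one
  imaginary unit \<open>r\<close>, which is the value of \<open>\<rho>\<close> on the plane, and the lift condition says that left
  multiplication by \<open>\<rho>\<^sub>X\<close> is \<open>F J F\<inverse>\<close>. So \<open>(F, X)\<close> is a lift if and only if \<open>t(\<partial>/\<partial>v) = J t(\<partial>/\<partial>u) \<noteq> 0\<close>
  (\<open>lift_imp_holomorphic\<close>, \<open>holomorphic_imp_lift\<close>); the equation is the vanishing of the
  \<open>(0,1)\<close>-part of \<open>\<alpha>\<^sub>-\<^sub>1\<close>, and the inequality is the non-vanishing of its \<open>(1,0)\<close>-part.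

  In the other direction a flat \<open>\<alpha>\<close> has to be integrated. On a convex domain the equation is solved along
  rays, and a Gronwall estimate shows that flatness makes the result a solution in all directions
  (\<open>flat_system_convex\<close>); the Riemann mapping theorem transports this to simply connected domains
  (\<open>flat_system_simply_connected\<close>). The solution stays in the group (\<open>solution_in_group\<close>) because Spin(7) is
  cut out by closed conditions: it consists of the orthogonal matrices that normalize the space of left
  multiplications by imaginary octonions (\<open>Spin7_iff\<close>).

  For harmonicity, split \<open>A = A\<^sub>0 + A\<^sub>2\<close> into the parts commuting and anticommuting with \<open>J\<close>. Differentiating
  \<open>F J F\<inverse>\<close> twice shows that left multiplication by the tension of \<open>\<rho>\<^sub>X\<close> is \<open>F (2 H J) F\<inverse>\<close>, where \<open>H\<close> is the
  covariant divergence of \<open>A\<^sub>2\<close> with respect to \<open>A\<^sub>0\<close> (\<open>tension_r\<close>). On the other side, \<open>\<alpha>\<^sub>\<lambda>\<close> arises from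
  \<open>\<alpha>\<close> by a rotation of \<open>(A\<^sub>2(\<partial>/\<partial>u), A\<^sub>2(\<partial>/\<partial>v))\<close> through a complex angle \<open>\<theta>\<close> with
  \<open>sin \<theta> = \<i>(\<lambda>\<^sup>2 - \<lambda>\<^sup>-\<^sup>2)/2\<close> and of \<open>(t(\<partial>/\<partial>u), t(\<partial>/\<partial>v))\<close> through \<open>\<theta>/2\<close>. If \<open>\<alpha>\<close> is flat, everything in
  the curvature of \<open>\<alpha>\<^sub>\<lambda>\<close> cancels except \<open>- sin \<theta> H\<close> (\<open>ext_curvature\<close>). Hence both conditions of the second
  claim say \<open>H = 0\<close>.
\<close>

section \<open>Flat linear systems of total differential equations\<close>

lemma gronwall_interval:
  fixes D :: "real \<Rightarrow> 'e::real_normed_vector"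
  assumes M: "M > 0" and \<epsilon>: "\<epsilon> \<ge> 0" and D0: "D 0 = 0"
    and D': "\<And>s. s \<in> {0..1} \<Longrightarrow> (D has_vector_derivative D' s) (at s within {0..1})"
    and bnd: "\<And>s. s \<in> {0..1} \<Longrightarrow> norm (D' s) \<le> M * norm (D s) + \<epsilon>"
    and t: "t \<in> {0..1}"
  shows "norm (D t) \<le> 2 * \<epsilon> * exp (2 * M * t)"
proof -
  have contD: "continuous_on {0..1} D"
    using D' by (rule continuous_on_vector_derivative)
  \<comment> \<open>The maximum of \<open>w\<close> bounds \<open>D\<close> by an exponential; inserted into the inequality for \<open>D'\<close> it bounds itself.\<close>
  define w where "w s = norm (D s) * exp (- (2 * M * s))" for s
  have "continuous_on {0..1} w"
    unfolding w_def by (intro continuous_intros contD)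
  then obtain m where m: "m \<in> {0..1}" "\<And>s. s \<in> {0..1} \<Longrightarrow> w s \<le> w m"
    using continuous_attains_sup[of "{0..1}" w] by auto
  have D_le: "norm (D s) \<le> w m * exp (2 * M * s)" if "s \<in> {0..1}" for s
  proof -
    have "norm (D s) = w s * exp (2 * M * s)"
      by (simp add: w_def exp_minus)
    then show ?thesis using m(2)[OF that] by simp
  qed
  have wm0: "w m \<ge> 0" by (simp add: w_def)
  have "w m \<le> 2 * \<epsilon>"
  proof (cases "m = 0")
    case True
    then show ?thesis using D0 \<epsilon> by (simp add: w_def)
  next
    case False
    then have m0: "0 < m" using m by auto
    \<comment> \<open>With the rate \<open>2 * M\<close> in the exponent, integration of \<open>M * w m * exp (2 * M * s)\<close> gains the factor \<open>1 / 2\<close>.\<close>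
    define \<phi> where "\<phi> s = w m / 2 * exp (2 * M * s) + \<epsilon> * s" for s
    have "norm (D m - D 0) \<le> \<phi> m - \<phi> 0"
    proof (rule differentiable_bound_general[OF m0, where f' = D' and \<phi>' = "\<lambda>s. M * (w m * exp (2 * M * s)) + \<epsilon>"])
      show "continuous_on {0..m} D" using contD m by (auto intro: continuous_on_subset)
      show "continuous_on {0..m} \<phi>" unfolding \<phi>_def by (intro continuous_intros)
      fix s assume s: "0 < s" "s < m"
      then have s1: "s \<in> {0..1}" using m by auto
      have "s \<in> interior {0..1::real}" using s m by auto
      then show "(D has_vector_derivative D' s) (at s)"
        using D'[OF s1] at_within_interior by metis
      show "(\<phi> has_vector_derivative M * (w m * exp (2 * M * s)) + \<epsilon>) (at s)"
        unfolding \<phi>_def has_real_derivative_iff_has_vector_derivative[symmetric]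
        by (auto intro!: derivative_eq_intros)
      show "norm (D' s) \<le> M * (w m * exp (2 * M * s)) + \<epsilon>"
        using bnd[OF s1] mult_left_mono[OF D_le[OF s1], of M] M by linarith
    qed
    also have "\<phi> m - \<phi> 0 \<le> w m / 2 * exp (2 * M * m) + \<epsilon> * exp (2 * M * m)"
    proof -
      have "1 \<le> exp (2 * M * m)" using M m0 by simp
      then have "\<epsilon> * m \<le> \<epsilon> * exp (2 * M * m)"
        using m(1) \<epsilon> by (intro mult_left_mono) (auto intro: order_trans)
      then show ?thesis using wm0 by (simp add: \<phi>_def)
    qed
    finally have "norm (D m) \<le> (w m / 2 + \<epsilon>) * exp (2 * M * m)"
      using D0 by (simp add: algebra_simps)
    then have "w m \<le> w m / 2 + \<epsilon>"
      unfolding w_def[of m] by (simp add: exp_minus field_simps)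
    then show ?thesis by simp
  qed
  then show ?thesis
    by (intro order_trans[OF D_le[OF t]] mult_right_mono) auto
qed

text \<open>The solution is the sum of the iterated integrals \<open>T n\<close>, which are dominated by the exponential series.\<close>

lemma linear_ode_exists:
  fixes C :: "real \<Rightarrow> ('e::banach \<Rightarrow>\<^sub>L 'e)"
  assumes C: "continuous_on {0..1} C"
  obtains Y where "Y 0 = y0"
    and "\<And>s. s \<in> {0..1} \<Longrightarrow> (Y has_vector_derivative blinfun_apply (C s) (Y s)) (at s within {0..1})"
proof -
  obtain M where M: "M > 0" "\<And>s. s \<in> {0..1} \<Longrightarrow> norm (C s) \<le> M"
  proof -
    have "bounded (C ` {0..1})"
      using C compact_continuous_image compact_imp_bounded compact_Icc by blast
    then show ?thesis using that unfolding bounded_pos by auto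
  qed
  define T where "T n = rec_nat (\<lambda>_. y0) (\<lambda>_ f s. integral {0..s} (\<lambda>r. blinfun_apply (C r) (f r))) n" for n :: nat
  have T0: "T 0 = (\<lambda>_. y0)" and TS: "T (Suc n) = (\<lambda>s. integral {0..s} (\<lambda>r. blinfun_apply (C r) (T n r)))" for n
    by (simp_all add: T_def)
  have contT: "continuous_on {0..1} (T n)" for n
  proof (induction n)
    case 0 show ?case by (simp add: T0)
  next
    case (Suc n)
    then have "continuous_on {0..1} (\<lambda>r. blinfun_apply (C r) (T n r))"
      by (intro continuous_intros C)
    then show ?case unfolding TS
      by (intro indefinite_integral_continuous_1 integrable_continuous_interval)
  qed
  have derT: "(T (Suc n) has_vector_derivative blinfun_apply (C s) (T n s)) (at s within {0..1})"
    if "s \<in> {0..1}" for n s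
    unfolding TS using that
    by (intro integral_has_vector_derivative continuous_intros C contT)
  have TS_0: "T (Suc n) 0 = 0" for n by (simp add: TS)
  define K where "K n s = norm y0 * ((M * s) ^ n / fact n)" for n and s :: real
  have bndT: "norm (T n s) \<le> K n s" if "s \<in> {0..1}" for n s
    using that
  proof (induction n arbitrary: s)
    case 0 then show ?case by (simp add: T0 K_def)
  next
    case (Suc n)
    show ?case
    proof (cases "s = 0")
      case True then show ?thesis by (simp add: TS_0 K_def)
    next
      case False
      then have s0: "0 < s" using Suc by auto
      have "norm (T (Suc n) s - T (Suc n) 0) \<le> K (Suc n) s - K (Suc n) 0"
      proof (rule differentiable_bound_general[OF s0, where f' = "\<lambda>r. blinfun_apply (C r) (T n r)" and \<phi>' = "\<lambda>r. M * K n r"])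
        show "continuous_on {0..s} (T (Suc n))" by (rule continuous_on_subset[OF contT]) (use Suc.prems in auto)
        show "continuous_on {0..s} (K (Suc n))" unfolding K_def by (intro continuous_intros) auto
        fix r assume r: "0 < r" "r < s"
        then have r1: "r \<in> {0..1}" using Suc.prems by auto
        have "r \<in> interior {0..1::real}" using r Suc.prems by auto
        then show "(T (Suc n) has_vector_derivative blinfun_apply (C r) (T n r)) (at r)"
          using derT[OF r1] at_within_interior by metis
        have *: "real (Suc n) * x / fact (Suc n) = x / fact n" for x :: real
          by (subst fact_Suc) (simp del: of_nat_Suc)
        have "(K (Suc n) has_real_derivative norm y0 * (real (Suc n) * ((M * r) ^ n * M) / fact (Suc n))) (at r)"
          unfolding K_def by (auto intro!: derivative_eq_intros simp del: fact_Suc) (cases n; simp add: algebra_simps)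
        then show "(K (Suc n) has_vector_derivative M * K n r) (at r)"
          unfolding has_real_derivative_iff_has_vector_derivative[symmetric] *
          by (simp add: K_def mult_ac)
        show "norm (blinfun_apply (C r) (T n r)) \<le> M * K n r"
        proof -
          have "norm (blinfun_apply (C r) (T n r)) \<le> norm (C r) * norm (T n r)"
            by (rule norm_blinfun)
          also have "\<dots> \<le> M * K n r"
            using M r1 Suc.IH[OF r1] by (intro mult_mono) auto
          finally show ?thesis .
        qed
      qed
      then show ?thesis by (simp add: TS_0 K_def)
    qed
  qed
  have K1: "K n s \<le> norm y0 * (M ^ n / fact n)" if "s \<in> {0..1}" for n s
  proof -
    have "(M * s) ^ n \<le> M ^ n"
      using M that by (intro power_mono) (auto simp: mult_le_cancel_left1)
    then show ?thesis unfolding K_def by (intro mult_left_mono divide_right_mono) auto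
  qed
  have summ: "summable (\<lambda>n. norm y0 * (M ^ n / fact n))"
    using summable_exp[of M] by (intro summable_mult) (simp add: field_simps)
  have sumsT: "summable (\<lambda>n. T n s)" if "s \<in> {0..1}" for s
    using order_trans[OF bndT[OF that] K1[OF that]] by (intro summable_comparison_test[OF _ summ]) auto
  define D where "D n = (case n of 0 \<Rightarrow> (\<lambda>s. 0) | Suc m \<Rightarrow> (\<lambda>s. blinfun_apply (C s) (T m s)))" for n :: nat
  have D0: "D 0 = (\<lambda>s. 0)" and DS: "D (Suc m) = (\<lambda>s. blinfun_apply (C s) (T m s))" for m
    by (simp_all add: D_def)
  define Y where "Y s = (\<Sum>n. T n s)" for s
  have CY: "(\<lambda>n. D n s) sums (blinfun_apply (C s) (Y s))" if "s \<in> {0..1}" for s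
  proof -
    have "(\<lambda>n. blinfun_apply (C s) (T n s)) sums (blinfun_apply (C s) (Y s))"
      unfolding Y_def by (intro bounded_linear.sums[OF blinfun.bounded_linear_right] summable_sums sumsT that)
    then show ?thesis using sums_Suc[of "\<lambda>n. D n s"] by (simp add: D0 DS)
  qed
  define b where "b n = (case n of 0 \<Rightarrow> 0 | Suc m \<Rightarrow> M * (norm y0 * (M ^ m / fact m)))" for n :: nat
  have "uniform_limit {0..1} (\<lambda>n s. \<Sum>i<n. D i s) (\<lambda>s. suminf (\<lambda>i. D i s)) sequentially"
  proof (rule Weierstrass_m_test[where M = b])
    show "norm (D n s) \<le> b n" if "s \<in> {0..1}" for n s
    proof (cases n)
      case 0 then show ?thesis by (simp add: D0 b_def)
    next
      case (Suc m)
      have "norm (blinfun_apply (C s) (T m s)) \<le> norm (C s) * norm (T m s)"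
        by (rule norm_blinfun)
      also have "\<dots> \<le> M * (norm y0 * (M ^ m / fact m))"
        using M that order_trans[OF bndT[OF that] K1[OF that]] by (intro mult_mono) auto
      finally show ?thesis by (simp add: Suc DS b_def)
    qed
    show "summable b"
      using summable_mult[OF summ, of M] by (subst summable_Suc_iff[symmetric]) (simp add: b_def)
  qed
  then have ulim: "uniform_limit {0..1} (\<lambda>n s. \<Sum>i<n. D i s) (\<lambda>s. blinfun_apply (C s) (Y s)) sequentially"
    by (rule uniform_limit_cong'[THEN iffD1, rotated -1]) (use CY sums_unique in fastforce)+
  have "\<exists>g. \<forall>s\<in>{0..1}. (\<lambda>n. T n s) sums (g s) \<and>
      (g has_derivative (\<lambda>h. h *\<^sub>R blinfun_apply (C s) (Y s))) (at s within {0..1})"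
  proof (rule has_derivative_series[where f' = "\<lambda>n s h. h *\<^sub>R D n s" and x = 0])
    show "(T n has_derivative (\<lambda>h. h *\<^sub>R D n s)) (at s within {0..1})" if "s \<in> {0..1}" for n s
      using derT[OF that] by (cases n) (auto simp: T0 D0 DS has_vector_derivative_def)
    show "\<forall>\<^sub>F n in sequentially. \<forall>s\<in>{0..1}. \<forall>h. norm ((\<Sum>i<n. h *\<^sub>R D i s) - h *\<^sub>R blinfun_apply (C s) (Y s)) \<le> e * norm h"
      if "e > 0" for e :: real
      using uniform_limitD[OF ulim that]
    proof eventually_elim
      case (elim n)
      show ?case
      proof (intro ballI allI)
        fix s h :: real assume s: "s \<in> {0..1}"
        have "norm ((\<Sum>i<n. h *\<^sub>R D i s) - h *\<^sub>R blinfun_apply (C s) (Y s))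
            = \<bar>h\<bar> * norm ((\<Sum>i<n. D i s) - blinfun_apply (C s) (Y s))"
          by (simp flip: scaleR_sum_right scaleR_diff_right)
        also have "\<dots> \<le> \<bar>h\<bar> * e"
          using elim s by (intro mult_left_mono) (auto simp: dist_norm less_imp_le)
        finally show "norm ((\<Sum>i<n. h *\<^sub>R D i s) - h *\<^sub>R blinfun_apply (C s) (Y s)) \<le> e * norm h"
          by (simp add: mult.commute)
      qed
    qed
    show "(\<lambda>n. T n 0) sums Y 0" unfolding Y_def by (intro summable_sums sumsT) auto
  qed auto
  then obtain g where g: "\<And>s. s \<in> {0..1} \<Longrightarrow> (\<lambda>n. T n s) sums (g s)"
      "\<And>s. s \<in> {0..1} \<Longrightarrow> (g has_derivative (\<lambda>h. h *\<^sub>R blinfun_apply (C s) (Y s))) (at s within {0..1})"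
    by blast
  have gY: "g s = Y s" if "s \<in> {0..1}" for s
    using g(1)[OF that] by (simp add: Y_def sums_iff)
  have "g 0 = y0"
  proof -
    have "(\<lambda>n. T n 0) sums (T 0 0)"
      using sums_finite[of "{0}" "\<lambda>n. T n 0"] TS_0 by (auto simp: gr0_conv_Suc)
    then show ?thesis using g(1)[of 0] sums_unique2 by (fastforce simp: T0)
  qed
  moreover have "(g has_vector_derivative blinfun_apply (C s) (g s)) (at s within {0..1})" if "s \<in> {0..1}" for s
    using g(2)[OF that] gY[OF that] by (simp add: has_vector_derivative_def)
  ultimately show ?thesis using that by blast
qed


text \<open>The solution at \<open>x\<close> is the value at time 1 of the solution \<open>Y x\<close> of the ordinary equation along the ray
  from 0 to \<open>x\<close>. For a displacement \<open>h\<close> the expected change of \<open>Y z\<close> at time \<open>s\<close> is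
  \<open>s B (A (s z) h) (Y z s)\<close>. Flatness is what makes this satisfy the linearized ray equation, so that the error
  \<open>D\<close> obeys the same linear equation up to a term of order \<open>o(h)\<close>, and Gronwall's inequality applies.\<close>

lemma flat_system_convex:
  fixes S :: "'a::euclidean_space set" and B :: "'v::real_normed_vector \<Rightarrow> 'e::banach \<Rightarrow> 'e"
    and A :: "'a \<Rightarrow> ('a \<Rightarrow>\<^sub>L 'v)" and A' :: "'a \<Rightarrow> ('a \<Rightarrow>\<^sub>L 'a \<Rightarrow>\<^sub>L 'v)"
  assumes "bounded_bilinear B" and S: "open S" "convex S" "0 \<in> S"
    and A': "\<And>x. x \<in> S \<Longrightarrow> (A has_derivative blinfun_apply (A' x)) (at x)"
    and cont: "continuous_on S A'"
    and flat: "\<And>x h k y. x \<in> S \<Longrightarrow>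
      B (A' x h k - A' x k h) y = B (A x h) (B (A x k) y) - B (A x k) (B (A x h) y)"
  obtains y where "y 0 = y0" and "\<And>x. x \<in> S \<Longrightarrow> (y has_derivative (\<lambda>h. B (A x h) (y x))) (at x)"
proof -
  interpret B: bounded_bilinear B by fact
  have contA: "continuous_on S A"
    by (rule has_derivative_continuous_on[OF has_derivative_at_withinI[OF A']])
  have ray: "s *\<^sub>R x \<in> S" if "x \<in> S" "s \<in> {0..1}" for x s
    using convexD_alt[OF S(2) S(3) that(1), of s] that by auto
  have "\<exists>Y. Y 0 = y0 \<and> (\<forall>s\<in>{0..1}. (Y has_vector_derivative B (A (s *\<^sub>R x) x) (Y s)) (at s within {0..1}))"
    if x: "x \<in> S" for x
  proof -
    have "continuous_on {0..1} (\<lambda>s. A (s *\<^sub>R x))"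
      by (rule continuous_on_compose2[OF contA]) (use ray[OF x] in \<open>auto intro!: continuous_intros\<close>)
    then have "continuous_on {0..1} (\<lambda>s. B.prod_right (A (s *\<^sub>R x) x))"
      by (intro bounded_linear.continuous_on[OF B.bounded_linear_prod_right] continuous_intros)
    from linear_ode_exists[OF this, of y0] obtain Y where "Y 0 = y0"
      "\<And>s. s \<in> {0..1} \<Longrightarrow> (Y has_vector_derivative B (A (s *\<^sub>R x) x) (Y s)) (at s within {0..1})"
      unfolding B.prod_right.rep_eq by metis
    then show ?thesis by blast
  qed
  then obtain Y where Y0: "\<And>x. x \<in> S \<Longrightarrow> Y x 0 = y0"
    and Y': "\<And>x s. x \<in> S \<Longrightarrow> s \<in> {0..1} \<Longrightarrow>
      (Y x has_vector_derivative B (A (s *\<^sub>R x) x) (Y x s)) (at s within {0..1})"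
    by metis
  obtain \<kappa> where \<kappa>: "\<kappa> > 0" "\<And>a b. norm (B a b) \<le> norm a * norm b * \<kappa>"
    using B.pos_bounded by blast
  have "((\<lambda>x. Y x 1) has_derivative (\<lambda>h. B (A z h) (Y z 1))) (at z)" if z: "z \<in> S" for z
    unfolding has_derivative_at_alt
  proof (intro conjI allI impI)
    show "bounded_linear (\<lambda>h. B (A z h) (Y z 1))"
      using bounded_linear_compose[OF B.bounded_linear_left blinfun.bounded_linear_right] .
    fix e :: real assume e: "e > 0"
    have segS: "closed_segment 0 z \<subseteq> S"
      using S(2,3) z by (simp add: closed_segment_subset)
    obtain \<delta> where \<delta>: "\<delta> > 0" "(\<Union>x\<in>closed_segment 0 z. cball x \<delta>) \<subseteq> S"
      using compact_subset_open_imp_cball_epsilon_subset[OF _ S(1) segS] by auto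
    define K where "K = (\<Union>x\<in>closed_segment 0 z. cball x \<delta>)"
    have "K = {x + k | x k. x \<in> closed_segment 0 z \<and> k \<in> cball 0 \<delta>}"
    proof -
      have "y \<in> cball x \<delta> \<longleftrightarrow> (\<exists>k\<in>cball 0 \<delta>. y = x + k)" for x y :: 'a
        by (auto simp: dist_norm norm_minus_commute intro!: bexI[of _ "y - x"])
      then show ?thesis unfolding K_def by blast
    qed
    then have K: "compact K" "K \<subseteq> S"
      using compact_sums[of "closed_segment 0 z" "cball 0 \<delta>"] \<delta> by (auto simp: K_def)
    have "bounded (A ` K)" "bounded (A' ` K)" "bounded (Y z ` {0..1})"
      using K contA cont continuous_on_vector_derivative[OF Y'[OF z]]
      by (auto intro!: compact_imp_bounded compact_continuous_image intro: continuous_on_subset)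
    then obtain N0 N1 NY where N0: "N0 > 0" "\<And>x. x \<in> K \<Longrightarrow> norm (A x) \<le> N0"
      and N1: "N1 > 0" "\<And>x. x \<in> K \<Longrightarrow> norm (A' x) \<le> N1"
      and NY: "NY > 0" "\<And>s. s \<in> {0..1} \<Longrightarrow> norm (Y z s) \<le> NY"
      unfolding bounded_pos by auto
    define M where "M = N0 * (norm z + 1) * \<kappa>"
    define G where "G = 2 * exp (2 * M)"
    define a where "a = NY * \<kappa> * norm z"
    \<comment> \<open>\<open>a\<close> and \<open>C1\<close> collect the coefficients of \<open>\<epsilon> * norm h\<close> and of \<open>(norm h)\<^sup>2\<close> in the bound for \<open>E\<close> below.\<close>
    define C1 where "C1 = NY * \<kappa> * N1 + (N1 * (norm z + 1) + N0) * (N0 * NY * \<kappa>) * \<kappa>"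
    have pos: "M > 0" "G > 0" "a \<ge> 0" "C1 > 0"
      using N0 N1 NY \<kappa> by (auto simp: M_def G_def a_def C1_def intro!: add_pos_pos mult_pos_pos add_nonneg_pos)
    define \<epsilon> where "\<epsilon> = e / (2 * G * (a + 1))"
    have \<epsilon>: "\<epsilon> > 0" using pos e by (simp add: \<epsilon>_def)
    have "uniformly_continuous_on K A'"
      using K cont compact_uniformly_continuous continuous_on_subset by blast
    then obtain d where d: "d > 0" "\<And>x x'. x \<in> K \<Longrightarrow> x' \<in> K \<Longrightarrow> dist x' x < d \<Longrightarrow> dist (A' x') (A' x) < \<epsilon>"
      using \<epsilon> unfolding uniformly_continuous_on_def by metis
    define d' where "d' = min (min d \<delta>) (min 1 (e / (2 * G * (C1 + 1))))"
    have "d' > 0" using d \<delta> e pos by (auto simp: d'_def)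
    moreover have "norm (Y w 1 - Y z 1 - B (A z (w - z)) (Y z 1)) \<le> e * norm (w - z)"
      if w: "norm (w - z) < d'" for w
    proof -
      define h where "h = w - z"
      have w_eq: "w = z + h" by (simp add: h_def)
      have h: "norm h < d" "norm h < \<delta>" "norm h < 1" "norm h < e / (2 * G * (C1 + 1))"
        using w by (auto simp: h_def d'_def)
      have "w \<in> cball z \<delta>" using h by (simp add: w_eq dist_norm)
      moreover have "z \<in> closed_segment 0 z" by simp
      ultimately have wS: "w \<in> S" using \<delta>(2) by blast
      have xK: "cball (s *\<^sub>R z) \<delta> \<subseteq> K" if "s \<in> {0..1}" for s
        using that unfolding K_def by (auto simp: closed_segment_def)
      define q where "q s = A (s *\<^sub>R w) - A (s *\<^sub>R z)" for s
      define r where "r s = A (s *\<^sub>R w) - A (s *\<^sub>R z) - A' (s *\<^sub>R z) (s *\<^sub>R h)" for s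
      have qr: "norm (q s) \<le> N1 * norm h" "norm (r s) \<le> \<epsilon> * norm h" if s: "s \<in> {0..1}" for s
      proof -
        define b where "b = cball (s *\<^sub>R z) (norm h)"
        have b: "b \<subseteq> K" using xK[OF s] h unfolding b_def by auto
        have sh: "norm (s *\<^sub>R h) \<le> norm h" using s by (simp add: mult_left_le_one_le)
        have mem: "s *\<^sub>R z \<in> b" "s *\<^sub>R w \<in> b"
          using sh by (auto simp: b_def w_eq dist_norm scaleR_add_right)
        have derb: "(A has_derivative blinfun_apply (A' x)) (at x within b)" if "x \<in> b" for x
          using A' b K that by (auto intro: has_derivative_at_withinI)
        have on: "onorm (blinfun_apply (A' x)) \<le> N1" if "x \<in> b" for x
          using N1 b that by (auto simp: norm_blinfun.rep_eq[symmetric])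
        have "norm (A (s *\<^sub>R w) - A (s *\<^sub>R z)) \<le> N1 * norm (s *\<^sub>R w - s *\<^sub>R z)"
          by (rule differentiable_bound[OF _ derb on mem(2,1)]) (simp add: b_def)
        also have "\<dots> \<le> N1 * norm h" using sh N1 by (simp add: w_eq scaleR_add_right)
        finally show "norm (q s) \<le> N1 * norm h" by (simp add: q_def)
        define x0 where "x0 = s *\<^sub>R z"
        have "norm ((A (s *\<^sub>R w) - A' x0 (s *\<^sub>R w)) - (A (s *\<^sub>R z) - A' x0 (s *\<^sub>R z)))
            \<le> \<epsilon> * norm (s *\<^sub>R w - s *\<^sub>R z)"
        proof (rule differentiable_bound[where S = b and f' = "\<lambda>x. blinfun_apply (A' x - A' x0)"])
          show "convex b" by (simp add: b_def)
          show "((\<lambda>x. A x - A' x0 x) has_derivative blinfun_apply (A' x - A' x0)) (at x within b)"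
            if "x \<in> b" for x
            unfolding blinfun.diff_left by (rule has_derivative_diff[OF derb[OF that]
                  bounded_linear_imp_has_derivative[OF blinfun.bounded_linear_right]])
          show "onorm (blinfun_apply (A' x - A' x0)) \<le> \<epsilon>" if x: "x \<in> b" for x
          proof -
            have "dist x x0 < d" using x h by (simp add: b_def x0_def dist_commute)
            then have "dist (A' x) (A' x0) < \<epsilon>"
              using b x mem x0_def by (intro d) auto
            then show ?thesis by (simp add: dist_norm norm_blinfun.rep_eq)
          qed
        qed (use mem in auto)
        also have "\<dots> \<le> \<epsilon> * norm h" using sh \<epsilon> by (simp add: w_eq scaleR_add_right)
        finally show "norm (r s) \<le> \<epsilon> * norm h"
          by (simp add: r_def x0_def w_eq scaleR_add_right blinfun.add_right algebra_simps)
      qed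
      define D where "D s = Y w s - Y z s - s *\<^sub>R B (A (s *\<^sub>R z) h) (Y z s)" for s
      define E where "E s = B (A (s *\<^sub>R w) w) (D s) + B (r s z + q s h) (Y z s)
          + s *\<^sub>R B (q s w + A (s *\<^sub>R z) h) (B (A (s *\<^sub>R z) h) (Y z s))" for s
      have derD: "(D has_vector_derivative E s) (at s within {0..1})" if s: "s \<in> {0..1}" for s
      proof -
        define x where "x = s *\<^sub>R z"
        have x: "x \<in> S" using ray[OF z s] by (simp add: x_def)
        have "((\<lambda>s. A (s *\<^sub>R z)) has_derivative (\<lambda>t. A' x (t *\<^sub>R z))) (at s within {0..1})"
          using A'[OF x] unfolding x_def
          by (intro has_derivative_compose[of "\<lambda>s. s *\<^sub>R z" _ s "{0..1}" A]) (auto intro!: derivative_eq_intros)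
        then have "((\<lambda>s. A (s *\<^sub>R z)) has_vector_derivative A' x z) (at s within {0..1})"
          by (simp add: has_vector_derivative_def blinfun.scaleR_right)
        then have 1: "((\<lambda>s. A (s *\<^sub>R z) h) has_vector_derivative A' x z h) (at s within {0..1})"
          by (rule bounded_linear.has_vector_derivative[OF blinfun.bounded_linear_left])
        have 2: "((\<lambda>s. s *\<^sub>R B (A (s *\<^sub>R z) h) (Y z s)) has_vector_derivative
            s *\<^sub>R (B (A x h) (B (A x z) (Y z s)) + B (A' x z h) (Y z s)) + 1 *\<^sub>R B (A x h) (Y z s)) (at s within {0..1})"
          unfolding x_def
          by (intro bounded_bilinear.has_vector_derivative[OF bounded_bilinear_scaleR] has_vector_derivative_id
              B.has_vector_derivative 1[unfolded x_def] Y'[OF z s])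
        have "(D has_vector_derivative B (A (s *\<^sub>R w) w) (Y w s) - B (A x z) (Y z s) -
            (s *\<^sub>R (B (A x h) (B (A x z) (Y z s)) + B (A' x z h) (Y z s)) + 1 *\<^sub>R B (A x h) (Y z s))) (at s within {0..1})"
          unfolding D_def
          by (intro has_vector_derivative_diff 2) (use Y'[OF wS s] Y'[OF z s] in \<open>auto simp: x_def\<close>)
        also have "B (A (s *\<^sub>R w) w) (Y w s) - B (A x z) (Y z s) -
            (s *\<^sub>R (B (A x h) (B (A x z) (Y z s)) + B (A' x z h) (Y z s)) + 1 *\<^sub>R B (A x h) (Y z s)) = E s"
        proof -
          \<comment> \<open>The only use of flatness.\<close>
          have f: "B (A x h) (B (A x z) (Y z s)) = B (A x z) (B (A x h) (Y z s)) + B (A' x h z) (Y z s) - B (A' x z h) (Y z s)"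
            using flat[OF x, of h z "Y z s"] by (simp add: B.diff_left algebra_simps)
          have Yw: "Y w s = D s + Y z s + s *\<^sub>R B (A x h) (Y z s)"
            by (simp add: D_def x_def)
          have r: "r s = q s - s *\<^sub>R A' x h"
            by (simp add: r_def q_def x_def blinfun.scaleR_right)
          have q: "A (s *\<^sub>R w) = q s + A x" by (simp add: q_def x_def)
          show ?thesis
            unfolding E_def Yw r f x_def[symmetric] q
            by (simp add: w_eq blinfun.bilinear_simps B.add_left B.add_right B.diff_left B.diff_right
                B.scaleR_left B.scaleR_right algebra_simps)
        qed
        finally show ?thesis .
      qed
      have bndD: "norm (E s) \<le> M * norm (D s) + (a * \<epsilon> + C1 * norm h) * norm h" if s: "s \<in> {0..1}" for s
      proof -
        have sK: "s *\<^sub>R z \<in> K" "s *\<^sub>R w \<in> K"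
        proof -
          have "norm (s *\<^sub>R h) \<le> norm h" using s by (simp add: mult_left_le_one_le)
          then have "s *\<^sub>R w \<in> cball (s *\<^sub>R z) \<delta>" using h by (simp add: w_eq dist_norm scaleR_add_right)
          then show "s *\<^sub>R w \<in> K" "s *\<^sub>R z \<in> K" using xK[OF s] \<delta> by auto
        qed
        have nw: "norm w \<le> norm z + 1" using h norm_triangle_ineq[of z h] by (simp add: w_eq)
        have Aw: "norm (A (s *\<^sub>R w) w) \<le> N0 * (norm z + 1)"
          using N0(1) nw by (intro order_trans[OF norm_blinfun] mult_mono N0 sK) auto
        have 1: "norm (B (A (s *\<^sub>R w) w) (D s)) \<le> M * norm (D s)"
        proof -
          have "norm (B (A (s *\<^sub>R w) w) (D s)) \<le> norm (A (s *\<^sub>R w) w) * norm (D s) * \<kappa>" by (rule \<kappa>)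
          also have "\<dots> \<le> N0 * (norm z + 1) * norm (D s) * \<kappa>"
            using Aw \<kappa> by (intro mult_right_mono) auto
          finally show ?thesis by (simp add: M_def mult_ac)
        qed
        have 2: "norm (B (r s z + q s h) (Y z s)) \<le> (a * \<epsilon> + NY * \<kappa> * N1 * norm h) * norm h"
        proof -
          have "norm (r s z + q s h) \<le> norm (r s) * norm z + norm (q s) * norm h"
            by (intro order_trans[OF norm_triangle_ineq] add_mono norm_blinfun)
          also have "\<dots> \<le> (\<epsilon> * norm h) * norm z + (N1 * norm h) * norm h"
            using qr[OF s] by (intro add_mono mult_right_mono) auto
          finally have "norm (r s z + q s h) \<le> (\<epsilon> * norm h) * norm z + (N1 * norm h) * norm h" .
          then have "norm (r s z + q s h) * norm (Y z s) * \<kappa>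
              \<le> ((\<epsilon> * norm h) * norm z + (N1 * norm h) * norm h) * NY * \<kappa>"
            using \<kappa> NY s \<epsilon> N1 by (intro mult_right_mono mult_mono) auto
          then show ?thesis
            using \<kappa>(2)[of "r s z + q s h" "Y z s"] by (simp add: a_def algebra_simps)
        qed
        have 3: "norm (s *\<^sub>R B (q s w + A (s *\<^sub>R z) h) (B (A (s *\<^sub>R z) h) (Y z s)))
            \<le> (N1 * (norm z + 1) + N0) * (N0 * NY * \<kappa>) * \<kappa> * norm h * norm h"
        proof -
          have Ah: "norm (A (s *\<^sub>R z) h) \<le> N0 * norm h"
            by (intro order_trans[OF norm_blinfun] mult_right_mono N0 sK) auto
          have "norm (q s w + A (s *\<^sub>R z) h) \<le> norm (q s) * norm w + N0 * norm h"
            by (intro order_trans[OF norm_triangle_ineq] add_mono norm_blinfun Ah)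
          also have "\<dots> \<le> (N1 * norm h) * (norm z + 1) + N0 * norm h"
            using qr[OF s] nw N1 N0(1) by (intro add_mono mult_mono) auto
          finally have u: "norm (q s w + A (s *\<^sub>R z) h) \<le> (N1 * norm h) * (norm z + 1) + N0 * norm h" .
          have v: "norm (B (A (s *\<^sub>R z) h) (Y z s)) \<le> (N0 * norm h) * NY * \<kappa>"
            using \<kappa> NY s Ah N0 by (intro order_trans[OF \<kappa>(2)] mult_right_mono mult_mono) auto
          have "norm (B (q s w + A (s *\<^sub>R z) h) (B (A (s *\<^sub>R z) h) (Y z s)))
              \<le> ((N1 * norm h) * (norm z + 1) + N0 * norm h) * ((N0 * norm h) * NY * \<kappa>) * \<kappa>"
            using \<kappa> N1 N0 by (intro order_trans[OF \<kappa>(2)] mult_right_mono mult_mono u v) auto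
          then have "\<bar>s\<bar> * norm (B (q s w + A (s *\<^sub>R z) h) (B (A (s *\<^sub>R z) h) (Y z s)))
              \<le> ((N1 * norm h) * (norm z + 1) + N0 * norm h) * ((N0 * norm h) * NY * \<kappa>) * \<kappa>"
            using s by (intro order_trans[OF mult_left_le_one_le]) auto
          then show ?thesis by (simp add: algebra_simps)
        qed
        have "norm (E s) \<le> norm (B (A (s *\<^sub>R w) w) (D s)) + norm (B (r s z + q s h) (Y z s))
            + norm (s *\<^sub>R B (q s w + A (s *\<^sub>R z) h) (B (A (s *\<^sub>R z) h) (Y z s)))"
          unfolding E_def by (intro order_trans[OF norm_triangle_ineq] add_right_mono norm_triangle_ineq)
        then show ?thesis using 1 2 3 by (simp add: C1_def algebra_simps)
      qed
      have "norm (D 1) \<le> 2 * ((a * \<epsilon> + C1 * norm h) * norm h) * exp (2 * M * 1)"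
        by (rule gronwall_interval[OF pos(1) _ _ derD bndD])
          (use pos \<epsilon> Y0[OF wS] Y0[OF z] in \<open>auto simp: D_def\<close>)
      also have "\<dots> = (G * (a * \<epsilon>) + G * (C1 * norm h)) * norm h"
        by (simp add: G_def algebra_simps)
      also have "\<dots> \<le> (e / 2 + e / 2) * norm h"
      proof (intro mult_right_mono add_mono)
        have half: "G * (x * (e / (2 * G * x))) = e / 2" if "x > 0" for x
          using that pos by (simp add: field_simps)
        have "G * (a * \<epsilon>) \<le> G * ((a + 1) * \<epsilon>)" using pos \<epsilon> by (intro mult_left_mono mult_right_mono) auto
        also have "\<dots> = e / 2" using half[of "a + 1"] pos by (simp add: \<epsilon>_def)
        finally show "G * (a * \<epsilon>) \<le> e / 2" .
        have "G * (C1 * norm h) \<le> G * ((C1 + 1) * (e / (2 * G * (C1 + 1))))"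
          using pos h by (intro mult_left_mono mult_mono) auto
        also have "\<dots> = e / 2" using half[of "C1 + 1"] pos by simp
        finally show "G * (C1 * norm h) \<le> e / 2" .
      qed auto
      finally show ?thesis by (simp add: D_def h_def)
    qed
    ultimately show "\<exists>d>0. \<forall>w. norm (w - z) < d \<longrightarrow>
        norm (Y w 1 - Y z 1 - B (A z (w - z)) (Y z 1)) \<le> e * norm (w - z)"
      by blast
  qed
  moreover have "Y 0 1 = y0"
  proof -
    have "(Y 0 has_vector_derivative 0) (at s within {0..1})" if "s \<in> {0..1}" for s
      using Y'[OF S(3) that] by (simp add: B.zero_left blinfun.zero_right)
    then obtain c where "\<And>s. s \<in> {0..1} \<Longrightarrow> Y 0 s = c"
      using has_vector_derivative_zero_constant[of "{0..1}" "Y 0"] by auto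
    from this[of 0] this[of 1] show ?thesis using Y0[OF S(3)] by simp
  qed
  ultimately show ?thesis using that[of "\<lambda>x. Y x 1"] by blast
qed

lemma complex_pair_bounded_linear: "bounded_linear (\<lambda>w. (Re w, Im w))"
  by (intro bounded_linear_Pair bounded_linear_Re bounded_linear_Im)

text \<open>A flat system pulls back to a flat system under any map with symmetric second derivatives; the map used is
  the biholomorphism from the disc or the plane.\<close>

lemma flat_system_simply_connected:
  fixes \<Omega> :: "(real \<times> real) set" and B :: "'v::real_normed_vector \<Rightarrow> 'e::banach \<Rightarrow> 'e"
    and A :: "real \<times> real \<Rightarrow> ((real \<times> real) \<Rightarrow>\<^sub>L 'v)"
    and A' :: "real \<times> real \<Rightarrow> ((real \<times> real) \<Rightarrow>\<^sub>L (real \<times> real) \<Rightarrow>\<^sub>L 'v)"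
  assumes B: "bounded_bilinear B" and \<Omega>: "open \<Omega>" "simply_connected \<Omega>" "\<Omega> \<noteq> {}"
    and A': "\<And>x. x \<in> \<Omega> \<Longrightarrow> (A has_derivative blinfun_apply (A' x)) (at x)"
    and cont: "continuous_on \<Omega> A'"
    and flat: "\<And>x h k y. x \<in> \<Omega> \<Longrightarrow>
      B (A' x h k - A' x k h) y = B (A x h) (B (A x k) y) - B (A x k) (B (A x h) y)"
  obtains y p where "p \<in> \<Omega>" "y p = y0"
    "\<And>x. x \<in> \<Omega> \<Longrightarrow> (y has_derivative (\<lambda>h. B (A x h) (y x))) (at x)"
proof -
  define \<iota> where "\<iota> = (\<lambda>w. (Re w, Im w))"
  define \<kappa> where "\<kappa> = (\<lambda>z. Complex (fst z) (snd z))"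
  have \<iota>\<kappa> [simp]: "\<iota> (\<kappa> z) = z" "\<kappa> (\<iota> w) = w" for z w by (auto simp: \<iota>_def \<kappa>_def)
  have \<iota>: "bounded_linear \<iota>" unfolding \<iota>_def by (rule complex_pair_bounded_linear)
  have \<kappa>: "bounded_linear \<kappa>"
  proof -
    have "\<kappa> = (\<lambda>z. of_real (fst z) + \<i> * of_real (snd z))" by (auto simp: \<kappa>_def complex_eq_iff)
    then show ?thesis
      by (auto intro!: bounded_linear_add bounded_linear_const_mult bounded_linear_compose[OF bounded_linear_of_real]
          bounded_linear_fst bounded_linear_snd)
  qed
  define \<Omega>' where "\<Omega>' = \<kappa> ` \<Omega>"
  have \<Omega>'_eq: "\<Omega>' = \<iota> -` \<Omega>" unfolding \<Omega>'_def by (auto simp: image_iff) (metis \<iota>\<kappa>(2))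
  have "open \<Omega>'" unfolding \<Omega>'_eq
    by (intro open_vimage \<Omega> linear_continuous_on \<iota>)
  moreover have "\<Omega> homeomorphic \<Omega>'"
    unfolding homeomorphic_def homeomorphism_def \<Omega>'_def
    by (rule exI[of _ \<kappa>], rule exI[of _ \<iota>])
      (auto intro!: linear_continuous_on \<iota> \<kappa> simp: image_image)
  then have "simply_connected \<Omega>'" using \<Omega>(2) homeomorphic_simply_connected by blast
  ultimately have "\<exists>D f g. open D \<and> convex D \<and> (0::complex) \<in> D \<and> f holomorphic_on \<Omega>' \<and> g holomorphic_on D \<and>
      (\<forall>z\<in>\<Omega>'. f z \<in> D \<and> g (f z) = z) \<and> (\<forall>z\<in>D. g z \<in> \<Omega>' \<and> f (g z) = z)"
  proof (cases "\<Omega>' = UNIV")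
    case True
    then show ?thesis by (intro exI[of _ UNIV] exI[of _ id]) auto
  next
    case False
    have "\<Omega>' \<noteq> {}" using \<Omega>(3) by (simp add: \<Omega>'_def)
    with False \<open>simply_connected \<Omega>'\<close> \<open>open \<Omega>'\<close> simply_connected_eq_biholomorphic_to_disc[of \<Omega>']
    obtain f g where "f holomorphic_on \<Omega>'" "g holomorphic_on ball 0 1"
      "\<forall>z\<in>\<Omega>'. f z \<in> ball 0 1 \<and> g (f z) = z" "\<forall>z\<in>ball 0 1. g z \<in> \<Omega>' \<and> f (g z) = z" by metis
    then show ?thesis by (intro exI[of _ "ball 0 1"] exI[of _ f] exI[of _ g]) auto
  qed
  then obtain D f g where D: "open D" "convex D" "0 \<in> D" and f: "f holomorphic_on \<Omega>'" and g: "g holomorphic_on D"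
    and fg: "\<And>z. z \<in> \<Omega>' \<Longrightarrow> f z \<in> D" "\<And>z. z \<in> \<Omega>' \<Longrightarrow> g (f z) = z" and gD: "\<And>w. w \<in> D \<Longrightarrow> g w \<in> \<Omega>'"
    and gf: "\<And>w. w \<in> D \<Longrightarrow> f (g w) = w"
    by blast
  define L where "L = Blinfun \<iota>"
  have L: "blinfun_apply L = \<iota>" using \<iota> by (simp add: L_def bounded_linear_Blinfun_apply)
  interpret M: bounded_bilinear "(*) :: complex \<Rightarrow> complex \<Rightarrow> complex" by (rule bounded_bilinear_mult)
  interpret C: bounded_bilinear "(o\<^sub>L) :: (complex \<Rightarrow>\<^sub>L (real \<times> real)) \<Rightarrow> (complex \<Rightarrow>\<^sub>L complex) \<Rightarrow> _" by (rule bounded_bilinear_blinfun_compose)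
  interpret C2: bounded_bilinear "(o\<^sub>L) :: ((real \<times> real) \<Rightarrow>\<^sub>L 'v) \<Rightarrow> (complex \<Rightarrow>\<^sub>L (real \<times> real)) \<Rightarrow> _" by (rule bounded_bilinear_blinfun_compose)
  define m where "m = Blinfun M.prod_right"
  have m: "blinfun_apply m = M.prod_right"
    by (simp add: m_def bounded_linear_Blinfun_apply M.bounded_linear_prod_right)
  define \<phi> where "\<phi> w = \<iota> (g w)" for w
  define \<phi>' where "\<phi>' w = L o\<^sub>L m (deriv g w)" for w
  define \<phi>'' where "\<phi>'' w = C.prod_right L o\<^sub>L (m o\<^sub>L m (deriv (deriv g) w))" for w
  have ev: "\<phi>' w h = \<iota> (deriv g w * h)" "\<phi>'' w h k = \<iota> (deriv (deriv g) w * h * k)" for w h k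
    by (simp_all add: \<phi>'_def \<phi>''_def L m M.prod_right.rep_eq C.prod_right.rep_eq)
  have \<phi>\<Omega>: "\<phi> w \<in> \<Omega>" if "w \<in> D" for w using gD[OF that] by (simp add: \<phi>_def \<Omega>'_eq)
  have dg: "deriv g holomorphic_on D" using g D(1) by (rule holomorphic_deriv)
  have ddg: "deriv (deriv g) holomorphic_on D" using dg D(1) by (rule holomorphic_deriv)
  have d1: "(\<phi> has_derivative blinfun_apply (\<phi>' w)) (at w)" if "w \<in> D" for w
    unfolding \<phi>_def ev using holomorphic_derivI[OF g D(1) that]
    by (intro bounded_linear.has_derivative[OF \<iota>]) (simp add: has_field_derivative_def)
  have d2: "(\<phi>' has_derivative blinfun_apply (\<phi>'' w)) (at w)" if "w \<in> D" for w
  proof -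
    have "(\<phi>' has_derivative (\<lambda>h. L o\<^sub>L m (deriv (deriv g) w * h))) (at w)"
      unfolding \<phi>'_def using holomorphic_derivI[OF dg D(1) that]
      by (intro bounded_linear.has_derivative[OF C.bounded_linear_right]
          bounded_linear.has_derivative[OF blinfun.bounded_linear_right]) (simp add: has_field_derivative_def)
    then show ?thesis
      by (rule has_derivative_eq_rhs) (simp add: fun_eq_iff \<phi>''_def m M.prod_right.rep_eq C.prod_right.rep_eq)
  qed
  define A1 where "A1 w = A (\<phi> w) o\<^sub>L \<phi>' w" for w
  define A2 where "A2 w = (C2.prod_left (\<phi>' w) o\<^sub>L (A' (\<phi> w) o\<^sub>L \<phi>' w)) + (C2.prod_right (A (\<phi> w)) o\<^sub>L \<phi>'' w)" for w
  have A2_ev: "A2 w h k = A' (\<phi> w) (\<phi>' w h) (\<phi>' w k) + A (\<phi> w) (\<phi>'' w h k)" for w h k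
    by (simp add: A2_def C2.prod_left.rep_eq C2.prod_right.rep_eq blinfun.add_left)
  have contA: "continuous_on \<Omega> A"
    by (rule has_derivative_continuous_on[OF has_derivative_at_withinI[OF A']])
  have cont\<phi>: "continuous_on D \<phi>"
    by (rule has_derivative_continuous_on[OF has_derivative_at_withinI[OF d1]])
  have cont\<phi>': "continuous_on D \<phi>'"
    by (rule has_derivative_continuous_on[OF has_derivative_at_withinI[OF d2]])
  have cont\<phi>'': "continuous_on D \<phi>''" unfolding \<phi>''_def
    by (intro continuous_intros holomorphic_on_imp_continuous_on ddg)
  obtain y where y0: "y 0 = y0" and y: "\<And>w. w \<in> D \<Longrightarrow> (y has_derivative (\<lambda>h. B (A1 w h) (y w))) (at w)"
  proof (rule flat_system_convex[OF B D, of A1 A2])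
    show "(A1 has_derivative blinfun_apply (A2 w)) (at w)" if w: "w \<in> D" for w
    proof -
      have "((\<lambda>w. A (\<phi> w)) has_derivative (\<lambda>h. A' (\<phi> w) (\<phi>' w h))) (at w)"
        by (rule has_derivative_compose[OF d1[OF w] A'[OF \<phi>\<Omega>[OF w]]])
      from C2.FDERIV[OF this d2[OF w]] show ?thesis
        unfolding A1_def
        by (rule has_derivative_eq_rhs) (auto simp: A2_def C2.prod_left.rep_eq C2.prod_right.rep_eq blinfun.add_left fun_eq_iff)
    qed
    show "continuous_on D A2" unfolding A2_def
      by (intro continuous_intros bounded_linear.continuous_on[OF C2.bounded_linear_prod_left]
          bounded_linear.continuous_on[OF C2.bounded_linear_prod_right] cont\<phi>' cont\<phi>''
          continuous_on_compose2[OF cont cont\<phi>] continuous_on_compose2[OF contA cont\<phi>]) (use \<phi>\<Omega> in auto)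
    show "B (A2 w h k - A2 w k h) y = B (A1 w h) (B (A1 w k) y) - B (A1 w k) (B (A1 w h) y)"
      if w: "w \<in> D" for w h k y
    proof -
      have "A2 w h k - A2 w k h = A' (\<phi> w) (\<phi>' w h) (\<phi>' w k) - A' (\<phi> w) (\<phi>' w k) (\<phi>' w h)"
        by (simp add: A2_ev ev mult_ac)
      then show ?thesis using flat[OF \<phi>\<Omega>[OF w]] by (simp add: A1_def)
    qed
  qed blast
  define u where "u z = y (f (\<kappa> z))" for z
  have "(u has_derivative (\<lambda>h. B (A z h) (u z))) (at z)" if z: "z \<in> \<Omega>" for z
  proof -
    have kz: "\<kappa> z \<in> \<Omega>'" using z by (simp add: \<Omega>'_def)
    have df: "(f has_field_derivative deriv f (\<kappa> z)) (at (\<kappa> z))"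
      using holomorphic_derivI[OF f \<open>open \<Omega>'\<close> kz] .
    have dg: "(g has_field_derivative deriv g (f (\<kappa> z))) (at (f (\<kappa> z)))"
      using holomorphic_derivI[OF g D(1) fg(1)[OF kz]] .
    have "((\<lambda>w. g (f w)) has_field_derivative deriv g (f (\<kappa> z)) * deriv f (\<kappa> z)) (at (\<kappa> z))"
      using DERIV_chain2[OF dg df] .
    moreover have "((\<lambda>w. g (f w)) has_field_derivative 1) (at (\<kappa> z))"
      by (rule has_field_derivative_transform_within_open[OF DERIV_ident \<open>open \<Omega>'\<close> kz]) (simp add: fg)
    ultimately have one: "deriv g (f (\<kappa> z)) * deriv f (\<kappa> z) = 1"
      by (rule DERIV_unique)
    have "((\<lambda>z. f (\<kappa> z)) has_derivative (\<lambda>h. deriv f (\<kappa> z) * \<kappa> h)) (at z)"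
      by (rule has_derivative_compose[OF bounded_linear_imp_has_derivative[OF \<kappa>]])
        (use df in \<open>simp add: has_field_derivative_def\<close>)
    from has_derivative_compose[OF this y[OF fg(1)[OF kz]]]
    have "(u has_derivative (\<lambda>h. B (A1 (f (\<kappa> z)) (deriv f (\<kappa> z) * \<kappa> h)) (y (f (\<kappa> z))))) (at z)"
      by (simp add: u_def[abs_def])
    moreover have "A1 (f (\<kappa> z)) (deriv f (\<kappa> z) * \<kappa> h) = A z h" for h
    proof -
      have "deriv g (f (\<kappa> z)) * (deriv f (\<kappa> z) * \<kappa> h) = \<kappa> h"
        using one by (metis mult.assoc mult_1)
      then show ?thesis
        by (simp only: A1_def \<phi>_def fg(2)[OF kz] ev blinfun_apply_blinfun_compose \<iota>\<kappa>)
    qed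
    ultimately show ?thesis by (simp add: u_def)
  qed
  moreover have "\<phi> (0::complex) \<in> \<Omega>" using \<phi>\<Omega> D by blast
  moreover have "u (\<phi> 0) = y0" using gf[OF D(3)] y0 by (simp add: u_def \<phi>_def)
  ultimately show ?thesis using that by blast
qed

text \<open>The second difference of \<open>f\<close> is a difference of increments in the direction \<open>h\<close>, so the mean value
  inequality needs only the differentiability of \<open>f' _ h\<close> at the one point \<open>z\<close>. The second difference is
  symmetric in \<open>h\<close> and \<open>k\<close>, and this gives the symmetry of the second derivative.\<close>

lemma mixed_increment:
  fixes f :: "'a::real_normed_vector \<Rightarrow> 'e::real_normed_vector"
  assumes S: "open S" "z \<in> S" and f': "\<And>w. w \<in> S \<Longrightarrow> (f has_derivative f' w) (at w)"
    and p: "((\<lambda>w. f' w h) has_derivative p) (at z)" and e: "e > 0"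
  shows "\<exists>d>0. \<forall>t. 0 < t \<longrightarrow> t < d \<longrightarrow>
    norm (f (z + t *\<^sub>R h + t *\<^sub>R k) - f (z + t *\<^sub>R h) - f (z + t *\<^sub>R k) + f z - t\<^sup>2 *\<^sub>R p k) \<le> e * t\<^sup>2"
proof -
  define N where "N = norm h + norm k"
  define e' where "e' = e / (2 * N + 1)"
  have N: "N \<ge> 0" by (simp add: N_def)
  have e': "e' > 0" using e N by (simp add: e'_def)
  obtain d0 where d0: "d0 > 0" "ball z d0 \<subseteq> S" using S openE by blast
  obtain d1 where d1: "d1 > 0" "\<And>w. norm (w - z) < d1 \<Longrightarrow> norm (f' w h - f' z h - p (w - z)) \<le> e' * norm (w - z)"
    using p e' unfolding has_derivative_at_alt by blast
  have lin: "linear p" using p has_derivative_linear by blast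
  define d where "d = min d0 d1 / (N + 1)"
  have "d > 0" using d0 d1 N by (simp add: d_def)
  moreover have "norm (f (z + t *\<^sub>R h + t *\<^sub>R k) - f (z + t *\<^sub>R h) - f (z + t *\<^sub>R k) + f z - t\<^sup>2 *\<^sub>R p k) \<le> e * t\<^sup>2"
    if t: "0 < t" "t < d" for t
  proof -
    have tN: "t * (N + 1) < min d0 d1" using t N by (simp add: d_def field_simps)
    have pt: "norm (w - z) \<le> t * N" "norm (w - z) < d0" "norm (w - z) < d1" "w \<in> S"
      if w: "w = z + (u * t) *\<^sub>R h + (c * t) *\<^sub>R k" and u: "0 \<le> u" "u \<le> 1" "0 \<le> c" "c \<le> 1" for w u c
    proof -
      have "norm (w - z) \<le> u * t * norm h + c * t * norm k"
        using norm_triangle_ineq[of "(u * t) *\<^sub>R h" "(c * t) *\<^sub>R k"] t u by (simp add: w abs_mult)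
      also have "\<dots> \<le> t * norm h + t * norm k"
        using u t by (intro add_mono mult_right_mono) auto
      finally show 1: "norm (w - z) \<le> t * N" by (simp add: N_def algebra_simps)
      also have "\<dots> < min d0 d1" using tN t N by (simp add: algebra_simps)
      finally show 2: "norm (w - z) < d0" "norm (w - z) < d1" by auto
      then show "w \<in> S" using d0 by (auto simp: dist_norm norm_minus_commute)
    qed
    define \<psi> where "\<psi> u = f (z + (u * t) *\<^sub>R h + t *\<^sub>R k) - f (z + (u * t) *\<^sub>R h) - (u * t\<^sup>2) *\<^sub>R p k" for u
    define \<psi>' where "\<psi>' u = t *\<^sub>R (f' (z + (u * t) *\<^sub>R h + t *\<^sub>R k) h - f' (z + (u * t) *\<^sub>R h) h - t *\<^sub>R p k)" for u
    have der: "(\<psi> has_vector_derivative \<psi>' u) (at u within {0..1})" if u: "0 \<le> u" "u \<le> 1" for u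
    proof -
      have S1: "z + (u * t) *\<^sub>R h + t *\<^sub>R k \<in> S" using pt(4)[of _ u 1] u by simp
      have S2: "z + (u * t) *\<^sub>R h \<in> S" using pt(4)[of _ u 0] u by simp
      have l1: "f' w (s *\<^sub>R x) = s *\<^sub>R f' w x" if "w \<in> S" for s x w
        using f'[OF that] has_derivative_linear linear_cmul by blast
      have "((\<lambda>u. f (z + (u * t) *\<^sub>R h + t *\<^sub>R k)) has_derivative (\<lambda>s. f' (z + (u * t) *\<^sub>R h + t *\<^sub>R k) ((s * t) *\<^sub>R h))) (at u within {0..1})"
        by (rule has_derivative_compose[of "\<lambda>u. z + (u * t) *\<^sub>R h + t *\<^sub>R k", OF _ f'[OF S1]]) (auto intro!: derivative_eq_intros)
      moreover have "((\<lambda>u. f (z + (u * t) *\<^sub>R h)) has_derivative (\<lambda>s. f' (z + (u * t) *\<^sub>R h) ((s * t) *\<^sub>R h))) (at u within {0..1})"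
        by (rule has_derivative_compose[of "\<lambda>u. z + (u * t) *\<^sub>R h", OF _ f'[OF S2]]) (auto intro!: derivative_eq_intros)
      moreover have "((\<lambda>u. (u * t\<^sup>2) *\<^sub>R p k) has_derivative (\<lambda>s. (s * t\<^sup>2) *\<^sub>R p k)) (at u within {0..1})"
        by (auto intro!: derivative_eq_intros)
      ultimately have "(\<psi> has_derivative (\<lambda>s. f' (z + (u * t) *\<^sub>R h + t *\<^sub>R k) ((s * t) *\<^sub>R h)
          - f' (z + (u * t) *\<^sub>R h) ((s * t) *\<^sub>R h) - (s * t\<^sup>2) *\<^sub>R p k)) (at u within {0..1})"
        unfolding \<psi>_def by (intro has_derivative_diff)
      then show ?thesis unfolding has_vector_derivative_def l1[OF S1] l1[OF S2]
        by (rule has_derivative_eq_rhs) (simp add: fun_eq_iff \<psi>'_def scaleR_diff_right power2_eq_square mult.assoc)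
    qed
    have bnd: "norm (\<psi>' u) \<le> t * (e' * (2 * (t * N)))" if u: "0 \<le> u" "u \<le> 1" for u
    proof -
      define w1 w2 where "w1 = z + (u * t) *\<^sub>R h + t *\<^sub>R k" and "w2 = z + (u * t) *\<^sub>R h"
      have w: "norm (w1 - z) \<le> t * N" "norm (w1 - z) < d1" "norm (w2 - z) \<le> t * N" "norm (w2 - z) < d1"
        using pt[of w1 u 1] pt[of w2 u 0] u by (auto simp: w1_def w2_def)
      have "f' w1 h - f' w2 h - t *\<^sub>R p k = (f' w1 h - f' z h - p (w1 - z)) - (f' w2 h - f' z h - p (w2 - z))"
        by (simp add: w1_def w2_def linear_add[OF lin] linear_diff[OF lin] linear_cmul[OF lin])
      also have "norm \<dots> \<le> e' * norm (w1 - z) + e' * norm (w2 - z)"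
        using w by (intro order_trans[OF norm_triangle_ineq4] add_mono d1)
      also have "\<dots> \<le> e' * (t * N) + e' * (t * N)" using w e' by (intro add_mono mult_left_mono) auto
      finally have "norm (f' w1 h - f' w2 h - t *\<^sub>R p k) \<le> e' * (2 * (t * N))" by (simp add: mult_ac)
      then show ?thesis using t by (simp add: \<psi>'_def w1_def w2_def abs_mult)
    qed
    have "norm (\<psi> 1 - \<psi> 0) \<le> (t * (e' * (2 * (t * N)))) * norm (1 - 0 :: real)"
    proof (rule differentiable_bound[of "{0..1}" \<psi> "\<lambda>u s. s *\<^sub>R \<psi>' u"])
      show "onorm (\<lambda>s. s *\<^sub>R \<psi>' u) \<le> t * (e' * (2 * (t * N)))" if "u \<in> {0..1}" for u
        using bnd[of u] that t e' N by (intro onorm_le) (simp only: norm_scaleR real_norm_def mult.commute[of "t * _"], intro mult_left_mono, auto)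
    qed (use der in \<open>auto simp: has_vector_derivative_def\<close>)
    also have "\<dots> = e' * (2 * N) * t\<^sup>2" by (simp add: power2_eq_square)
    also have "\<dots> \<le> e * t\<^sup>2"
      using e N by (intro mult_right_mono) (auto simp: e'_def field_simps)
    finally show ?thesis by (simp add: \<psi>_def algebra_simps)
  qed
  ultimately show ?thesis by blast
qed

lemma mixed_derivatives_commute:
  fixes f :: "'a::real_normed_vector \<Rightarrow> 'e::real_normed_vector"
  assumes S: "open S" "z \<in> S" and f': "\<And>w. w \<in> S \<Longrightarrow> (f has_derivative f' w) (at w)"
    and p: "((\<lambda>w. f' w h) has_derivative p) (at z)"
    and q: "((\<lambda>w. f' w k) has_derivative q) (at z)"
  shows "p k = q h"
proof -
  have "norm (p k - q h) \<le> 0 + e" if e: "e > 0" for e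
  proof -
    obtain d1 where d1: "d1 > 0" "\<And>t. 0 < t \<Longrightarrow> t < d1 \<Longrightarrow>
      norm (f (z + t *\<^sub>R h + t *\<^sub>R k) - f (z + t *\<^sub>R h) - f (z + t *\<^sub>R k) + f z - t\<^sup>2 *\<^sub>R p k) \<le> e / 2 * t\<^sup>2"
      using mixed_increment[OF S f' p, of "e / 2" k] e by auto
    obtain d2 where d2: "d2 > 0" "\<And>t. 0 < t \<Longrightarrow> t < d2 \<Longrightarrow>
      norm (f (z + t *\<^sub>R k + t *\<^sub>R h) - f (z + t *\<^sub>R k) - f (z + t *\<^sub>R h) + f z - t\<^sup>2 *\<^sub>R q h) \<le> e / 2 * t\<^sup>2"
      using mixed_increment[OF S f' q, of "e / 2" h] e by auto
    define t where "t = min d1 d2 / 2"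
    have t: "0 < t" "t < d1" "t < d2" using d1 d2 by (auto simp: t_def)
    define \<Delta> where \<Delta>_def: "\<Delta> = f (z + t *\<^sub>R h + t *\<^sub>R k) - f (z + t *\<^sub>R h) - f (z + t *\<^sub>R k) + f z"
    have "\<Delta> = f (z + t *\<^sub>R k + t *\<^sub>R h) - f (z + t *\<^sub>R k) - f (z + t *\<^sub>R h) + f z"
      by (simp add: \<Delta>_def algebra_simps)
    then have "norm (\<Delta> - t\<^sup>2 *\<^sub>R p k) \<le> e / 2 * t\<^sup>2" "norm (\<Delta> - t\<^sup>2 *\<^sub>R q h) \<le> e / 2 * t\<^sup>2"
      using d1(2)[OF t(1,2)] d2(2)[OF t(1,3)] unfolding \<Delta>_def by metis+
    then have "norm ((\<Delta> - t\<^sup>2 *\<^sub>R q h) - (\<Delta> - t\<^sup>2 *\<^sub>R p k)) \<le> e / 2 * t\<^sup>2 + e / 2 * t\<^sup>2"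
      by (intro order_trans[OF norm_triangle_ineq4]) auto
    then have "t\<^sup>2 * norm (p k - q h) \<le> t\<^sup>2 * e"
      by (simp add: mult.commute flip: scaleR_diff_right)
    then show ?thesis using t by simp
  qed
  then have "norm (p k - q h) \<le> 0" by (rule field_le_epsilon)
  then show ?thesis by simp
qed

section \<open>Calculus of smooth maps\<close>

lemma Ck_on_cong:
  assumes "open S" "\<And>x. x \<in> S \<Longrightarrow> f x = g x" "Ck_on k S f"
  shows "Ck_on k S g"
  using assms(2,3)
proof (induction k arbitrary: f g)
  case 0 then show ?case using continuous_on_cong[of S S f g] by simp
next
  case (Suc k)
  have d: "(g has_derivative frechet_derivative f (at x)) (at x)" if "x \<in> S" for x
    using Suc.prems that assms(1)
    by (intro has_derivative_transform_within_open[of f _ x UNIV S g]) (auto simp: frechet_derivative_works)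
  have eq: "frechet_derivative f (at x) v = frechet_derivative g (at x) v" if "x \<in> S" for x v
    using frechet_derivative_at[OF d[OF that]] by simp
  show ?case
    unfolding Ck_on.simps
  proof (intro conjI allI ballI)
    show "g differentiable at x" if "x \<in> S" for x using d[OF that] by (auto simp: differentiable_def)
    show "Ck_on k S (\<lambda>x. frechet_derivative g (at x) v)" for v
      by (rule Suc.IH[OF eq]) (use Suc.prems in auto)
  qed
qed

lemma Ck_on_SucI:
  assumes "open S" and f': "\<And>x. x \<in> S \<Longrightarrow> (f has_derivative f' x) (at x)"
    and "\<And>v. Ck_on k S (\<lambda>x. f' x v)"
  shows "Ck_on (Suc k) S f"
  unfolding Ck_on.simps
proof (intro conjI allI ballI)
  show "f differentiable at x" if "x \<in> S" for x using f'[OF that] by (auto simp: differentiable_def)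
  have eq: "f' x v = frechet_derivative f (at x) v" if "x \<in> S" for x v
    using frechet_derivative_at[OF f'[OF that]] by simp
  show "Ck_on k S (\<lambda>x. frechet_derivative f (at x) v)" for v
    by (rule Ck_on_cong[OF assms(1) eq assms(3)])
qed

lemma Ck_on_SucD: "Ck_on (Suc k) S f \<Longrightarrow> Ck_on k S f"
proof (induction k arbitrary: f)
  case 0
  then show ?case by (auto intro!: continuous_at_imp_continuous_on differentiable_imp_continuous_within)
qed auto

lemma Ck_on_has_derivative:
  "Ck_on (Suc k) S f \<Longrightarrow> x \<in> S \<Longrightarrow> (f has_derivative frechet_derivative f (at x)) (at x)"
  by (simp add: frechet_derivative_works)

lemma Ck_on_const: "open S \<Longrightarrow> Ck_on k S (\<lambda>x. c)"
proof (induction k arbitrary: c)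
  case (Suc k)
  show ?case by (rule Ck_on_SucI[where f' = "\<lambda>_ _. 0"]) (use Suc in auto)
qed simp

lemma Ck_on_bounded_linear:
  assumes "open S" "bounded_linear L" "Ck_on k S f"
  shows "Ck_on k S (\<lambda>x. L (f x))"
  using assms(3)
proof (induction k arbitrary: f)
  case 0 then show ?case using assms by (auto intro: bounded_linear.continuous_on)
next
  case (Suc k)
  show ?case
    by (rule Ck_on_SucI[OF assms(1), where f' = "\<lambda>x v. L (frechet_derivative f (at x) v)"])
      (use Suc assms Ck_on_has_derivative[OF Suc.prems] in \<open>auto intro: bounded_linear.has_derivative\<close>)
qed

lemma Ck_on_add:
  assumes "open S" "Ck_on k S f" "Ck_on k S g"
  shows "Ck_on k S (\<lambda>x. f x + g x)"
  using assms(2,3)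
proof (induction k arbitrary: f g)
  case 0 then show ?case by (auto intro: continuous_intros)
next
  case (Suc k)
  show ?case
    by (rule Ck_on_SucI[OF assms(1), where f' = "\<lambda>x v. frechet_derivative f (at x) v + frechet_derivative g (at x) v"])
      (use Suc Ck_on_has_derivative[OF Suc.prems(1)] Ck_on_has_derivative[OF Suc.prems(2)] in \<open>auto intro: has_derivative_add\<close>)
qed

lemma Ck_on_bilinear:
  assumes "open S" "bounded_bilinear B" "Ck_on k S f" "Ck_on k S g"
  shows "Ck_on k S (\<lambda>x. B (f x) (g x))"
  using assms(3,4)
proof (induction k arbitrary: f g)
  case 0 then show ?case using assms by (auto intro: bounded_bilinear.continuous_on)
next
  case (Suc k)
  note d = bounded_bilinear.FDERIV[OF assms(2) Ck_on_has_derivative[OF Suc.prems(1)] Ck_on_has_derivative[OF Suc.prems(2)]]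
  show ?case
    by (rule Ck_on_SucI[OF assms(1) d])
      (use Suc Ck_on_SucD[OF Suc.prems(1)] Ck_on_SucD[OF Suc.prems(2)] in \<open>auto intro!: Ck_on_add assms(1)\<close>)
qed

text \<open>Bootstrapping: the equation expresses the derivative of a solution through the solution itself.\<close>

lemma linear_system_smooth:
  assumes S: "open S" and B: "bounded_bilinear B" and A: "\<And>h. smooth_on S (\<lambda>x. A x h)"
    and y: "\<And>x. x \<in> S \<Longrightarrow> (y has_derivative (\<lambda>h. B (A x h) (y x))) (at x)"
  shows "smooth_on S y"
proof -
  have "Ck_on k S y" for k
  proof (induction k)
    case 0
    show ?case using has_derivative_continuous_on[OF has_derivative_at_withinI[OF y]] by simp
  next
    case (Suc k)
    show ?case
      by (rule Ck_on_SucI[OF S y]) (use A Suc in \<open>auto intro!: Ck_on_bilinear[OF S B] simp: smooth_on_def\<close>)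
  qed
  then show ?thesis by (simp add: smooth_on_def)
qed

lemma smooth_on_cong: "open S \<Longrightarrow> (\<And>x. x \<in> S \<Longrightarrow> f x = g x) \<Longrightarrow> smooth_on S f \<Longrightarrow> smooth_on S g"
  unfolding smooth_on_def using Ck_on_cong by blast

lemma smooth_on_const: "open S \<Longrightarrow> smooth_on S (\<lambda>x. c)"
  by (simp add: smooth_on_def Ck_on_const)

lemma smooth_on_bounded_linear: "open S \<Longrightarrow> bounded_linear L \<Longrightarrow> smooth_on S f \<Longrightarrow> smooth_on S (\<lambda>x. L (f x))"
  by (simp add: smooth_on_def Ck_on_bounded_linear)

lemma smooth_on_add: "open S \<Longrightarrow> smooth_on S f \<Longrightarrow> smooth_on S g \<Longrightarrow> smooth_on S (\<lambda>x. f x + g x)"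
  by (simp add: smooth_on_def Ck_on_add)

lemma smooth_on_bilinear:
  "open S \<Longrightarrow> bounded_bilinear B \<Longrightarrow> smooth_on S f \<Longrightarrow> smooth_on S g \<Longrightarrow> smooth_on S (\<lambda>x. B (f x) (g x))"
  by (simp add: smooth_on_def Ck_on_bilinear)

lemma smooth_on_has_derivative:
  "smooth_on S f \<Longrightarrow> x \<in> S \<Longrightarrow> (f has_derivative frechet_derivative f (at x)) (at x)"
  using Ck_on_has_derivative by (metis smooth_on_def)

lemma smooth_on_frechet_derivative: "smooth_on S f \<Longrightarrow> smooth_on S (\<lambda>x. frechet_derivative f (at x) v)"
  unfolding smooth_on_def by (metis Ck_on.simps(2))

lemma smooth_on_continuous_on: "smooth_on S f \<Longrightarrow> continuous_on S f"
  unfolding smooth_on_def by (metis Ck_on.simps(1))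

lemma smooth_on_rescale:
  fixes f :: "real \<Rightarrow> 'b::real_normed_vector"
  assumes "smooth_on UNIV f"
  shows "smooth_on UNIV (\<lambda>t. f (c * t))"
proof -
  have "Ck_on k UNIV (\<lambda>t. f (c * t))" if "Ck_on k UNIV f" for k and f :: "real \<Rightarrow> 'b"
    using that
  proof (induction k arbitrary: f)
    case 0 then show ?case by (auto intro!: continuous_on_compose2[of UNIV f] continuous_intros)
  next
    case (Suc k)
    show ?case
    proof (rule Ck_on_SucI[where f' = "\<lambda>t v. frechet_derivative f (at (c * t)) (c * v)"])
      show "((\<lambda>t. f (c * t)) has_derivative (\<lambda>v. frechet_derivative f (at (c * t)) (c * v))) (at t)" for t
        by (rule has_derivative_compose[of "\<lambda>t. c * t", OF _ Ck_on_has_derivative[OF Suc.prems]])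
          (auto intro!: derivative_eq_intros)
    qed (use Suc in auto)
  qed
  then show ?thesis using assms by (simp add: smooth_on_def)
qed

section \<open>Octonions and the Clifford relations\<close>

lemma UNIV_8: "(UNIV :: 8 set) = {0, 1, 2, 3, 4, 5, 6, 7}"
proof -
  have "x \<in> {0, 1, 2, 3, 4, 5, 6, 7}" for x :: 8
  proof (cases x)
    case (of_int z)
    then have "z \<in> {0, 1, 2, 3, 4, 5, 6, 7}" by auto
    then show ?thesis using of_int by auto
  qed
  then show ?thesis by blast
qed

lemma sum_8: "(\<Sum>i\<in>(UNIV :: 8 set). f i) = f 0 + f 1 + f 2 + f 3 + f 4 + f 5 + f 6 + f 7"
  unfolding UNIV_8 by (simp add: add.assoc)

lemma all_8: "(\<forall>i::8. P i) \<longleftrightarrow> P 0 \<and> P 1 \<and> P 2 \<and> P 3 \<and> P 4 \<and> P 5 \<and> P 6 \<and> P 7"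
  using UNIV_8 by (metis UNIV_I empty_iff insert_iff)

lemma oct_eq_iff: "(x :: 'a ^ 8) = y \<longleftrightarrow> x $ 0 = y $ 0 \<and> x $ 1 = y $ 1 \<and> x $ 2 = y $ 2 \<and> x $ 3 = y $ 3 \<and>
    x $ 4 = y $ 4 \<and> x $ 5 = y $ 5 \<and> x $ 6 = y $ 6 \<and> x $ 7 = y $ 7"
  unfolding vec_eq_iff all_8 by blast

lemma inner_oct: "x \<bullet> y = x $ 0 * y $ 0 + x $ 1 * y $ 1 + x $ 2 * y $ 2 + x $ 3 * y $ 3 +
    x $ 4 * y $ 4 + x $ 5 * y $ 5 + x $ 6 * y $ 6 + x $ 7 * y $ 7" for x y :: oct
  by (simp add: inner_vec_def sum_8)

lemma oct_unit_nth [simp]: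
  "oct_unit 0 $ j = (if j = 0 then 1 else 0)" "oct_unit (Suc 0) $ j = (if j = 1 then 1 else 0)"
  "oct_unit 2 $ j = (if j = 2 then 1 else 0)" "oct_unit 3 $ j = (if j = 3 then 1 else 0)"
  "oct_unit 4 $ j = (if j = 4 then 1 else 0)" "oct_unit 5 $ j = (if j = 5 then 1 else 0)"
  "oct_unit 6 $ j = (if j = 6 then 1 else 0)" "oct_unit 7 $ j = (if j = 7 then 1 else 0)"
  by (simp_all add: oct_unit_def axis_def)

lemma oct_pair_nth [simp]:
  "oct_pair ((a, b, c, d), (a', b', c', d')) $ 0 = a"
  "oct_pair ((a, b, c, d), (a', b', c', d')) $ 1 = b"
  "oct_pair ((a, b, c, d), (a', b', c', d')) $ 2 = c"
  "oct_pair ((a, b, c, d), (a', b', c', d')) $ 3 = d"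
  "oct_pair ((a, b, c, d), (a', b', c', d')) $ 4 = a'"
  "oct_pair ((a, b, c, d), (a', b', c', d')) $ 5 = b'"
  "oct_pair ((a, b, c, d), (a', b', c', d')) $ 6 = c'"
  "oct_pair ((a, b, c, d), (a', b', c', d')) $ 7 = d'"
  by (simp_all add: oct_pair_def oct_unit_nth)

lemma oct_mult_nth:
  "oct_mult p q $ 0 = p$0 * q$0 - p$1 * q$1 - p$2 * q$2 - p$3 * q$3 - p$4 * q$4 - p$5 * q$5 - p$6 * q$6 - p$7 * q$7"
  "oct_mult p q $ 1 = p$0 * q$1 + p$1 * q$0 + p$2 * q$3 - p$3 * q$2 - p$4 * q$5 + p$5 * q$4 - p$6 * q$7 + p$7 * q$6"
  "oct_mult p q $ 2 = p$0 * q$2 - p$1 * q$3 + p$2 * q$0 + p$3 * q$1 - p$4 * q$6 + p$5 * q$7 + p$6 * q$4 - p$7 * q$5"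
  "oct_mult p q $ 3 = p$0 * q$3 + p$1 * q$2 - p$2 * q$1 + p$3 * q$0 - p$4 * q$7 - p$5 * q$6 + p$6 * q$5 + p$7 * q$4"
  "oct_mult p q $ 4 = p$0 * q$4 + p$1 * q$5 + p$2 * q$6 + p$3 * q$7 + p$4 * q$0 - p$5 * q$1 - p$6 * q$2 - p$7 * q$3"
  "oct_mult p q $ 5 = p$0 * q$5 - p$1 * q$4 - p$2 * q$7 + p$3 * q$6 + p$4 * q$1 + p$5 * q$0 - p$6 * q$3 + p$7 * q$2"
  "oct_mult p q $ 6 = p$0 * q$6 + p$1 * q$7 - p$2 * q$4 - p$3 * q$5 + p$4 * q$2 + p$5 * q$3 + p$6 * q$0 - p$7 * q$1"
  "oct_mult p q $ 7 = p$0 * q$7 - p$1 * q$6 + p$2 * q$5 - p$3 * q$4 + p$4 * q$3 - p$5 * q$2 + p$6 * q$1 + p$7 * q$0"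
  by (simp_all add: oct_mult_def oct_fst_def oct_snd_def Let_def algebra_simps)


lemma bilinear_matrix_mult: "bilinear ((**) :: real ^ 'n ^ 'm \<Rightarrow> real ^ 'k ^ 'n \<Rightarrow> real ^ 'k ^ 'm)"
  unfolding bilinear_def
  by (auto intro!: linearI simp: matrix_matrix_mult_def vec_eq_iff sum.distrib algebra_simps sum_distrib_left)

interpretation mm: bounded_bilinear "(**) :: real ^ 8 ^ 8 \<Rightarrow> real ^ 8 ^ 8 \<Rightarrow> real ^ 8 ^ 8"
  using bilinear_matrix_mult by (simp add: bilinear_conv_bounded_bilinear)

lemma bilinear_matrix_vector_mult: "bilinear ((*v) :: real ^ 'n ^ 'm \<Rightarrow> real ^ 'n \<Rightarrow> real ^ 'm)"
  unfolding bilinear_def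
  by (auto intro!: linearI simp: matrix_vector_mult_def vec_eq_iff sum.distrib algebra_simps sum_distrib_left)

interpretation mv: bounded_bilinear "(*v) :: real ^ 8 ^ 8 \<Rightarrow> real ^ 8 \<Rightarrow> real ^ 8"
  using bilinear_matrix_vector_mult by (simp add: bilinear_conv_bounded_bilinear)

lemmas mm_simps = mm.add_left mm.add_right mm.diff_left mm.diff_right mm.minus_left mm.minus_right
  mm.scaleR_left mm.scaleR_right mm.zero_left mm.zero_right

lemma bounded_linear_transpose: "bounded_linear (transpose :: real ^ 8 ^ 8 \<Rightarrow> real ^ 8 ^ 8)"
  unfolding linear_conv_bounded_linear[symmetric]
  by (auto intro!: linearI simp: transpose_def vec_eq_iff)

lemma transpose_simps:
  "transpose (A + B) = transpose A + transpose B" "transpose (A - B) = transpose A - transpose B"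
  "transpose (- A) = - transpose A" "transpose (c *\<^sub>R A) = c *\<^sub>R transpose A"
  for A B :: "real ^ 8 ^ 8"
  by (simp_all add: transpose_def vec_eq_iff)

lemma ImO_iff: "u \<in> ImO \<longleftrightarrow> u $ 0 = 0"
  by (simp add: ImO_def inner_oct)

lemma bilinear_oct_mult: "bilinear oct_mult"
  unfolding bilinear_def by (auto intro!: linearI simp: oct_eq_iff oct_mult_nth algebra_simps)

interpretation om: bounded_bilinear oct_mult
  using bilinear_oct_mult by (simp add: bilinear_conv_bounded_bilinear)

lemma Lmat_mult_vec [simp]: "Lmat u *v x = oct_mult u x"
proof -
  have "linear (oct_mult u)" using bounded_linear.linear[OF om.bounded_linear_right] .
  then show ?thesis unfolding Lmat_def
    by (intro matrix_works) (simp add: linear_def scalar_mult_eq_scaleR[abs_def])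
qed

lemma linear_Lmat: "linear Lmat"
  by (rule linearI) (simp_all add: matrix_eq mv.add_left mv.scaleR_left om.add_left om.scaleR_left)

lemma bounded_linear_Lmat: "bounded_linear Lmat"
  using linear_Lmat by (simp add: linear_conv_bounded_linear)

lemmas Lmat_simps = linear_add[OF linear_Lmat] linear_diff[OF linear_Lmat] linear_cmul[OF linear_Lmat]
  linear_neg[OF linear_Lmat] linear_0[OF linear_Lmat]

lemma oct_mult_one [simp]: "oct_mult u (oct_unit 0) = u"
  by (simp add: oct_eq_iff oct_mult_nth)

lemma Lmat_inject [simp]: "Lmat u = Lmat v \<longleftrightarrow> u = v"
  by (metis Lmat_mult_vec oct_mult_one)

lemma transpose_Lmat: "u \<in> ImO \<Longrightarrow> transpose (Lmat u) = - Lmat u"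
  by (simp add: ImO_iff vec_eq_iff[where 'b = 8] all_8 transpose_def Lmat_def matrix_def axis_def oct_mult_nth)

text \<open>Together with \<open>transpose_Lmat\<close> these relations carry the computations with matrices below: they replace
  the missing associativity of the octonions.\<close>

lemma clifford:
  assumes "u \<in> ImO" "v \<in> ImO"
  shows "Lmat u ** Lmat v + Lmat v ** Lmat u = (- 2 * (u \<bullet> v)) *\<^sub>R mat 1"
  using assms
  by (simp add: matrix_eq mv.add_left mv.scaleR_left oct_eq_iff oct_mult_nth ImO_iff inner_oct
      flip: matrix_vector_mul_assoc) (simp add: algebra_simps)

lemma Lmat_square:
  assumes "u \<in> ImO" shows "Lmat u ** Lmat u = - (u \<bullet> u) *\<^sub>R mat 1"
proof -
  have "2 *\<^sub>R (Lmat u ** Lmat u) = 2 *\<^sub>R (- (u \<bullet> u) *\<^sub>R mat 1)"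
    using clifford[OF assms assms] by (simp add: scaleR_2)
  then show ?thesis by (simp only: scaleR_cancel_left) simp
qed

lemma ImO_units: "i \<in> {1..7} \<Longrightarrow> oct_unit i \<in> ImO"
  unfolding ImO_iff by (auto simp: oct_unit_def axis_def atLeastAtMost_iff numeral_eq_Suc le_Suc_eq)


lemma seven: "{1..7::nat} = {1, 2, 3, 4, 5, 6, 7}"
  by auto

lemma inner_units:
  "i \<in> {1..7} \<Longrightarrow> j \<in> {1..7} \<Longrightarrow> oct_unit i \<bullet> oct_unit j = (if i = j then 1 else 0)"
  unfolding seven by (auto simp: inner_oct)

lemma ImO_expand: "u \<in> ImO \<Longrightarrow> u = (\<Sum>i\<in>{1..7}. (u \<bullet> oct_unit i) *\<^sub>R oct_unit i)"
  unfolding seven by (simp add: oct_eq_iff inner_oct ImO_iff)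

lemma oct_cnj_nth: "oct_cnj p $ 0 = p $ 0" "oct_cnj p $ 1 = - p $ 1" "oct_cnj p $ 2 = - p $ 2"
  "oct_cnj p $ 3 = - p $ 3" "oct_cnj p $ 4 = - p $ 4" "oct_cnj p $ 5 = - p $ 5" "oct_cnj p $ 6 = - p $ 6"
  "oct_cnj p $ 7 = - p $ 7"
  by (simp_all add: oct_cnj_def oct_fst_def oct_snd_def)

text \<open>For orthonormal \<open>q, q'\<close> the cross product is the imaginary unit \<open>r\<close> with \<open>r q = q'\<close>: this and the next
  lemma are the two directions.\<close>

lemma oct_cross_mult:
  "oct_mult (oct_cross q q') q = (q \<bullet> q) *\<^sub>R q' - (q \<bullet> q') *\<^sub>R q"
  by (simp add: oct_eq_iff oct_mult_nth oct_cross_def oct_Im_def inner_oct oct_cnj_nth) (simp add: algebra_simps)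

lemma oct_cross_of_mult:
  "r \<in> ImO \<Longrightarrow> oct_cross q (oct_mult r q) = (q \<bullet> q) *\<^sub>R r"
  by (simp add: oct_eq_iff oct_mult_nth oct_cross_def oct_Im_def inner_oct oct_cnj_nth ImO_iff) (simp add: algebra_simps)

section \<open>Spin(7) as a normalizer\<close>

text \<open>Closed conditions that single out Spin(7) among all matrices; unlike membership in a generated group, they can
  be verified along a curve by differentiation.\<close>

definition spin_like :: "real ^ 8 ^ 8 \<Rightarrow> bool" where
  "spin_like g \<longleftrightarrow> transpose g ** g = mat 1 \<and> (\<forall>u\<in>ImO. \<exists>w\<in>ImO. g ** Lmat u ** transpose g = Lmat w)"

lemma transpose_right_inverse: "transpose g ** g = mat 1 \<Longrightarrow> g ** transpose g = mat 1" for g :: "real ^ 8 ^ 8"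
  by (simp add: matrix_left_right_inverse)

lemma matrix_inv_orthogonal: "transpose g ** g = mat 1 \<Longrightarrow> matrix_inv g = transpose g" for g :: "real ^ 8 ^ 8"
proof -
  assume o: "transpose g ** g = mat 1"
  have "g ** matrix_inv g = mat 1 \<and> matrix_inv g ** g = mat 1"
    unfolding matrix_inv_def
    by (rule someI[of _ "transpose g"]) (simp add: o transpose_right_inverse)
  then have "transpose g = (transpose g ** g) ** matrix_inv g" by (simp flip: matrix_mul_assoc)
  then show ?thesis by (simp add: o)
qed

lemma spin_like_mult:
  assumes "spin_like g" "spin_like h" shows "spin_like (g ** h)"
  unfolding spin_like_def
proof (intro conjI ballI)
  have "transpose (g ** h) ** (g ** h) = transpose h ** (transpose g ** g) ** h"
    by (simp add: matrix_transpose_mul matrix_mul_assoc)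
  then show "transpose (g ** h) ** (g ** h) = mat 1" using assms by (simp add: spin_like_def)
  fix u assume "u \<in> ImO"
  then obtain v where v: "v \<in> ImO" "h ** Lmat u ** transpose h = Lmat v" using assms spin_like_def by blast
  then obtain w where w: "w \<in> ImO" "g ** Lmat v ** transpose g = Lmat w" using assms spin_like_def by blast
  have "g ** h ** Lmat u ** transpose (g ** h) = g ** (h ** Lmat u ** transpose h) ** transpose g"
    by (simp add: matrix_transpose_mul matrix_mul_assoc)
  then show "\<exists>w\<in>ImO. g ** h ** Lmat u ** transpose (g ** h) = Lmat w" using v w by auto
qed

text \<open>A generator of Spin(7) acts on the imaginary octonions by the negative of a reflection.\<close>

lemma Lmat_reflection:
  assumes u: "u \<in> ImO" "norm u = 1" and v: "v \<in> ImO"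
  shows "Lmat u ** Lmat v ** transpose (Lmat u) = Lmat ((2 * (u \<bullet> v)) *\<^sub>R u - v)"
proof -
  have uu: "Lmat u ** Lmat u = - mat 1"
    using Lmat_square[OF u(1)] u(2) by (simp add: norm_eq_sqrt_inner)
  have "Lmat u ** Lmat v = (- 2 * (u \<bullet> v)) *\<^sub>R mat 1 - Lmat v ** Lmat u"
    using clifford[OF u(1) v] by (simp add: algebra_simps)
  then have "Lmat u ** Lmat v ** transpose (Lmat u) = ((- 2 * (u \<bullet> v)) *\<^sub>R mat 1 - Lmat v ** Lmat u) ** (- Lmat u)"
    using transpose_Lmat[OF u(1)] by simp
  also have "\<dots> = (2 * (u \<bullet> v)) *\<^sub>R Lmat u + Lmat v ** (Lmat u ** Lmat u)"
    by (simp add: mm_simps matrix_mul_assoc)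
  finally show ?thesis by (simp add: uu mm_simps Lmat_simps)
qed

lemma spin_like_Lmat:
  assumes u: "u \<in> ImO" "norm u = 1" shows "spin_like (Lmat u)"
  unfolding spin_like_def
proof (intro conjI ballI)
  show "transpose (Lmat u) ** Lmat u = mat 1"
    using Lmat_square[OF u(1)] u(2) transpose_Lmat[OF u(1)] by (simp add: norm_eq_sqrt_inner mm_simps)
  fix v assume v: "v \<in> ImO"
  show "\<exists>w\<in>ImO. Lmat u ** Lmat v ** transpose (Lmat u) = Lmat w"
    using Lmat_reflection[OF u v] u(1) v by (intro bexI[of _ "(2 * (u \<bullet> v)) *\<^sub>R u - v"]) (auto simp: ImO_iff)
qed

lemma spin_like_one: "spin_like (mat 1)"
  by (auto simp: spin_like_def)

text \<open>The statement for the transpose is carried along because closure under inverses needs it.\<close>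

lemma Spin7_imp_spin_like: "g \<in> Spin7 \<Longrightarrow> spin_like g \<and> spin_like (transpose g)"
proof (induction rule: Spin7.induct)
  case (gen u)
  have "spin_like (Lmat (- u))" using gen by (intro spin_like_Lmat) (auto simp: ImO_iff)
  then show ?case using spin_like_Lmat[OF gen] transpose_Lmat[OF gen(1)] by (simp add: Lmat_simps)
next
  case (mult g h) then show ?case by (simp add: spin_like_mult matrix_transpose_mul)
next
  case (inv g) then show ?case by (simp add: spin_like_def matrix_inv_orthogonal)
qed (simp add: spin_like_one)

lemma spin_like_norm:
  assumes g: "spin_like g" and u: "u \<in> ImO" "w \<in> ImO" "g ** Lmat u ** transpose g = Lmat w"
    and v: "v \<in> ImO" "x \<in> ImO" "g ** Lmat v ** transpose g = Lmat x"
  shows "w \<bullet> x = u \<bullet> v"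
proof -
  have o: "transpose g ** g = mat 1" "g ** transpose g = mat 1"
    using g transpose_right_inverse by (auto simp: spin_like_def)
  have *: "g ** A ** transpose g ** (g ** B ** transpose g) = g ** (A ** B) ** transpose g" for A B
  proof -
    have "g ** A ** transpose g ** (g ** B ** transpose g) = g ** A ** (transpose g ** g) ** B ** transpose g"
      by (simp add: matrix_mul_assoc)
    then show ?thesis by (simp add: o matrix_mul_assoc)
  qed
  have "Lmat w ** Lmat x + Lmat x ** Lmat w = g ** (Lmat u ** Lmat v + Lmat v ** Lmat u) ** transpose g"
    unfolding u(3)[symmetric] v(3)[symmetric] * by (simp add: mm_simps)
  then have "(- 2 * (w \<bullet> x)) *\<^sub>R (mat 1 :: real^8^8) = (- 2 * (u \<bullet> v)) *\<^sub>R mat 1"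
    unfolding clifford[OF u(2) v(2)] clifford[OF u(1) v(1)] by (simp add: mm_simps o)
  moreover have "(mat 1 :: real^8^8) \<noteq> 0" by (simp add: vec_eq_iff mat_def)
  ultimately show ?thesis by simp
qed

text \<open>Without this table, nested products with basis elements expand into sums of exponential size before they
  collapse.\<close>

lemmas oct_mult_unit_nth =
  oct_mult_nth[where p = "oct_unit (Suc 0)", simplified]
  oct_mult_nth[where p = "oct_unit 2", simplified]
  oct_mult_nth[where p = "oct_unit 3", simplified]
  oct_mult_nth[where p = "oct_unit 4", simplified]
  oct_mult_nth[where p = "oct_unit 5", simplified]
  oct_mult_nth[where p = "oct_unit 6", simplified]
  oct_mult_nth[where p = "oct_unit 7", simplified]

lemma oct_eq_sum_units: "x = (x $ 0) *\<^sub>R oct_unit 0 + (\<Sum>i\<in>{1..7}. (x \<bullet> oct_unit i) *\<^sub>R oct_unit i)"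
  unfolding seven by (simp add: oct_eq_iff inner_oct)

text \<open>The products of three basis elements along lines of the Fano plane are diagonal matrices with entries
  \<open>1\<close> and \<open>-1\<close>, and the only vectors on which they all act as on the unit are its multiples. So
  the matrix multiplies the unit by a scalar, and therefore every octonion.\<close>

lemma commute_units_scalar:
  fixes p :: "real ^ 8 ^ 8"
  assumes c: "\<And>i. i \<in> {1..7} \<Longrightarrow> p ** Lmat (oct_unit i) = Lmat (oct_unit i) ** p"
  obtains c where "p = c *\<^sub>R mat 1"
proof -
  have c': "p *v oct_mult (oct_unit i) x = oct_mult (oct_unit i) (p *v x)" if "i \<in> {1..7}" for i x
    using arg_cong[OF c[OF that], of "\<lambda>A. A *v x"] by (simp flip: matrix_vector_mul_assoc)
  define m where "m = p *v oct_unit 0"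
  have t: "p *v oct_mult (oct_unit i) (oct_mult (oct_unit j) (oct_mult (oct_unit k) (oct_unit 0)))
     = oct_mult (oct_unit i) (oct_mult (oct_unit j) (oct_mult (oct_unit k) m))"
    if "i \<in> {1..7}" "j \<in> {1..7}" "k \<in> {1..7}" for i j k
    unfolding m_def c'[OF that(1)] c'[OF that(2)] c'[OF that(3)] ..
  have a: "oct_mult (oct_unit 1) (oct_mult (oct_unit 2) (oct_mult (oct_unit 3) (oct_unit 0))) = - oct_unit 0"
    "oct_mult (oct_unit 1) (oct_mult (oct_unit 4) (oct_mult (oct_unit 5) (oct_unit 0))) = oct_unit 0"
    "oct_mult (oct_unit 2) (oct_mult (oct_unit 4) (oct_mult (oct_unit 6) (oct_unit 0))) = oct_unit 0"
    by (simp_all add: oct_eq_iff oct_mult_unit_nth del: oct_mult_one)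
  have "oct_mult (oct_unit 1) (oct_mult (oct_unit 2) (oct_mult (oct_unit 3) m)) = - m"
    "oct_mult (oct_unit 1) (oct_mult (oct_unit 4) (oct_mult (oct_unit 5) m)) = m"
    "oct_mult (oct_unit 2) (oct_mult (oct_unit 4) (oct_mult (oct_unit 6) m)) = m"
    using t[of 1 2 3, unfolded a mv.minus_right, folded m_def, symmetric]
      t[of 1 4 5, unfolded a mv.minus_right, folded m_def, symmetric]
      t[of 2 4 6, unfolded a mv.minus_right, folded m_def, symmetric] by simp_all
  then have m: "m = (m $ 0) *\<^sub>R oct_unit 0"
    by (simp add: oct_eq_iff oct_mult_unit_nth)
  have "p *v oct_unit i = (m $ 0) *\<^sub>R oct_unit i" if "i \<in> {1..7}" for i
    using c'[OF that, of "oct_unit 0"] m by (metis m_def oct_mult_one om.scaleR_right)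
  moreover have "p *v oct_unit 0 = (m $ 0) *\<^sub>R oct_unit 0" using m m_def by simp
  ultimately have "p *v ((x $ 0) *\<^sub>R oct_unit 0 + (\<Sum>i\<in>{1..7}. (x \<bullet> oct_unit i) *\<^sub>R oct_unit i))
      = (m $ 0) *\<^sub>R ((x $ 0) *\<^sub>R oct_unit 0 + (\<Sum>i\<in>{1..7}. (x \<bullet> oct_unit i) *\<^sub>R oct_unit i))" for x
    by (simp only: mv.add_right mv.sum_right mv.scaleR_right scaleR_sum_right scaleR_add_right
        scaleR_scaleR mult.commute cong: sum.cong)
  then have "p *v x = ((m $ 0) *\<^sub>R mat 1) *v x" for x
    unfolding oct_eq_sum_units[symmetric] by (simp add: mv.scaleR_left)
  then have "p = (m $ 0) *\<^sub>R mat 1" by (simp add: matrix_eq)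
  then show ?thesis using that by blast
qed

text \<open>The product of the seven left multiplications is the identity, and seven is odd.\<close>

lemma not_anticommute_units:
  fixes p :: "real ^ 8 ^ 8"
  assumes c: "\<And>i. i \<in> {1..7} \<Longrightarrow> p ** Lmat (oct_unit i) = - (Lmat (oct_unit i) ** p)"
  shows "p = 0"
proof -
  have c': "p *v oct_mult (oct_unit i) x = - oct_mult (oct_unit i) (p *v x)" if "i \<in> {1..7}" for i x
    using arg_cong[OF c[OF that], of "\<lambda>A. A *v x"] by (simp add: mv.minus_left flip: matrix_vector_mul_assoc)
  define W where "W x = oct_mult (oct_unit 1) (oct_mult (oct_unit 2) (oct_mult (oct_unit 3) (oct_mult (oct_unit 4)
      (oct_mult (oct_unit 5) (oct_mult (oct_unit 6) (oct_mult (oct_unit 7) x))))))" for x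
  have W: "W x = x" for x
    by (simp add: W_def oct_eq_iff oct_mult_unit_nth)
  have "p *v W x = - W (p *v x)" for x
    by (simp add: W_def c' om.minus_right)
  then have "- (p *v x) = p *v x" for x by (simp only: W)
  then have "- ((p *v x) $ i) = (p *v x) $ i" for x i by (metis vector_uminus_component)
  then have "p *v x = 0 *v x" for x by (simp add: vec_eq_iff)
  then show ?thesis by (simp add: matrix_eq)
qed

lemma one_matrix_nonzero: "(mat 1 :: real ^ 8 ^ 8) \<noteq> 0"
  by (simp add: vec_eq_iff mat_def)

text \<open>The induction of the Cartan-Dieudonne theorem. The generators act by negatives of reflections, so the basis
  vectors can only be fixed up to a common sign, which flips at every step that uses a reflection.\<close>

lemma Spin7_transform_units:
  assumes g: "spin_like g" and "k \<le> 7"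
  shows "\<exists>h\<in>Spin7. \<exists>s::real. (s = 1 \<or> s = - 1) \<and>
    (\<forall>i\<in>{1..k}. h ** g ** Lmat (oct_unit i) ** transpose (h ** g) = s *\<^sub>R Lmat (oct_unit i))"
  using \<open>k \<le> 7\<close>
proof (induction k)
  case 0 then show ?case using Spin7.one by auto
next
  case (Suc k)
  then have "k \<le> 7" by simp
  from Suc.IH[OF this] obtain h s where h: "h \<in> Spin7" and s: "s = 1 \<or> s = - 1"
    and hk: "\<And>i. i \<in> {1..k} \<Longrightarrow> h ** g ** Lmat (oct_unit i) ** transpose (h ** g) = s *\<^sub>R Lmat (oct_unit i)"
    by blast
  define p where "p = h ** g"
  have ss: "s * s = 1" using s by auto
  have p: "spin_like p" using h g Spin7_imp_spin_like spin_like_mult p_def by blast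
  have k1: "Suc k \<in> {1..7}" using Suc by auto
  have e1: "oct_unit (Suc k) \<in> ImO" using ImO_units[OF k1] .
  obtain w where w: "w \<in> ImO" "p ** Lmat (oct_unit (Suc k)) ** transpose p = Lmat w"
    using p e1 spin_like_def by blast
  have ei: "oct_unit i \<in> ImO" "i \<in> {1..7}" "s *\<^sub>R oct_unit i \<in> ImO"
    "p ** Lmat (oct_unit i) ** transpose p = Lmat (s *\<^sub>R oct_unit i)" if "i \<in> {1..k}" for i
  proof -
    show "i \<in> {1..7}" using that Suc.prems by auto
    then show "oct_unit i \<in> ImO" by (rule ImO_units)
    then show "s *\<^sub>R oct_unit i \<in> ImO" by (simp add: ImO_iff)
    show "p ** Lmat (oct_unit i) ** transpose p = Lmat (s *\<^sub>R oct_unit i)"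
      using hk[OF that] by (simp add: p_def Lmat_simps)
  qed
  have ww: "w \<bullet> w = 1"
    using spin_like_norm[OF p e1 w e1 w] inner_units[OF k1 k1] by simp
  have wi: "w \<bullet> oct_unit i = 0" if "i \<in> {1..k}" for i
    using spin_like_norm[OF p e1 w ei(1)[OF that] ei(3,4)[OF that]] inner_units[OF k1 ei(2)[OF that]] that ss
    by auto
  show ?case
  proof (cases "w = s *\<^sub>R oct_unit (Suc k)")
    case True
    then have "\<forall>i\<in>{1..Suc k}. h ** g ** Lmat (oct_unit i) ** transpose (h ** g) = s *\<^sub>R Lmat (oct_unit i)"
      using hk w(2) by (auto simp: p_def Lmat_simps le_Suc_eq)
    then show ?thesis using h s by blast
  next
    case False
    \<comment> \<open>The reflection along \<open>d\<close> exchanges the image \<open>w\<close> and the target \<open>s *\<^sub>R oct_unit (Suc k)\<close>.\<close>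
    define d where "d = w - s *\<^sub>R oct_unit (Suc k)"
    define u where "u = (1 / norm d) *\<^sub>R d"
    have d: "norm d \<noteq> 0" using False by (simp add: d_def)
    have dI: "d \<in> ImO" using w(1) e1 by (simp add: d_def ImO_iff)
    have u: "u \<in> ImO" "norm u = 1" using dI d by (auto simp: u_def ImO_iff)
    have dd: "d \<bullet> d = 2 * (d \<bullet> w)"
      using ww inner_units[OF k1 k1] ss
      by (simp add: d_def inner_diff_left inner_diff_right inner_commute algebra_simps)
    have uw: "(2 * (u \<bullet> w)) *\<^sub>R u - w = - s *\<^sub>R oct_unit (Suc k)"
    proof -
      have "(2 * (u \<bullet> w)) *\<^sub>R u = ((d \<bullet> d) / (norm d * norm d)) *\<^sub>R d"
        unfolding dd by (simp add: u_def)
      also have "\<dots> = d" using d by (simp add: power2_norm_eq_inner[symmetric] power2_eq_square)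
      finally show ?thesis by (simp add: d_def)
    qed
    have ui: "u \<bullet> oct_unit i = 0" if "i \<in> {1..k}" for i
      using wi[OF that] inner_units[OF k1 ei(2)[OF that]] that by (simp add: u_def d_def inner_diff_left)
    have conj: "(Lmat u ** h) ** g ** A ** transpose ((Lmat u ** h) ** g)
        = Lmat u ** (p ** A ** transpose p) ** transpose (Lmat u)" for A
      by (simp add: p_def matrix_transpose_mul matrix_mul_assoc)
    have "(Lmat u ** h) ** g ** Lmat (oct_unit i) ** transpose ((Lmat u ** h) ** g) = (- s) *\<^sub>R Lmat (oct_unit i)"
      if "i \<in> {1..Suc k}" for i
    proof (cases "i = Suc k")
      case True
      then show ?thesis unfolding conj True w(2) Lmat_reflection[OF u w(1)] uw by (simp add: Lmat_simps)
    next
      case False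
      then have i: "i \<in> {1..k}" using that by auto
      show ?thesis unfolding conj ei(4)[OF i] Lmat_reflection[OF u ei(3)[OF i]]
        using ui[OF i] by (simp add: Lmat_simps)
    qed
    moreover have "Lmat u ** h \<in> Spin7" using u h Spin7.gen Spin7.mult by blast
    ultimately show ?thesis using s by (intro bexI[of _ "Lmat u ** h"] exI[of _ "- s"]) auto
  qed
qed

text \<open>After the normalization of \<open>Spin7_transform_units\<close> the sign must be \<open>1\<close>, and what remains is a scalar
  orthogonal matrix.\<close>

lemma spin_like_imp_Spin7:
  assumes g: "spin_like g" shows "g \<in> Spin7"
proof -
  obtain h s where h: "h \<in> Spin7" and s: "s = 1 \<or> s = - 1"
    and hk: "\<And>i. i \<in> {1..7} \<Longrightarrow> h ** g ** Lmat (oct_unit i) ** transpose (h ** g) = s *\<^sub>R Lmat (oct_unit i)"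
    using Spin7_transform_units[OF g order_refl] by blast
  define p where "p = h ** g"
  have p: "transpose p ** p = mat 1"
    using h g Spin7_imp_spin_like spin_like_mult p_def unfolding spin_like_def by blast
  have ps: "p ** Lmat (oct_unit i) = s *\<^sub>R (Lmat (oct_unit i) ** p)" if "i \<in> {1..7}" for i
  proof -
    have "p ** Lmat (oct_unit i) = (p ** Lmat (oct_unit i) ** transpose p) ** p"
      by (simp add: p flip: matrix_mul_assoc)
    then show ?thesis using hk[OF that] by (simp add: p_def mm_simps)
  qed
  have "p \<noteq> 0" using p by (metis mm.zero_right one_matrix_nonzero)
  then have "s \<noteq> - 1" using ps not_anticommute_units[of p] by auto
  then have "s = 1" using s by auto
  then obtain c where c: "p = c *\<^sub>R mat 1"
    using ps commute_units_scalar[of p] by auto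
  have "transpose p ** p = (c * c) *\<^sub>R mat 1" by (simp add: c transpose_simps mm_simps)
  then have "(c * c - 1) *\<^sub>R (mat 1 :: real ^ 8 ^ 8) = 0" using p by (simp add: scaleR_diff_left)
  then have "c * c = 1" using one_matrix_nonzero by simp
  then have c1: "c = 1 \<or> c = - 1" by (simp add: square_eq_1_iff)
  have "- mat 1 = Lmat (oct_unit 1) ** Lmat (oct_unit 1)"
    using Lmat_square[OF ImO_units[of 1]] inner_units[of 1 1] by simp
  moreover have "oct_unit 1 \<in> ImO" "norm (oct_unit 1) = 1"
    using ImO_units[of 1] inner_units[of 1 1] by (auto simp: norm_eq_sqrt_inner)
  ultimately have "- mat 1 \<in> Spin7" using Spin7.gen Spin7.mult by metis
  then have pS: "p \<in> Spin7" using c1 c Spin7.one by auto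
  have "transpose h ** h = mat 1" using Spin7_imp_spin_like[OF h] by (simp add: spin_like_def)
  then have "g = matrix_inv h ** p" by (simp add: p_def matrix_inv_orthogonal matrix_mul_assoc)
  then show ?thesis using Spin7.inv[OF h] Spin7.mult pS by blast
qed

lemma Spin7_iff: "g \<in> Spin7 \<longleftrightarrow> spin_like g"
  using spin_like_imp_Spin7 Spin7_imp_spin_like by blast

section \<open>The groups and their Lie algebras\<close>

lemma G_grp_iff: "g \<in> G_grp I \<longleftrightarrow> spin_like g \<and> (\<forall>i\<in>I. g ** Lmat (oct_unit i) = Lmat (oct_unit i) ** g)"
  by (simp add: G_grp_def Spin7_iff)

lemma Lmat_chi:
  assumes g: "spin_like g" and u: "u \<in> ImO"
  shows "chi g u \<in> ImO" "Lmat (chi g u) = g ** Lmat u ** transpose g"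
proof -
  obtain w where w: "w \<in> ImO" "g ** Lmat u ** transpose g = Lmat w" using g u spin_like_def by blast
  have inv: "matrix_inv g = transpose g" using g by (simp add: spin_like_def matrix_inv_orthogonal)
  have "chi g u = w" unfolding chi_def inv w(2) by (rule the_equality) (use w in auto)
  then show "chi g u \<in> ImO" "Lmat (chi g u) = g ** Lmat u ** transpose g" using w by auto
qed

lemma linear_zero_on_curve:
  assumes L: "bounded_linear L" and c: "\<And>t. L (f t) = 0" and f: "(f has_vector_derivative d) (at (0::real))"
  shows "L d = 0"
proof -
  have "((\<lambda>t. L (f t)) has_vector_derivative L d) (at 0)"
    by (rule bounded_linear.has_vector_derivative[OF L f])
  then have "((\<lambda>t. 0) has_vector_derivative L d) (at (0::real))" by (simp add: c)
  then show ?thesis using vector_derivative_unique_at[OF has_vector_derivative_const] by metis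
qed

text \<open>The three conditions result from differentiating orthogonality, normalization of the left multiplications
  and commutation along a curve through the identity. For the second, that \<open>M\<close> is a left multiplication is the linear equation
  \<open>M = L\<^sub>M\<^sub>1\<close>, which the derivative inherits.\<close>

lemma g_linD:
  assumes "A \<in> g_lin I"
  shows "transpose A = - A"
    and "u \<in> ImO \<Longrightarrow> \<exists>w\<in>ImO. A ** Lmat u - Lmat u ** A = Lmat w"
    and "i \<in> I \<Longrightarrow> A ** Lmat (oct_unit i) = Lmat (oct_unit i) ** A"
proof -
  obtain \<gamma> where \<gamma>: "\<And>t. \<gamma> t \<in> G_grp I" "\<gamma> 0 = mat 1" "(\<gamma> has_vector_derivative A) (at (0::real))"
    using assms by (auto simp: g_lin_def lie_algebra_def)
  have sp: "spin_like (\<gamma> t)" for t using \<gamma>(1) G_grp_iff by blast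
  have d\<gamma>T: "((\<lambda>t. transpose (\<gamma> t)) has_vector_derivative transpose A) (at 0)"
    by (rule bounded_linear.has_vector_derivative[OF bounded_linear_transpose \<gamma>(3)])
  have "((\<lambda>t. transpose (\<gamma> t) ** \<gamma> t) has_vector_derivative transpose (\<gamma> 0) ** A + transpose A ** \<gamma> 0) (at 0)"
    by (rule mm.has_vector_derivative[OF d\<gamma>T \<gamma>(3)])
  moreover have "transpose (\<gamma> t) ** \<gamma> t = mat 1" for t using sp by (simp add: spin_like_def)
  ultimately have "A + transpose A = 0"
    using vector_derivative_unique_at[OF has_vector_derivative_const] \<gamma>(2) by fastforce
  then show skew: "transpose A = - A" by (simp add: eq_neg_iff_add_eq_0 add.commute)
  show "\<exists>w\<in>ImO. A ** Lmat u - Lmat u ** A = Lmat w" if u: "u \<in> ImO"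
  proof -
    define R where "R t = \<gamma> t ** Lmat u ** transpose (\<gamma> t)" for t
    have "((\<lambda>t. \<gamma> t ** Lmat u) has_vector_derivative A ** Lmat u) (at 0)"
      by (rule bounded_linear.has_vector_derivative[OF mm.bounded_linear_left \<gamma>(3)])
    from mm.has_vector_derivative[OF this d\<gamma>T]
    have dR: "(R has_vector_derivative A ** Lmat u - Lmat u ** A) (at 0)"
      unfolding R_def by (simp add: \<gamma>(2) skew mm_simps)
    define w where "w = (A ** Lmat u - Lmat u ** A) *v oct_unit 0"
    have R: "R t = Lmat (R t *v oct_unit 0)" "(R t *v oct_unit 0) $ 0 = 0" for t
      using Lmat_chi[OF sp[of t] u] by (simp_all add: R_def ImO_iff flip: Lmat_chi(2)[OF sp u])
    have "bounded_linear (\<lambda>M. M - Lmat (M *v oct_unit 0))"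
      by (intro bounded_linear_sub bounded_linear_ident bounded_linear_compose[OF bounded_linear_Lmat] mv.bounded_linear_left)
    from linear_zero_on_curve[OF this _ dR] R(1) have "A ** Lmat u - Lmat u ** A = Lmat w"
      by (simp add: w_def)
    moreover have "bounded_linear (\<lambda>M. (M *v oct_unit 0) $ (0 :: 8))"
      by (intro bounded_linear_compose[OF bounded_linear_vec_nth] mv.bounded_linear_left)
    from linear_zero_on_curve[OF this _ dR] R(2) have "w \<in> ImO" by (simp add: w_def ImO_iff)
    ultimately show ?thesis by blast
  qed
  show "A ** Lmat (oct_unit i) = Lmat (oct_unit i) ** A" if i: "i \<in> I"
  proof -
    have "bounded_linear (\<lambda>M. M ** Lmat (oct_unit i) - Lmat (oct_unit i) ** M)"
      by (intro bounded_linear_sub mm.bounded_linear_left mm.bounded_linear_right)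
    from linear_zero_on_curve[OF this _ \<gamma>(3)] show ?thesis using \<gamma>(1) i by (simp add: G_grp_iff)
  qed
qed

lemma one_G_grp: "mat 1 \<in> G_grp I"
  by (simp add: G_grp_iff spin_like_one)

lemma mult_G_grp: "g \<in> G_grp I \<Longrightarrow> h \<in> G_grp I \<Longrightarrow> g ** h \<in> G_grp I"
  unfolding G_grp_iff by (metis matrix_mul_assoc spin_like_mult)

lemma subspace_g_lin: "subspace (g_lin I)"
proof (rule subspaceI)
  show "0 \<in> g_lin I"
    unfolding g_lin_def lie_algebra_def
    by (auto intro!: exI[of _ "\<lambda>_. mat 1"] smooth_on_const one_G_grp)
next
  fix A B assume "A \<in> g_lin I" "B \<in> g_lin I"
  then obtain \<gamma> \<delta> where \<gamma>: "smooth_on UNIV \<gamma>" "range \<gamma> \<subseteq> G_grp I" "\<gamma> 0 = mat 1" "(\<gamma> has_vector_derivative A) (at (0::real))"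
    and \<delta>: "smooth_on UNIV \<delta>" "range \<delta> \<subseteq> G_grp I" "\<delta> 0 = mat 1" "(\<delta> has_vector_derivative B) (at (0::real))"
    unfolding g_lin_def lie_algebra_def by auto
  have "smooth_on UNIV (\<lambda>t. \<gamma> t ** \<delta> t)" by (rule smooth_on_bilinear[OF open_UNIV mm.bounded_bilinear_axioms \<gamma>(1) \<delta>(1)])
  moreover have "((\<lambda>t. \<gamma> t ** \<delta> t) has_vector_derivative A + B) (at 0)"
    using mm.has_vector_derivative[OF \<gamma>(4) \<delta>(4)] \<gamma>(3) \<delta>(3) by (simp add: add.commute)
  ultimately show "A + B \<in> g_lin I"
    unfolding g_lin_def lie_algebra_def using \<gamma> \<delta>
    by (auto intro!: exI[of _ "\<lambda>t. \<gamma> t ** \<delta> t"] mult_G_grp)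
next
  fix c A assume "A \<in> g_lin I"
  then obtain \<gamma> where \<gamma>: "smooth_on UNIV \<gamma>" "range \<gamma> \<subseteq> G_grp I" "\<gamma> 0 = mat 1" "(\<gamma> has_vector_derivative A) (at (0::real))"
    unfolding g_lin_def lie_algebra_def by auto
  have "((\<lambda>t. c * t) has_vector_derivative c) (at 0)"
    by (auto intro!: derivative_eq_intros simp flip: has_real_derivative_iff_has_vector_derivative)
  from vector_diff_chain_at[OF this, of \<gamma> A] have "((\<lambda>t. \<gamma> (c * t)) has_vector_derivative c *\<^sub>R A) (at 0)"
    using \<gamma>(4) by (simp add: o_def)
  then show "c *\<^sub>R A \<in> g_lin I"
    unfolding g_lin_def lie_algebra_def using \<gamma> smooth_on_rescale[OF \<gamma>(1), of c]
    by (auto intro!: exI[of _ "\<lambda>t. \<gamma> (c * t)"])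
qed

section \<open>The automorphism of order four and its eigenspaces\<close>

locale isotropy_index =
  fixes I :: "nat set"
  assumes proper: "I \<subset> {1..7}" and initial: "I = {1..card I}"
begin

lemma next_index: "card I + 1 \<in> {1..7}"
proof -
  have "card I < card {1..7::nat}" using proper by (intro psubset_card_mono) auto
  then show ?thesis by simp
qed

lemma index_bounds: "i \<in> I \<Longrightarrow> i \<in> {1..7} \<and> i \<noteq> card I + 1"
proof -
  assume i: "i \<in> I"
  then have "i \<in> {1..card I}" by (subst initial[symmetric])
  then show ?thesis using i proper by auto
qed

definition J :: "real ^ 8 ^ 8" where "J = Lmat (e_vec I)"

lemma e_ImO: "e_vec I \<in> ImO"
  unfolding e_vec_def using ImO_units[OF next_index] .

lemma norm_e: "norm (e_vec I) = 1"
  unfolding e_vec_def using inner_units[OF next_index next_index] by (simp add: norm_eq_sqrt_inner)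

lemma J_square: "J ** J = - mat 1"
  using Lmat_square[OF e_ImO] norm_e by (simp add: J_def norm_eq_sqrt_inner)

lemma transpose_J: "transpose J = - J"
  using transpose_Lmat[OF e_ImO] by (simp add: J_def)

lemma J_cancel [simp]: "J ** (J ** A) = - A" "A ** J ** J = - A"
  by (simp_all add: matrix_mul_assoc[of J J] J_square mm_simps matrix_mul_assoc[symmetric, of A J J])

lemma J_vec_cancel [simp]: "J *v (J *v x) = - x"
  by (simp add: matrix_vector_mul_assoc J_square mv.minus_left)

lemma J_anticommutes: "i \<in> I \<Longrightarrow> J ** Lmat (oct_unit i) = - (Lmat (oct_unit i) ** J)"
  using clifford[OF e_ImO ImO_units[of i]] index_bounds[of i] inner_units[OF next_index, of i]
  by (simp add: J_def e_vec_def eq_neg_iff_add_eq_0)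

lemma spin_like_J: "spin_like J"
  unfolding J_def by (rule spin_like_Lmat[OF e_ImO norm_e])

text \<open>\<open>J\<close> anticommutes with the \<open>L\<^sub>i\<close> for \<open>i \<in> I\<close>, and the two signs cancel in the conjugate.\<close>

lemma conj_J_G_grp: assumes "g \<in> G_grp I" shows "- (J ** g ** J) \<in> G_grp I"
proof -
  have "spin_like (- J)" using Spin7_imp_spin_like[OF spin_like_imp_Spin7[OF spin_like_J]] by (simp add: transpose_J)
  then have "spin_like (J ** g ** (- J))" using assms spin_like_J spin_like_mult G_grp_iff by blast
  moreover have "J ** g ** J ** Lmat (oct_unit i) = Lmat (oct_unit i) ** (J ** g ** J)" if i: "i \<in> I" for i
  proof -
    let ?L = "Lmat (oct_unit i)"
    have "J ** g ** J ** ?L = J ** g ** (J ** ?L)" by (simp add: matrix_mul_assoc)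
    also have "\<dots> = - (J ** (g ** ?L) ** J)" by (simp add: J_anticommutes[OF i] mm_simps matrix_mul_assoc)
    also have "g ** ?L = ?L ** g" using assms i by (simp add: G_grp_iff)
    also have "- (J ** (?L ** g) ** J) = - (J ** ?L) ** g ** J" by (simp add: mm_simps matrix_mul_assoc)
    also have "\<dots> = ?L ** (J ** g ** J)" by (simp add: J_anticommutes[OF i] mm_simps matrix_mul_assoc)
    finally show ?thesis .
  qed
  ultimately show ?thesis by (simp add: G_grp_iff mm_simps)
qed

lemma conj_J_g_lin: assumes "A \<in> g_lin I" shows "J ** A ** J \<in> g_lin I"
proof -
  obtain \<gamma> where \<gamma>: "smooth_on UNIV \<gamma>" "range \<gamma> \<subseteq> G_grp I" "\<gamma> 0 = mat 1" "(\<gamma> has_vector_derivative A) (at (0::real))"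
    using assms unfolding g_lin_def lie_algebra_def by auto
  have bl: "bounded_linear (\<lambda>M. - (J ** M ** J))"
    by (intro bounded_linear_minus bounded_linear_compose[OF mm.bounded_linear_left] mm.bounded_linear_right)
  have "- (J ** A ** J) \<in> g_lin I"
    unfolding g_lin_def lie_algebra_def
    using \<gamma> smooth_on_bounded_linear[OF open_UNIV bl \<gamma>(1)] bounded_linear.has_vector_derivative[OF bl \<gamma>(4)]
    by (auto intro!: exI[of _ "\<lambda>t. - (J ** \<gamma> t ** J)"] conj_J_G_grp simp: J_square)
  from subspace_neg[OF subspace_g_lin this] show ?thesis by simp
qed

lemma tau_eq: "tau I (g, T) = (- (J ** g ** J), - (J *v T))"
proof -
  have "matrix_inv (- J) = J"
    using matrix_inv_orthogonal[of "- J"] by (simp add: transpose_simps transpose_J mm_simps J_square)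
  then show ?thesis by (simp add: tau_def mm_simps mv.zero_right mv.minus_left flip: J_def)
qed

lemma dtau_eq: "dtau I (g, T) = (- (J ** g ** J), - (J *v T))"
proof -
  have eq: "tau I = (\<lambda>p. (- (J ** fst p ** J), - (J *v snd p)))"
    by (auto simp: fun_eq_iff tau_eq)
  have "bounded_linear (tau I)" unfolding eq
    by (intro bounded_linear_Pair bounded_linear_minus bounded_linear_compose[OF mm.bounded_linear_left]
        bounded_linear_compose[OF mm.bounded_linear_right] bounded_linear_compose[OF mv.bounded_linear_right]
        bounded_linear_fst bounded_linear_snd)
  then have "dtau I = tau I"
    unfolding dtau_def using frechet_derivative_at[OF bounded_linear_imp_has_derivative] by metis
  then show ?thesis by (simp add: tau_eq)
qed

end

lemma aff8_eq_iff: "v = w \<longleftrightarrow> (\<forall>i j. fst v $ i $ j = fst w $ i $ j) \<and> (\<forall>i. snd v $ i = snd w $ i)"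
  for v w :: "'a aff8"
  by (auto simp: prod_eq_iff vec_eq_iff)

lemma cscale_nth: "fst (cscale c v) $ i $ j = c * fst v $ i $ j" "snd (cscale c v) $ i = c * snd v $ i"
  by (cases v; simp)+

lemma cplx_nth: "fst (cplx a) $ i $ j = of_real (fst a $ i $ j)" "snd (cplx a) $ i = of_real (snd a $ i)"
  by (cases a; simp)+

lemma Re_part_nth: "fst (Re_part v) $ i $ j = Re (fst v $ i $ j)" "snd (Re_part v) $ i = Re (snd v $ i)"
  by (cases v; simp)+

lemma Im_part_nth: "fst (Im_part v) $ i $ j = Im (fst v $ i $ j)" "snd (Im_part v) $ i = Im (snd v $ i)"
  by (cases v; simp)+

declare cplx.simps [simp del] cscale.simps [simp del]

lemmas aff8_nth = cscale_nth cplx_nth Re_part_nth Im_part_nth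

lemma cplx_add: "cplx (a + b) = cplx a + cplx b"
  and cplx_minus: "cplx (- a) = - cplx a"
  and cplx_zero: "cplx 0 = 0"
  by (simp_all add: aff8_eq_iff aff8_nth)

lemma cscale_add_right: "cscale c (v + w) = cscale c v + cscale c w"
  and cscale_add_left: "cscale (c + d) v = cscale c v + cscale d v"
  and cscale_minus_left: "cscale (- c) v = - cscale c v"
  and cscale_minus_right: "cscale c (- v) = - cscale c v"
  and cscale_cscale [simp]: "cscale c (cscale d v) = cscale (c * d) v"
  and cscale_one [simp]: "cscale 1 v = v"
  and cscale_zero_left [simp]: "cscale 0 v = 0"
  and cscale_zero_right [simp]: "cscale c 0 = 0"
  by (simp_all add: aff8_eq_iff aff8_nth algebra_simps)

lemma cplx_inject [simp]: "cplx a = cplx b \<longleftrightarrow> a = b"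
  by (simp add: aff8_eq_iff aff8_nth)

lemma cscale_eq_zero [simp]: "cscale c v = 0 \<longleftrightarrow> c = 0 \<or> v = 0"
  by (auto simp: aff8_eq_iff aff8_nth)

lemma parts_of_sum [simp]:
  "Re_part (cplx a + cscale \<i> (cplx b)) = a" "Im_part (cplx a + cscale \<i> (cplx b)) = b"
  by (simp_all add: aff8_eq_iff aff8_nth)

lemma parts_add: "Re_part (v + w) = Re_part v + Re_part w" "Im_part (v + w) = Im_part v + Im_part w"
  by (simp_all add: aff8_eq_iff aff8_nth)

lemma parts_cscale:
  "Re_part (cscale c v) = Re c *\<^sub>R Re_part v - Im c *\<^sub>R Im_part v"
  "Im_part (cscale c v) = Re c *\<^sub>R Im_part v + Im c *\<^sub>R Re_part v"
  by (simp_all add: aff8_eq_iff aff8_nth)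

lemma cplx_comb_eq_zero_iff: "cplx a + cscale \<i> (cplx b) = 0 \<longleftrightarrow> a = 0 \<and> b = 0"
  by (auto simp: aff8_eq_iff aff8_nth complex_eq_iff)

definition average :: "complex \<Rightarrow> (complex aff8 \<Rightarrow> complex aff8) \<Rightarrow> complex aff8 \<Rightarrow> complex aff8" where
  "average \<omega> D v = cscale (1 / 4) (v + cscale \<omega> (D v) + cscale (\<omega> * \<omega>) (D (D v)) + cscale (\<omega> * \<omega> * \<omega>) (D (D (D v))))"

text \<open>Averaging the powers of an operator against the powers of a fourth root of unity \<open>\<omega>\<close> projects to the
  eigenspace of \<open>\<omega>\<inverse>\<close>, so a sum of eigenvectors determines its summands.\<close>

lemma four_eigenvectors_determined:
  fixes D :: "complex aff8 \<Rightarrow> complex aff8"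
  assumes add: "\<And>v w. D (v + w) = D v + D w" and hom: "\<And>c v. D (cscale c v) = cscale c (D v)"
    and eig: "D p = cscale (- \<i>) p" "D q = q" "D r = cscale \<i> r" "D s = - s"
    and v: "v = p + q + r + s"
  shows "p = average \<i> D v" "q = average 1 D v" "r = average (- \<i>) D v" "s = average (- 1) D v"
proof -
  have m: "D (- w) = - D w" for w using hom[of "- 1" w] by (simp add: cscale_minus_left)
  have df: "D (w - w') = D w - D w'" for w w' using add[of w "- w'"] by (simp add: m)
  have D1: "D v = cscale (- \<i>) p + q + cscale \<i> r - s"
    by (simp add: v add eig)
  have D2: "D (D v) = - p + q - r + s"
    unfolding D1 by (simp add: add df m hom eig cscale_minus_left cscale_minus_right)
  have D3: "D (D (D v)) = cscale \<i> p + q - cscale \<i> r - s"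
    unfolding D2 by (simp add: add df m hom eig cscale_minus_left cscale_minus_right)
  show "p = average \<i> D v" "q = average 1 D v" "r = average (- \<i>) D v" "s = average (- 1) D v"
    unfolding average_def unfolding D3 unfolding D2 unfolding D1 unfolding v
    by (simp_all add: aff8_eq_iff aff8_nth) (simp_all add: algebra_simps)
qed

context isotropy_index
begin

definition P0 :: "real ^ 8 ^ 8 \<Rightarrow> real ^ 8 ^ 8" where "P0 A = (1 / 2) *\<^sub>R (A - J ** A ** J)"
definition P2 :: "real ^ 8 ^ 8 \<Rightarrow> real ^ 8 ^ 8" where "P2 A = (1 / 2) *\<^sub>R (A + J ** A ** J)"

lemma P0_P2_sum: "P0 A + P2 A = A"
  by (simp add: P0_def P2_def vec_eq_iff field_simps)

lemma P0_commutes: "J ** P0 A = P0 A ** J"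
  by (simp add: P0_def mm_simps matrix_mul_assoc[symmetric]) (simp add: matrix_mul_assoc J_square mm_simps add.commute)

lemma P2_anticommutes: "J ** P2 A = - (P2 A ** J)"
  by (simp add: P2_def mm_simps matrix_mul_assoc[symmetric] J_square)
    (simp add: algebra_simps flip: scaleR_minus_right)

lemma P0_g_lin: "A \<in> g_lin I \<Longrightarrow> P0 A \<in> g_lin I"
  unfolding P0_def by (intro subspace_scale subspace_diff subspace_g_lin conj_J_g_lin)

lemma P2_g_lin: "A \<in> g_lin I \<Longrightarrow> P2 A \<in> g_lin I"
  unfolding P2_def by (intro subspace_scale subspace_add subspace_g_lin conj_J_g_lin)

lemma dtau_linear: "dtau I (a + b) = dtau I a + dtau I b" "dtau I (r *\<^sub>R a) = r *\<^sub>R dtau I a"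
  by (cases a; cases b; simp add: dtau_eq mm_simps mv.add_right mv.scaleR_right)+

lemma dtau_cplx_add: "dtau_cplx I (v + w) = dtau_cplx I v + dtau_cplx I w"
  by (simp add: dtau_cplx_def parts_add dtau_linear cplx_add cscale_add_right)

lemma dtau_diff: "dtau I (a - b) = dtau I a - dtau I b"
  using dtau_linear(1)[of a "- 1 *\<^sub>R b"] unfolding dtau_linear(2) by simp

lemma dtau_cplx_cscale: "dtau_cplx I (cscale c v) = cscale c (dtau_cplx I v)"
proof -
  obtain x y where c: "c = Complex x y" by (cases c)
  show ?thesis
    by (simp add: c dtau_cplx_def parts_cscale dtau_linear dtau_diff aff8_eq_iff aff8_nth)
      (simp add: complex_eq_iff algebra_simps)
qed

lemma dtau_cplx_cplx: "dtau_cplx I (cplx a) = cplx (dtau I a)"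
  using dtau_linear(2)[of 0 0] parts_of_sum[of a 0] by (simp add: dtau_cplx_def cplx_zero)

lemma g_cplxI: "a \<in> g_aff I \<Longrightarrow> b \<in> g_aff I \<Longrightarrow> cplx a + cscale \<i> (cplx b) \<in> g_cplx I"
  unfolding g_cplx_def by blast

lemma zero_g_aff: "0 \<in> g_aff I"
  using subspace_0[OF subspace_g_lin] by (auto simp: g_aff_def zero_prod_def)

text \<open>The four components, written down explicitly; \<open>g_comp_eq\<close> shows that they are the ones defined by the
  eigenspace decomposition.\<close>

definition comp :: "int \<Rightarrow> real aff8 \<Rightarrow> complex aff8" where
  "comp k a = (if k = 0 then cplx (P0 (fst a), 0)
     else if k = 2 then cplx (P2 (fst a), 0)
     else if k = -1 then cplx (0, (1 / 2) *\<^sub>R snd a) + cscale \<i> (cplx (0, (- 1 / 2) *\<^sub>R (J *v snd a)))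
     else cplx (0, (1 / 2) *\<^sub>R snd a) + cscale \<i> (cplx (0, (1 / 2) *\<^sub>R (J *v snd a))))"

lemma comp_g_eig:
  assumes a: "a \<in> g_aff I" and k: "k \<in> {-1, 0, 1, 2}"
  shows "comp k a \<in> g_eig I k"
proof -
  obtain A t where at: "a = (A, t)" by (cases a)
  have A: "A \<in> g_lin I" using a by (simp add: at g_aff_def)
  have z: "(0, x) \<in> g_aff I" for x using subspace_0[OF subspace_g_lin] by (simp add: g_aff_def)
  have w: "(B, 0) \<in> g_aff I \<longleftrightarrow> B \<in> g_lin I" for B by (simp add: g_aff_def)
  have mem: "comp k a \<in> g_cplx I"
    using g_cplxI[OF _ zero_g_aff, of "(P0 A, 0)"] g_cplxI[OF _ zero_g_aff, of "(P2 A, 0)"] P0_g_lin[OF A] P2_g_lin[OF A]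
    by (auto simp: comp_def at cplx_zero w intro!: g_cplxI z)
  have i: "\<i> powi 2 = - 1" "\<i> powi (-1) = - \<i>" by (simp_all add: power_int_def)
  have "dtau_cplx I (comp k a) = cscale (\<i> powi k) (comp k a)"
  proof -
    have P0: "J ** P0 A ** J = - P0 A"
      by (simp add: P0_commutes)
    have P2: "J ** P2 A ** J = P2 A"
      by (simp add: P2_anticommutes mm_simps)
    from k consider "k = 0" | "k = 2" | "k = -1" | "k = 1" by auto
    then show ?thesis
    proof cases
      case 1 then show ?thesis by (simp add: comp_def at dtau_cplx_cplx dtau_eq P0 mv.zero_right)
    next
      case 2 then show ?thesis
        by (simp add: comp_def at dtau_cplx_cplx dtau_eq P2 mv.zero_right i cscale_minus_left flip: cplx_minus)
    next
      case 3 then show ?thesis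
        by (simp add: comp_def at dtau_cplx_add dtau_cplx_cscale dtau_cplx_cplx dtau_eq mm_simps mv.scaleR_right mv.minus_right i)
          (simp add: aff8_eq_iff aff8_nth complex_eq_iff)
    next
      case 4 then show ?thesis
        by (simp add: comp_def at dtau_cplx_add dtau_cplx_cscale dtau_cplx_cplx dtau_eq mm_simps mv.scaleR_right mv.minus_right i)
          (simp add: aff8_eq_iff aff8_nth complex_eq_iff)
    qed
  qed
  then show ?thesis using mem by (simp add: g_eig_def)
qed

lemma comp_sum: "cplx a = (\<Sum>j\<in>{-1, 0, 1, 2}. comp j a)"
proof -
  obtain A t where at: "a = (A, t)" by (cases a)
  have "P0 A $ i $ j + P2 A $ i $ j = A $ i $ j" for i j using P0_P2_sum[of A] by (metis vector_add_component)
  then show ?thesis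
    by (simp add: comp_def at aff8_eq_iff aff8_nth flip: of_real_add)
qed

lemma g_comp_eq:
  assumes a: "a \<in> g_aff I" and k: "k \<in> {-1, 0, 1, 2}"
  shows "g_comp I k (cplx a) = comp k a"
proof -
  have i: "\<i> powi 2 = - 1" "\<i> powi (-1) = - \<i>" by (simp_all add: power_int_def)
  have det: "c (-1) = average \<i> (dtau_cplx I) v" "c 0 = average 1 (dtau_cplx I) v"
    "c 1 = average (- \<i>) (dtau_cplx I) v" "c 2 = average (- 1) (dtau_cplx I) v"
    if c: "\<forall>j\<in>{-1, 0, 1, 2}. c j \<in> g_eig I j" "v = (\<Sum>j\<in>{-1, 0, 1, 2}. c j)" for c v
  proof -
    have e: "dtau_cplx I (c (-1)) = cscale (- \<i>) (c (-1))" "dtau_cplx I (c 0) = c 0"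
      "dtau_cplx I (c 1) = cscale \<i> (c 1)" "dtau_cplx I (c 2) = - c 2"
      using c(1) i by (simp_all add: g_eig_def cscale_minus_left)
    have s: "v = c (-1) + c 0 + c 1 + c 2" using c(2) by (simp add: add.assoc)
    note d = four_eigenvectors_determined[OF dtau_cplx_add dtau_cplx_cscale e s]
    show "c (-1) = average \<i> (dtau_cplx I) v" "c 0 = average 1 (dtau_cplx I) v"
      "c 1 = average (- \<i>) (dtau_cplx I) v" "c 2 = average (- 1) (dtau_cplx I) v"
      by (fact d)+
  qed
  show ?thesis
    unfolding g_comp_def
  proof (rule the_equality)
    show "\<exists>c. (\<forall>j\<in>{-1, 0, 1, 2}. c j \<in> g_eig I j) \<and> cplx a = (\<Sum>j\<in>{-1, 0, 1, 2}. c j) \<and> comp k a = c k"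
      using comp_g_eig[OF a] comp_sum by (intro exI[of _ "\<lambda>j. comp j a"]) blast
    fix w assume "\<exists>c. (\<forall>j\<in>{-1, 0, 1, 2}. c j \<in> g_eig I j) \<and> cplx a = (\<Sum>j\<in>{-1, 0, 1, 2}. c j) \<and> w = c k"
    then obtain c where c: "\<forall>j\<in>{-1, 0, 1, 2}. c j \<in> g_eig I j" "cplx a = (\<Sum>j\<in>{-1, 0, 1, 2}. c j)" and w: "w = c k"
      by blast
    have e: "\<forall>j\<in>{-1, 0, 1, 2}. comp j a \<in> g_eig I j" using comp_g_eig[OF a] by blast
    show "w = comp k a"
      using k det[OF c] det[of "\<lambda>j. comp j a", OF e comp_sum] w by auto
  qed
qed

end

section \<open>The structure equation and the lift conditions in coordinates\<close>

lemma fst_lie_bracket: "fst (lie_bracket v w) = fst v ** fst w - fst w ** fst v"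
  and snd_lie_bracket: "snd (lie_bracket v w) = fst v *v snd w - fst w *v snd v"
  by (cases v; cases w; simp)+

lemma lie_bracket_bilinear:
  fixes v w :: "'a::real_normed_field aff8"
  shows "lie_bracket (v + v') w = lie_bracket v w + lie_bracket v' w"
    "lie_bracket v (w + w') = lie_bracket v w + lie_bracket v w'"
    "lie_bracket (r *\<^sub>R v) w = r *\<^sub>R lie_bracket v w"
    "lie_bracket v (r *\<^sub>R w) = r *\<^sub>R lie_bracket v w"
  by (simp_all add: aff8_eq_iff fst_lie_bracket snd_lie_bracket matrix_matrix_mult_def matrix_vector_mult_def
      sum.distrib scaleR_sum_right algebra_simps)

lemma lie_bracket_skew: "lie_bracket v v = 0" "lie_bracket w v = - lie_bracket v w"
  by (simp_all add: prod_eq_iff fst_lie_bracket snd_lie_bracket)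

lemma has_derivative_du: "(f has_derivative f') (at z) \<Longrightarrow> du f z = f' (1, 0)"
  and has_derivative_dv: "(f has_derivative f') (at z) \<Longrightarrow> dv f z = f' (0, 1)"
  by (simp_all add: du_def dv_def frechet_derivative_at[symmetric])

lemma linear_R2: "linear f \<Longrightarrow> f \<xi> = fst \<xi> *\<^sub>R f (1, 0) + snd \<xi> *\<^sub>R f (0, 1)"
  for f :: "real \<times> real \<Rightarrow> 'b::real_vector"
proof -
  assume f: "linear f"
  have "\<xi> = fst \<xi> *\<^sub>R (1, 0) + snd \<xi> *\<^sub>R (0, 1)" by (simp add: prod_eq_iff)
  then have "f \<xi> = f (fst \<xi> *\<^sub>R (1, 0) + snd \<xi> *\<^sub>R (0, 1))" by (rule arg_cong)
  then show ?thesis by (simp only: linear_add[OF f] linear_cmul[OF f])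
qed

lemma MC_equation_iff:
  fixes \<beta> :: "real \<times> real \<Rightarrow> real \<times> real \<Rightarrow> 'a::real_normed_field aff8"
  assumes \<Omega>: "open \<Omega>" and lin: "\<And>z. z \<in> \<Omega> \<Longrightarrow> linear (\<beta> z)"
    and diff: "\<And>z \<xi>. z \<in> \<Omega> \<Longrightarrow> (\<lambda>w. \<beta> w \<xi>) differentiable (at z)"
  shows "MC_equation \<Omega> \<beta> \<longleftrightarrow> (\<forall>z\<in>\<Omega>. du (\<lambda>w. \<beta> w (0, 1)) z - dv (\<lambda>w. \<beta> w (1, 0)) z
      + lie_bracket (\<beta> z (1, 0)) (\<beta> z (0, 1)) = 0)"
proof -
  have key: "ext_d \<beta> z \<xi> \<zeta> + wedge_self \<beta> z \<xi> \<zeta> = (fst \<xi> * snd \<zeta> - snd \<xi> * fst \<zeta>) *\<^sub>R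
      (du (\<lambda>w. \<beta> w (0, 1)) z - dv (\<lambda>w. \<beta> w (1, 0)) z + lie_bracket (\<beta> z (1, 0)) (\<beta> z (0, 1)))"
    if z: "z \<in> \<Omega>" for z \<xi> \<zeta>
  proof -
    define Du where "Du = frechet_derivative (\<lambda>w. \<beta> w (1, 0)) (at z)"
    define Dv where "Dv = frechet_derivative (\<lambda>w. \<beta> w (0, 1)) (at z)"
    have D: "((\<lambda>w. \<beta> w (1, 0)) has_derivative Du) (at z)" "((\<lambda>w. \<beta> w (0, 1)) has_derivative Dv) (at z)"
      using diff[OF z] by (auto simp: Du_def Dv_def frechet_derivative_works)
    have Dlin: "linear Du" "linear Dv" using D has_derivative_linear by blast+
    have fd: "frechet_derivative (\<lambda>w. \<beta> w \<zeta>) (at z) \<xi> = fst \<zeta> *\<^sub>R Du \<xi> + snd \<zeta> *\<^sub>R Dv \<xi>" for \<xi> \<zeta>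
    proof -
      have "((\<lambda>w. fst \<zeta> *\<^sub>R \<beta> w (1, 0) + snd \<zeta> *\<^sub>R \<beta> w (0, 1)) has_derivative
          (\<lambda>h. fst \<zeta> *\<^sub>R Du h + snd \<zeta> *\<^sub>R Dv h)) (at z)"
        by (intro has_derivative_add has_derivative_scaleR_right D)
      then have "((\<lambda>w. \<beta> w \<zeta>) has_derivative (\<lambda>h. fst \<zeta> *\<^sub>R Du h + snd \<zeta> *\<^sub>R Dv h)) (at z)"
        by (rule has_derivative_transform_within_open[OF _ \<Omega> z]) (simp flip: linear_R2[OF lin])
      then show ?thesis by (simp add: frechet_derivative_at[symmetric])
    qed
    have "ext_d \<beta> z \<xi> \<zeta> = (fst \<xi> * snd \<zeta> - snd \<xi> * fst \<zeta>) *\<^sub>R (Dv (1, 0) - Du (0, 1))"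
      unfolding ext_d_def fd linear_R2[OF Dlin(1), of \<xi>] linear_R2[OF Dlin(1), of \<zeta>]
        linear_R2[OF Dlin(2), of \<xi>] linear_R2[OF Dlin(2), of \<zeta>]
      by (simp add: algebra_simps)
    moreover have "wedge_self \<beta> z \<xi> \<zeta> = (fst \<xi> * snd \<zeta> - snd \<xi> * fst \<zeta>) *\<^sub>R lie_bracket (\<beta> z (1, 0)) (\<beta> z (0, 1))"
      unfolding wedge_self_def linear_R2[OF lin[OF z], of \<xi>] linear_R2[OF lin[OF z], of \<zeta>]
      by (simp add: lie_bracket_bilinear lie_bracket_skew(1) lie_bracket_skew(2)[of "\<beta> z (0, 1)" "\<beta> z (1, 0)"] algebra_simps)
    ultimately show ?thesis by (simp add: du_def dv_def Du_def Dv_def scaleR_add_right)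
  qed
  show ?thesis
    unfolding MC_equation_def
  proof (intro iffI ballI allI)
    fix z assume "\<forall>z\<in>\<Omega>. \<forall>\<xi> \<zeta>. ext_d \<beta> z \<xi> \<zeta> + wedge_self \<beta> z \<xi> \<zeta> = 0" and z: "z \<in> \<Omega>"
    then have "ext_d \<beta> z (1, 0) (0, 1) + wedge_self \<beta> z (1, 0) (0, 1) = 0" by blast
    then show "du (\<lambda>w. \<beta> w (0, 1)) z - dv (\<lambda>w. \<beta> w (1, 0)) z + lie_bracket (\<beta> z (1, 0)) (\<beta> z (0, 1)) = 0"
      unfolding key[OF z] by simp
  qed (simp add: key)
qed

lemma oct_cross_skew: "oct_cross (a *\<^sub>R p + b *\<^sub>R p') (c *\<^sub>R p + d *\<^sub>R p') = (a * d - b * c) *\<^sub>R oct_cross p p'"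
  by (simp add: oct_eq_iff oct_cross_def oct_Im_def inner_oct oct_mult_nth oct_cnj_nth) (simp add: algebra_simps)

text \<open>For an orthonormal basis of the plane, Lagrange's identity shows that the determinant of the change of
  basis is \<open>1 / (norm p)\<^sup>2\<close>, since it is positive.\<close>

lemma rho_oriented_plane:
  assumes n: "norm p' = norm p" "norm p \<noteq> 0" and o: "p \<bullet> p' = 0"
  shows "rho (oriented_plane p p') = (1 / (norm p)\<^sup>2) *\<^sub>R oct_cross p p'"
  unfolding rho_def
proof (rule the_equality)
  define k where "k = 1 / norm p"
  have k: "k * norm p = 1" "k > 0" "k\<^sup>2 = 1 / (norm p)\<^sup>2" using n(2) by (auto simp: k_def power_divide)
  have "(k *\<^sub>R p, k *\<^sub>R p') \<in> oriented_plane p p'"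
  proof -
    have "\<exists>a b c d. k *\<^sub>R p = a *\<^sub>R p + b *\<^sub>R p' \<and> k *\<^sub>R p' = c *\<^sub>R p + d *\<^sub>R p' \<and> a * d - b * c > 0"
      by (rule exI[of _ k], rule exI[of _ 0], rule exI[of _ 0], rule exI[of _ k]) (use k in auto)
    then show ?thesis using k o n by (simp add: oriented_plane_def)
  qed
  moreover have "oct_cross (k *\<^sub>R p) (k *\<^sub>R p') = (1 / (norm p)\<^sup>2) *\<^sub>R oct_cross p p'"
    using oct_cross_skew[of k p 0 p' 0 k] k by (simp add: power2_eq_square)
  ultimately show "\<exists>(q, q')\<in>oriented_plane p p'. (1 / (norm p)\<^sup>2) *\<^sub>R oct_cross p p' = oct_cross q q'"
    by (metis (mono_tags, lifting) case_prodI)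
  fix r assume "\<exists>(q, q')\<in>oriented_plane p p'. r = oct_cross q q'"
  then obtain q q' where qq: "(q, q') \<in> oriented_plane p p'" and r: "r = oct_cross q q'" by auto
  then obtain a b c d where q: "q = a *\<^sub>R p + b *\<^sub>R p'" "q' = c *\<^sub>R p + d *\<^sub>R p'" and pos: "a * d - b * c > 0"
    and nq: "norm q = 1" "norm q' = 1" "q \<bullet> q' = 0"
    by (auto simp: oriented_plane_def)
  define N where "N = (norm p)\<^sup>2"
  have pp: "p \<bullet> p = N" "p' \<bullet> p' = N" "p \<bullet> p' = 0" "p' \<bullet> p = 0" "N > 0"
    using n o by (auto simp: N_def power2_norm_eq_inner[symmetric] inner_commute)
  have e: "(a * a + b * b) * N = 1" "(c * c + d * d) * N = 1" "(a * c + b * d) * N = 0"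
  proof -
    have "q \<bullet> q = 1" "q' \<bullet> q' = 1" using nq by (simp_all add: power2_norm_eq_inner[symmetric])
    then show "(a * a + b * b) * N = 1" "(c * c + d * d) * N = 1" "(a * c + b * d) * N = 0"
      using nq(3) by (simp_all add: q inner_add_left inner_add_right pp algebra_simps)
  qed
  have "((a * d - b * c) * N)\<^sup>2 = ((a * a + b * b) * N) * ((c * c + d * d) * N) - ((a * c + b * d) * N)\<^sup>2"
    by (simp add: power2_eq_square algebra_simps)
  then have "((a * d - b * c) * N)\<^sup>2 = 1" using e by simp
  then have "(a * d - b * c) * N = 1" using pos pp(5) by (metis mult_pos_pos less_asym neg_0_less_iff_less power2_eq_1_iff zero_less_one)
  then have "a * d - b * c = 1 / N" using pp(5) by (simp add: field_simps)
  then show "r = (1 / (norm p)\<^sup>2) *\<^sub>R oct_cross p p'"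
    unfolding r q oct_cross_skew by (simp add: N_def)
qed

lemma orthogonal_matrix_inner:
  fixes g :: "real ^ 8 ^ 8"
  assumes "transpose g ** g = mat 1" shows "(g *v x) \<bullet> (g *v y) = x \<bullet> y"
proof -
  have "(g *v x) \<bullet> (g *v y) = x \<bullet> (transpose g *v (g *v y))"
    by (metis dot_lmul_matrix vector_transpose_matrix transpose_transpose)
  then show ?thesis using assms by (simp add: matrix_vector_mul_assoc del: transpose_matrix_vector)
qed

lemma orthogonal_matrix_cancel:
  fixes g :: "real ^ 8 ^ 8"
  assumes "transpose g ** g = mat 1"
  shows "transpose g ** (g ** A) = A" "transpose g *v (g *v x) = x" "g *v x = g *v y \<longleftrightarrow> x = y"
    "g ** A ** transpose g = g ** B ** transpose g \<longleftrightarrow> A = B"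
proof -
  show 1: "transpose g ** (g ** A) = A" for A using assms by (simp add: matrix_mul_assoc)
  show 2: "transpose g *v (g *v x) = x" for x
    using assms by (simp add: matrix_vector_mul_assoc del: transpose_matrix_vector)
  show "g *v x = g *v y \<longleftrightarrow> x = y" using 2 by metis
  have "A = B" if "g ** A ** transpose g = g ** B ** transpose g" for A B
  proof -
    have "transpose g ** (g ** C ** transpose g) ** g = C" for C
    proof -
      have "transpose g ** (g ** C ** transpose g) ** g = (transpose g ** g) ** C ** (transpose g ** g)"
        by (simp add: matrix_mul_assoc)
      then show ?thesis using assms by simp
    qed
    then show ?thesis using that by metis
  qed
  then show "g ** A ** transpose g = g ** B ** transpose g \<longleftrightarrow> A = B" by blast
qed

locale one_form_setting = isotropy_index +
  fixes \<Omega> :: "(real \<times> real) set" and \<alpha> :: "real \<times> real \<Rightarrow> real \<times> real \<Rightarrow> real aff8"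
  assumes open_\<Omega>: "open \<Omega>" and form: "smooth_one_form \<Omega> (g_aff I) \<alpha>"
begin

definition A where "A z \<xi> = fst (\<alpha> z \<xi>)"
definition t where "t z \<xi> = snd (\<alpha> z \<xi>)"

lemma form_value: "z \<in> \<Omega> \<Longrightarrow> \<alpha> z \<xi> \<in> g_aff I"
  using form unfolding smooth_one_form_def by blast

lemma A_g_lin: "z \<in> \<Omega> \<Longrightarrow> A z \<xi> \<in> g_lin I"
  using form_value[of z \<xi>] by (auto simp: A_def g_aff_def)

lemma form_linear: "z \<in> \<Omega> \<Longrightarrow> linear (\<alpha> z)"
  using form unfolding smooth_one_form_def by blast

lemma form_smooth: "smooth_on \<Omega> (\<lambda>z. \<alpha> z \<xi>)"
  using form unfolding smooth_one_form_def by blast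

lemma A_smooth: "smooth_on \<Omega> (\<lambda>z. A z \<xi>)"
  unfolding A_def by (rule smooth_on_bounded_linear[OF open_\<Omega> bounded_linear_fst form_smooth])

lemma t_smooth: "smooth_on \<Omega> (\<lambda>z. t z \<xi>)"
  unfolding t_def by (rule smooth_on_bounded_linear[OF open_\<Omega> bounded_linear_snd form_smooth])

lemma A_deriv: "z \<in> \<Omega> \<Longrightarrow> ((\<lambda>w. A w \<xi>) has_derivative frechet_derivative (\<lambda>w. A w \<xi>) (at z)) (at z)"
  by (rule smooth_on_has_derivative[OF A_smooth])

lemma t_deriv: "z \<in> \<Omega> \<Longrightarrow> ((\<lambda>w. t w \<xi>) has_derivative frechet_derivative (\<lambda>w. t w \<xi>) (at z)) (at z)"
  by (rule smooth_on_has_derivative[OF t_smooth])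

lemma ext_d_form: 
  assumes z: "z \<in> \<Omega>"
  shows "fst (ext_d \<alpha> z \<xi> \<zeta>) = frechet_derivative (\<lambda>w. A w \<zeta>) (at z) \<xi> - frechet_derivative (\<lambda>w. A w \<xi>) (at z) \<zeta>"
    "snd (ext_d \<alpha> z \<xi> \<zeta>) = frechet_derivative (\<lambda>w. t w \<zeta>) (at z) \<xi> - frechet_derivative (\<lambda>w. t w \<xi>) (at z) \<zeta>"
proof -
  have "frechet_derivative (\<lambda>w. A w \<zeta>) (at z) = (\<lambda>\<xi>. fst (frechet_derivative (\<lambda>w. \<alpha> w \<zeta>) (at z) \<xi>))" for \<zeta>
    unfolding A_def by (rule frechet_derivative_at[symmetric], rule has_derivative_fst[OF smooth_on_has_derivative[OF form_smooth z]])
  moreover have "frechet_derivative (\<lambda>w. t w \<zeta>) (at z) = (\<lambda>\<xi>. snd (frechet_derivative (\<lambda>w. \<alpha> w \<zeta>) (at z) \<xi>))" for \<zeta>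
    unfolding t_def by (rule frechet_derivative_at[symmetric], rule has_derivative_snd[OF smooth_on_has_derivative[OF form_smooth z]])
  ultimately show "fst (ext_d \<alpha> z \<xi> \<zeta>) = frechet_derivative (\<lambda>w. A w \<zeta>) (at z) \<xi> - frechet_derivative (\<lambda>w. A w \<xi>) (at z) \<zeta>"
    "snd (ext_d \<alpha> z \<xi> \<zeta>) = frechet_derivative (\<lambda>w. t w \<zeta>) (at z) \<xi> - frechet_derivative (\<lambda>w. t w \<xi>) (at z) \<zeta>"
    by (simp_all add: ext_d_def)
qed

lemma MC_form_equations:
  "MC_equation \<Omega> \<alpha> \<longleftrightarrow> (\<forall>z\<in>\<Omega>. \<forall>\<xi> \<zeta>.
     frechet_derivative (\<lambda>w. A w \<zeta>) (at z) \<xi> - frechet_derivative (\<lambda>w. A w \<xi>) (at z) \<zeta> + (A z \<xi> ** A z \<zeta> - A z \<zeta> ** A z \<xi>) = 0 \<and>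
     frechet_derivative (\<lambda>w. t w \<zeta>) (at z) \<xi> - frechet_derivative (\<lambda>w. t w \<xi>) (at z) \<zeta> + (A z \<xi> *v t z \<zeta> - A z \<zeta> *v t z \<xi>) = 0)"
  unfolding MC_equation_def prod_eq_iff
  by (simp add: ext_d_form wedge_self_def fst_lie_bracket snd_lie_bracket flip: A_def t_def)

lemma form_comp_eq: "z \<in> \<Omega> \<Longrightarrow> k \<in> {-1, 0, 1, 2} \<Longrightarrow> form_comp I k \<alpha> z \<xi> = comp k (\<alpha> z \<xi>)"
  unfolding form_comp_def by (rule g_comp_eq[OF form_value])

lemma comp_minus_one: "comp (-1) a = cplx (0, (1 / 2) *\<^sub>R snd a) + cscale \<i> (cplx (0, (- 1 / 2) *\<^sub>R (J *v snd a)))"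
  by (simp add: comp_def)

text \<open>The component in the eigenspace of \<open>-\<i>\<close> is \<open>(t - \<i> J t) / 2\<close>, and four times its value on \<open>\<partial>/\<partial>\<bar>z\<close> is
  \<open>(t(\<partial>/\<partial>u) + J t(\<partial>/\<partial>v)) + \<i> (t(\<partial>/\<partial>v) - J t(\<partial>/\<partial>u))\<close>, whose
  real and imaginary parts vanish under equivalent conditions.\<close>

lemma dzbar_condition:
  assumes z: "z \<in> \<Omega>"
  shows "(\<forall>\<xi>. dzbar_part (form_comp I (-1) \<alpha>) z \<xi> = 0) \<longleftrightarrow> t z (0, 1) = J *v t z (1, 0)"
proof -
  let ?b = "form_comp I (-1) \<alpha> z"
  have "?b (1, 0) + cscale \<i> (?b (0, 1)) =
      cplx (0, (1 / 2) *\<^sub>R (t z (1, 0) + J *v t z (0, 1))) + cscale \<i> (cplx (0, (1 / 2) *\<^sub>R (t z (0, 1) - J *v t z (1, 0))))"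
    by (simp add: form_comp_eq[OF z] comp_minus_one aff8_eq_iff aff8_nth t_def complex_eq_iff)
  then have "?b (1, 0) + cscale \<i> (?b (0, 1)) = 0 \<longleftrightarrow> t z (1, 0) + J *v t z (0, 1) = 0 \<and> t z (0, 1) - J *v t z (1, 0) = 0"
    by (simp only: cplx_comb_eq_zero_iff) (simp add: prod_eq_iff)
  also have "\<dots> \<longleftrightarrow> t z (0, 1) = J *v t z (1, 0)" by auto
  finally have *: "?b (1, 0) + cscale \<i> (?b (0, 1)) = 0 \<longleftrightarrow> t z (0, 1) = J *v t z (1, 0)" .
  have "(\<forall>\<xi>. dzbar_part (form_comp I (-1) \<alpha>) z \<xi> = 0) \<longleftrightarrow> ?b (1, 0) + cscale \<i> (?b (0, 1)) = 0"
    by (auto simp: dzbar_part_def complex_eq_iff intro: exI[of _ 1])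
  then show ?thesis using * by simp
qed

lemma dz_condition:
  assumes z: "z \<in> \<Omega>" and h: "t z (0, 1) = J *v t z (1, 0)"
  shows "(\<exists>\<xi>. dz_part (form_comp I (-1) \<alpha>) z \<xi> \<noteq> 0) \<longleftrightarrow> t z (1, 0) \<noteq> 0"
proof -
  let ?b = "form_comp I (-1) \<alpha> z"
  have "?b (1, 0) - cscale \<i> (?b (0, 1)) = cplx (0, t z (1, 0)) + cscale \<i> (cplx (0, - (J *v t z (1, 0))))"
    using h by (simp add: form_comp_eq[OF z] comp_minus_one aff8_eq_iff aff8_nth t_def complex_eq_iff)
  then have *: "?b (1, 0) - cscale \<i> (?b (0, 1)) = 0 \<longleftrightarrow> t z (1, 0) = 0"
    by (simp only: cplx_comb_eq_zero_iff) (auto simp: prod_eq_iff mv.zero_right)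
  have "(\<exists>\<xi>. dz_part (form_comp I (-1) \<alpha>) z \<xi> \<noteq> 0) \<longleftrightarrow> ?b (1, 0) - cscale \<i> (?b (0, 1)) \<noteq> 0"
    by (auto simp: dz_part_def complex_eq_iff intro: exI[of _ 1])
  then show ?thesis using * by simp
qed

end

section \<open>Frames and their integration\<close>

text \<open>Combines \<open>dF = F A\<close> and \<open>dX = F t\<close> into one linear system for the pair \<open>y = (F, X)\<close>; the bracket of the
  semidirect product is minus the commutator of these actions.\<close>

definition frame_act :: "real aff8 \<Rightarrow> real aff8 \<Rightarrow> real aff8" where
  "frame_act a y = (fst y ** fst a, fst y *v snd a)"

lemma bounded_bilinear_frame_act: "bounded_bilinear frame_act"
  unfolding bilinear_conv_bounded_bilinear[symmetric] bilinear_def frame_act_def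
  by (auto intro!: linearI simp: mm_simps mv.add_left mv.add_right mv.scaleR_left mv.scaleR_right)

lemma (in one_form_setting) conj_derivative:
  fixes F :: "real \<times> real \<Rightarrow> real ^ 8 ^ 8"
  assumes z: "z \<in> \<Omega>" and F: "(F has_derivative (\<lambda>\<xi>. F z ** A z \<xi>)) (at z)"
    and M: "(M has_derivative M') (at z)"
  shows "((\<lambda>w. F w ** M w ** transpose (F w)) has_derivative
    (\<lambda>\<xi>. F z ** (M' \<xi> + (A z \<xi> ** M z - M z ** A z \<xi>)) ** transpose (F z))) (at z)"
proof -
  have "((\<lambda>w. transpose (F w)) has_derivative (\<lambda>\<xi>. transpose (F z ** A z \<xi>))) (at z)"
    by (rule bounded_linear.has_derivative[OF bounded_linear_transpose F])
  from mm.FDERIV[OF mm.FDERIV[OF F M] this] show ?thesis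
    by (rule has_derivative_eq_rhs)
      (simp add: fun_eq_iff matrix_transpose_mul g_linD(1)[OF A_g_lin[OF z]] mm_simps matrix_mul_assoc)
qed

locale frame = one_form_setting +
  fixes F :: "real \<times> real \<Rightarrow> real ^ 8 ^ 8" and X :: "real \<times> real \<Rightarrow> oct"
  assumes F_grp: "z \<in> \<Omega> \<Longrightarrow> F z \<in> G_grp I"
    and dF: "z \<in> \<Omega> \<Longrightarrow> (F has_derivative (\<lambda>\<xi>. F z ** A z \<xi>)) (at z)"
    and dX: "z \<in> \<Omega> \<Longrightarrow> (X has_derivative (\<lambda>\<xi>. F z *v t z \<xi>)) (at z)"

lemma (in one_form_setting) frameI:
  assumes "isotropic_lift I \<Omega> F X" "is_MC_form_of \<Omega> \<alpha> F X"
  shows "frame I \<Omega> \<alpha> F X"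
proof
  fix z assume z: "z \<in> \<Omega>"
  show G: "F z \<in> G_grp I" using assms(1) z by (auto simp: isotropic_lift_def aff_grp_def)
  then have o: "transpose (F z) ** F z = mat 1" by (simp add: G_grp_iff spin_like_def)
  have inv: "F z ** matrix_inv (F z) = mat 1"
    using o by (simp add: matrix_inv_orthogonal transpose_right_inverse)
  have \<alpha>: "A z \<xi> = matrix_inv (F z) ** frechet_derivative F (at z) \<xi>"
    "t z \<xi> = matrix_inv (F z) *v frechet_derivative X (at z) \<xi>" for \<xi>
    using assms(2) z by (simp_all add: A_def t_def is_MC_form_of_def MC_form_def)
  have "F z ** A z \<xi> = frechet_derivative F (at z) \<xi>" "F z *v t z \<xi> = frechet_derivative X (at z) \<xi>" for \<xi>
    by (simp_all add: \<alpha> matrix_mul_assoc matrix_vector_mul_assoc inv)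
  moreover have "smooth_on \<Omega> F" "smooth_on \<Omega> X"
    using assms(1) by (auto simp: isotropic_lift_def immersion_on_def)
  ultimately show "(F has_derivative (\<lambda>\<xi>. F z ** A z \<xi>)) (at z)" "(X has_derivative (\<lambda>\<xi>. F z *v t z \<xi>)) (at z)"
    using smooth_on_has_derivative[OF _ z] by simp_all
qed

context frame
begin

lemma F_spin_like: "z \<in> \<Omega> \<Longrightarrow> spin_like (F z)"
  using F_grp G_grp_iff by blast

lemma F_orthogonal: "z \<in> \<Omega> \<Longrightarrow> transpose (F z) ** F z = mat 1"
  using F_spin_like spin_like_def by blast

lemma F_smooth: "smooth_on \<Omega> F"
  by (rule linear_system_smooth[OF open_\<Omega> bounded_bilinear.flip[OF mm.bounded_bilinear_axioms] A_smooth dF])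

lemma frechet_F: "z \<in> \<Omega> \<Longrightarrow> frechet_derivative F (at z) = (\<lambda>\<xi>. F z ** A z \<xi>)"
  using frechet_derivative_at[OF dF] by metis

lemma frechet_X: "z \<in> \<Omega> \<Longrightarrow> frechet_derivative X (at z) = (\<lambda>\<xi>. F z *v t z \<xi>)"
  using frechet_derivative_at[OF dX] by metis

lemma X_smooth: "smooth_on \<Omega> X"
proof -
  have Ft: "smooth_on \<Omega> (\<lambda>z. F z *v t z \<xi>)" for \<xi>
    by (rule smooth_on_bilinear[OF open_\<Omega> mv.bounded_bilinear_axioms F_smooth t_smooth])
  have "Ck_on k \<Omega> X" for k
  proof (induction k)
    case 0 show ?case using has_derivative_continuous_on[OF has_derivative_at_withinI[OF dX]] by simp
  next
    case (Suc k)
    show ?case by (rule Ck_on_SucI[OF open_\<Omega> dX]) (use Ft in \<open>auto simp: smooth_on_def\<close>)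
  qed
  then show ?thesis by (simp add: smooth_on_def)
qed

text \<open>Symmetry of the second derivatives of \<open>F\<close> and of \<open>X\<close>.\<close>

lemma structure_equation: "MC_equation \<Omega> \<alpha>"
  unfolding MC_form_equations
proof (intro ballI allI conjI)
  fix z \<xi> \<zeta> assume z: "z \<in> \<Omega>"
  let ?DA = "\<lambda>\<xi>. frechet_derivative (\<lambda>w. A w \<xi>) (at z)"
  let ?Dt = "\<lambda>\<xi>. frechet_derivative (\<lambda>w. t w \<xi>) (at z)"
  have "((\<lambda>w. F w ** A w \<xi>) has_derivative (\<lambda>h. F z ** ?DA \<xi> h + F z ** A z h ** A z \<xi>)) (at z)" for \<xi>
    by (rule mm.FDERIV[OF dF[OF z] A_deriv[OF z]])
  from mixed_derivatives_commute[OF open_\<Omega> z dF this this]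
  have "F z ** ?DA \<xi> \<zeta> + F z ** A z \<zeta> ** A z \<xi> = F z ** ?DA \<zeta> \<xi> + F z ** A z \<xi> ** A z \<zeta>" .
  then have "F z ** (?DA \<zeta> \<xi> - ?DA \<xi> \<zeta> + (A z \<xi> ** A z \<zeta> - A z \<zeta> ** A z \<xi>)) = 0"
    by (simp add: mm_simps matrix_mul_assoc algebra_simps)
  then show "?DA \<zeta> \<xi> - ?DA \<xi> \<zeta> + (A z \<xi> ** A z \<zeta> - A z \<zeta> ** A z \<xi>) = 0"
    using orthogonal_matrix_cancel(1)[OF F_orthogonal[OF z]] by (metis mm.zero_right)
  have "((\<lambda>w. F w *v t w \<xi>) has_derivative (\<lambda>h. F z *v ?Dt \<xi> h + (F z ** A z h) *v t z \<xi>)) (at z)" for \<xi>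
    by (rule mv.FDERIV[OF dF[OF z] t_deriv[OF z]])
  from mixed_derivatives_commute[OF open_\<Omega> z dX this this]
  have "F z *v ?Dt \<xi> \<zeta> + (F z ** A z \<zeta>) *v t z \<xi> = F z *v ?Dt \<zeta> \<xi> + (F z ** A z \<xi>) *v t z \<zeta>" .
  then have "F z *v (?Dt \<zeta> \<xi> - ?Dt \<xi> \<zeta> + (A z \<xi> *v t z \<zeta> - A z \<zeta> *v t z \<xi>)) = F z *v 0"
    by (simp add: mv.add_right mv.diff_right mv.zero_right flip: matrix_vector_mul_assoc) (simp add: algebra_simps)
  then show "?Dt \<zeta> \<xi> - ?Dt \<xi> \<zeta> + (A z \<xi> *v t z \<zeta> - A z \<zeta> *v t z \<xi>) = 0"
    unfolding orthogonal_matrix_cancel(3)[OF F_orthogonal[OF z]] .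
qed

text \<open>The value of \<open>rho_tilde\<close> on the frame; it agrees with \<open>\<rho>\<^sub>X\<close> once \<open>t(\<partial>/\<partial>v) = J t(\<partial>/\<partial>u) \<noteq> 0\<close>.\<close>

definition r where "r z = chi (F z) (e_vec I)"

lemma r_ImO: "z \<in> \<Omega> \<Longrightarrow> r z \<in> ImO"
  and Lmat_r: "z \<in> \<Omega> \<Longrightarrow> Lmat (r z) = F z ** J ** transpose (F z)"
  using Lmat_chi[OF F_spin_like e_ImO] by (simp_all add: r_def J_def)

lemma r_mult_F: "z \<in> \<Omega> \<Longrightarrow> oct_mult (r z) (F z *v x) = F z *v (J *v x)"
proof -
  assume z: "z \<in> \<Omega>"
  have "oct_mult (r z) (F z *v x) = Lmat (r z) *v (F z *v x)" by simp
  also have "\<dots> = F z *v (J *v (transpose (F z) *v (F z *v x)))"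
    unfolding Lmat_r[OF z] by (simp add: matrix_vector_mul_assoc matrix_mul_assoc)
  finally show ?thesis by (simp only: orthogonal_matrix_cancel(2)[OF F_orthogonal[OF z]])
qed

text \<open>The lift condition and \<open>oct_cross_mult\<close> say that \<open>X\<^sub>v = r X\<^sub>u\<close>; since left multiplication by \<open>r\<close> is
  \<open>F J F\<inverse>\<close>, this is the equation \<open>t(\<partial>/\<partial>v) = J t(\<partial>/\<partial>u)\<close> moved by \<open>F\<close>.\<close>

lemma lift_imp_holomorphic:
  assumes lift: "isotropic_lift I \<Omega> F X" and z: "z \<in> \<Omega>"
  shows "t z (0, 1) = J *v t z (1, 0)" "t z (1, 0) \<noteq> 0"
proof -
  have u: "du X z = F z *v t z (1, 0)" "dv X z = F z *v t z (0, 1)"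
    by (simp_all add: has_derivative_du[OF dX[OF z]] has_derivative_dv[OF dX[OF z]])
  have "inj (frechet_derivative X (at z))" using lift z by (simp add: isotropic_lift_def immersion_on_def)
  then have "frechet_derivative X (at z) (1, 0) \<noteq> frechet_derivative X (at z) (0, 0)"
    by (simp add: inj_eq)
  moreover have "frechet_derivative X (at z) (0, 0) = 0"
    using linear_0[OF has_derivative_linear[OF smooth_on_has_derivative[OF X_smooth z]]] by (simp add: zero_prod_def)
  ultimately have nz: "du X z \<noteq> 0" by (simp add: du_def)
  then show "t z (1, 0) \<noteq> 0" by (auto simp: u mv.zero_right)
  have c: "norm (dv X z) = norm (du X z)" "du X z \<bullet> dv X z = 0"
    using lift z by (auto simp: isotropic_lift_def conformal_on_def)
  have "rho_map X z = r z" using lift z by (simp add: isotropic_lift_def rho_tilde_def r_def)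
  then have "r z = (1 / (norm (du X z))\<^sup>2) *\<^sub>R oct_cross (du X z) (dv X z)"
    using rho_oriented_plane[OF c(1) _ c(2)] nz by (simp add: rho_map_def tangent_plane_def)
  then have "oct_mult (r z) (du X z) = dv X z"
    using oct_cross_mult[of "du X z" "dv X z"] c nz by (simp add: om.scaleR_left power2_norm_eq_inner)
  then have "F z *v (J *v t z (1, 0)) = F z *v t z (0, 1)" using r_mult_F[OF z] u by simp
  then show "t z (0, 1) = J *v t z (1, 0)"
    unfolding orthogonal_matrix_cancel(3)[OF F_orthogonal[OF z]] by simp
qed

lemma holomorphic_imp_rho_map:
  assumes z: "z \<in> \<Omega>" and h: "t z (0, 1) = J *v t z (1, 0)" and nz: "t z (1, 0) \<noteq> 0"
  shows "norm (dv X z) = norm (du X z)" "du X z \<bullet> dv X z = 0" "du X z \<noteq> 0" "rho_map X z = r z"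
    "dv X z = oct_mult (r z) (du X z)"
proof -
  have u: "du X z = F z *v t z (1, 0)" "dv X z = F z *v (J *v t z (1, 0))"
    by (simp_all add: has_derivative_du[OF dX[OF z]] has_derivative_dv[OF dX[OF z]] h)
  note inn = orthogonal_matrix_inner[OF F_orthogonal[OF z]]
  have Jo: "transpose J ** J = mat 1" by (simp add: transpose_J mm_simps J_square)
  have "x \<bullet> (J *v x) = 0" for x
  proof -
    have "(J *v x) \<bullet> (J *v (J *v x)) = x \<bullet> (J *v x)" by (rule orthogonal_matrix_inner[OF Jo])
    then show ?thesis by (simp add: inner_commute)
  qed
  then show o: "du X z \<bullet> dv X z = 0" by (simp add: u inn)
  show n: "norm (dv X z) = norm (du X z)"
    by (simp add: u norm_eq_sqrt_inner inn orthogonal_matrix_inner[OF Jo])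
  show nz': "du X z \<noteq> 0"
    using orthogonal_matrix_cancel(3)[OF F_orthogonal[OF z], of _ 0] nz by (simp add: u mv.zero_right)
  show v: "dv X z = oct_mult (r z) (du X z)" by (simp add: u r_mult_F[OF z])
  have "rho_map X z = (1 / (norm (du X z))\<^sup>2) *\<^sub>R oct_cross (du X z) (dv X z)"
    using rho_oriented_plane[OF n _ o] nz' by (simp add: rho_map_def tangent_plane_def)
  also have "\<dots> = r z"
    unfolding v oct_cross_of_mult[OF r_ImO[OF z]] using nz' by (simp add: power2_norm_eq_inner)
  finally show "rho_map X z = r z" .
qed

lemma r_orthogonal_units: "z \<in> \<Omega> \<Longrightarrow> i \<in> I \<Longrightarrow> r z \<bullet> oct_unit i = 0"
proof -
  assume z: "z \<in> \<Omega>" and i: "i \<in> I"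
  have e: "oct_unit i \<in> ImO" using index_bounds[OF i] ImO_units by blast
  have "F z ** Lmat (oct_unit i) ** transpose (F z) = Lmat (oct_unit i) ** (F z ** transpose (F z))"
    using F_grp[OF z] i by (simp add: G_grp_iff matrix_mul_assoc)
  then have "F z ** Lmat (oct_unit i) ** transpose (F z) = Lmat (oct_unit i)"
    using F_orthogonal[OF z] by (simp add: transpose_right_inverse)
  from spin_like_norm[OF F_spin_like[OF z] e_ImO r_ImO[OF z] _ e e this] Lmat_r[OF z]
  have "r z \<bullet> oct_unit i = e_vec I \<bullet> oct_unit i" by (simp add: J_def)
  then show ?thesis using inner_units[OF next_index, of i] index_bounds[OF i] by (simp add: e_vec_def)
qed

lemma bilinear_omega: "bilinear (omega i)"
  unfolding omega_def bilinear_def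
  by (auto intro!: linearI simp: inner_add_left inner_add_right om.add_right om.scaleR_right)

text \<open>By the Clifford relations \<open>\<omega>\<^sub>i(q, r q) = - (e\<^sub>i \<bullet> r) (q \<bullet> q)\<close>, and \<open>r\<close> is orthogonal to \<open>e\<^sub>i\<close> for
  \<open>i \<in> I\<close> because \<open>F\<close> fixes \<open>e\<^sub>i\<close>.\<close>

lemma isotropic_tangent_plane:
  assumes z: "z \<in> \<Omega>" and h: "t z (0, 1) = J *v t z (1, 0)" and nz: "t z (1, 0) \<noteq> 0"
  shows "tangent_plane X z \<in> Q_planes I"
proof -
  note f = holomorphic_imp_rho_map[OF z h nz]
  define p p' where "p = du X z" and "p' = dv X z"
  have P: "tangent_plane X z = oriented_plane p p'" by (simp add: tangent_plane_def p_def p'_def)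
  have ne: "p \<noteq> p'" using f(2,3) by (auto simp: p_def p'_def)
  have "0 \<notin> {p, p'}" using f(1,3) by (auto simp: p_def p'_def)
  moreover have "pairwise orthogonal {p, p'}"
    using f(2) by (auto simp: pairwise_def orthogonal_def p_def p'_def inner_commute)
  ultimately have "independent {p, p'}" by (intro pairwise_orthogonal_independent)
  then have "tangent_plane X z \<in> Gr2" unfolding P Gr2_def using ne by blast
  moreover have "omega i x y = 0"
    if i: "i \<in> I" and xy: "x \<in> plane_space (tangent_plane X z)" "y \<in> plane_space (tangent_plane X z)" for i x y
  proof -
    have sub: "plane_space (tangent_plane X z) \<subseteq> span {p, p'}"
    proof -
      have "a *\<^sub>R p + b *\<^sub>R p' \<in> span {p, p'}" for a b by (intro span_add span_scale span_base) auto
      then show ?thesis unfolding plane_space_def P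
        by (intro span_minimal subspace_span) (auto simp: oriented_plane_def)
    qed
    have e: "oct_unit i \<in> ImO" using index_bounds[OF i] ImO_units by blast
    have skew: "x \<bullet> oct_mult u y = - (y \<bullet> oct_mult u x)" if "u \<in> ImO" for u x y
      using that by (simp add: inner_oct oct_mult_nth ImO_iff algebra_simps)
    have w0: "omega i x x = 0" for x using skew[OF e, of x x] by (simp add: omega_def)
    have pp': "omega i p p' = 0"
    proof -
      have "2 * (p \<bullet> oct_mult (oct_unit i) p') = p \<bullet> ((Lmat (oct_unit i) ** Lmat (r z) + Lmat (r z) ** Lmat (oct_unit i)) *v p)"
      proof -
        have "p \<bullet> oct_mult (r z) (oct_mult (oct_unit i) p) = p \<bullet> oct_mult (oct_unit i) (oct_mult (r z) p)"
          using skew[OF r_ImO[OF z], of p "oct_mult (oct_unit i) p"] skew[OF e, of p "oct_mult (r z) p"]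
          by (simp add: inner_commute)
        then show ?thesis
          by (simp add: mv.add_left inner_add_right p'_def f(5) p_def flip: matrix_vector_mul_assoc)
      qed
      also have "\<dots> = 0"
        unfolding clifford[OF e r_ImO[OF z]] using r_orthogonal_units[OF z i]
        by (simp add: inner_commute mv.zero_left)
      finally show ?thesis by (simp add: omega_def)
    qed
    have p'p: "omega i p' p = 0" using pp' skew[OF e, of p p'] by (simp add: omega_def)
    show ?thesis
    proof (rule bilinear_eq[OF bilinear_omega, where g = "\<lambda>_ _. 0" and B = "{p, p'}" and C = "{p, p'}" and S = "span {p, p'}" and T = "span {p, p'}"])
      show "bilinear (\<lambda>_ _. 0 :: real)" by (simp add: bilinear_def linear_zero)
      show "omega i x y = 0" if "x \<in> {p, p'}" "y \<in> {p, p'}" for x y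
        using that w0 pp' p'p by auto
    qed (use sub xy in auto)
  qed
  ultimately show ?thesis by (auto simp: Q_planes_def)
qed

lemma holomorphic_imp_lift:
  assumes h: "\<And>z. z \<in> \<Omega> \<Longrightarrow> t z (0, 1) = J *v t z (1, 0)" and nz: "\<And>z. z \<in> \<Omega> \<Longrightarrow> t z (1, 0) \<noteq> 0"
  shows "isotropic_lift I \<Omega> F X" "is_MC_form_of \<Omega> \<alpha> F X"
proof -
  show "is_MC_form_of \<Omega> \<alpha> F X"
    unfolding is_MC_form_of_def
  proof
    fix z assume z: "z \<in> \<Omega>"
    note o = F_orthogonal[OF z]
    show "\<alpha> z = MC_form F X z"
      by (rule ext) (simp only: MC_form_def frechet_F[OF z] frechet_X[OF z] matrix_inv_orthogonal[OF o]
        orthogonal_matrix_cancel(1,2)[OF o] A_def t_def prod.collapse)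
  qed
  have inj: "inj (frechet_derivative X (at z))" if z: "z \<in> \<Omega>" for z
  proof -
    note f = holomorphic_imp_rho_map[OF z h[OF z] nz[OF z]]
    have lin: "linear (frechet_derivative X (at z))"
      using smooth_on_has_derivative[OF X_smooth z] has_derivative_linear by blast
    have "\<xi> = 0" if "frechet_derivative X (at z) \<xi> = 0" for \<xi>
    proof -
      have 0: "fst \<xi> *\<^sub>R du X z + snd \<xi> *\<^sub>R dv X z = 0"
        using that linear_R2[OF lin, of \<xi>] by (simp add: du_def dv_def)
      have "(fst \<xi> *\<^sub>R du X z + snd \<xi> *\<^sub>R dv X z) \<bullet> du X z = fst \<xi> * (du X z \<bullet> du X z)"
        "(fst \<xi> *\<^sub>R du X z + snd \<xi> *\<^sub>R dv X z) \<bullet> dv X z = snd \<xi> * (dv X z \<bullet> dv X z)"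
        using f(2) by (simp_all add: inner_add_left inner_commute[of "dv X z" "du X z"])
      moreover have "dv X z \<noteq> 0" using f(1,3) by auto
      ultimately have "fst \<xi> = 0" "snd \<xi> = 0" using f(3) unfolding 0 by auto
      then show ?thesis by (simp add: prod_eq_iff)
    qed
    then show ?thesis using linear_injective_0[OF lin] by blast
  qed
  show "isotropic_lift I \<Omega> F X"
    unfolding isotropic_lift_def
    using F_smooth F_grp X_smooth inj holomorphic_imp_rho_map[OF _ h nz] isotropic_tangent_plane[OF _ h nz]
    by (auto simp: aff_grp_def immersion_on_def conformal_on_def isotropic_on_def rho_tilde_def r_def)
qed

end

text \<open>The form \<open>a du + b dv\<close> for \<open>p = (a, b)\<close>. It depends linearly on \<open>p\<close>, so it is as smooth as its two
  coefficients.\<close>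

definition covec :: "'b \<times> 'b \<Rightarrow> (real \<times> real) \<Rightarrow>\<^sub>L 'b::euclidean_space" where
  "covec p = Blinfun (\<lambda>\<xi>. fst \<xi> *\<^sub>R fst p + snd \<xi> *\<^sub>R snd p)"

lemma covec_apply [simp]: "covec p \<xi> = fst \<xi> *\<^sub>R fst p + snd \<xi> *\<^sub>R snd p"
proof -
  have "bounded_linear (\<lambda>\<xi>. fst \<xi> *\<^sub>R fst p + snd \<xi> *\<^sub>R snd p)"
    by (intro bounded_linear_add bounded_linear_compose[OF bounded_linear_scaleR_left] bounded_linear_fst bounded_linear_snd)
  then show ?thesis by (simp add: covec_def bounded_linear_Blinfun_apply)
qed

lemma bounded_linear_covec: "bounded_linear covec"
  unfolding linear_conv_bounded_linear[symmetric]
  by (rule linearI; rule blinfun_eqI) (simp_all add: blinfun.add_left blinfun.scaleR_left algebra_simps)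

lemma smooth_on_has_covec_derivative:
  fixes f :: "real \<times> real \<Rightarrow> 'b::euclidean_space"
  assumes "smooth_on S f" "z \<in> S"
  shows "(f has_derivative blinfun_apply (covec (du f z, dv f z))) (at z)"
proof -
  note d = smooth_on_has_derivative[OF assms]
  have "blinfun_apply (covec (du f z, dv f z)) = frechet_derivative f (at z)"
    by (rule ext) (simp add: du_def dv_def flip: linear_R2[OF has_derivative_linear[OF d]])
  then show ?thesis using d by simp
qed

context one_form_setting
begin

text \<open>Each defining condition of the group holds because some quantity is constant along \<open>dF = F A\<close>. For the
  condition on conjugates of left multiplications this quantity is the sum \<open>N\<close> of the squared norms of the defects
  \<open>M - L\<^sub>M\<^sub>1\<close> of \<open>M = F L\<^sub>i F\<inverse>\<close>: the vector of the defects is infinitesimally rotated by the skew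
  matrix \<open>b\<close> that represents the bracket with \<open>A\<close> on the imaginary octonions.\<close>

lemma solution_in_group:
  fixes F :: "real \<times> real \<Rightarrow> real ^ 8 ^ 8"
  assumes conn: "connected \<Omega>" and p: "p \<in> \<Omega>" "F p = mat 1"
    and dF: "\<And>z. z \<in> \<Omega> \<Longrightarrow> (F has_derivative (\<lambda>\<xi>. F z ** A z \<xi>)) (at z)"
    and z: "z \<in> \<Omega>"
  shows "F z \<in> G_grp I"
proof -
  have const: "f z = f p" if "\<And>w. w \<in> \<Omega> \<Longrightarrow> (f has_derivative (\<lambda>_. 0)) (at w)" for f :: "real \<times> real \<Rightarrow> 'c::real_normed_vector"
    using has_derivative_zero_unique_connected[OF open_\<Omega> conn that z p(1)] .
  have o: "F z ** transpose (F z) = mat 1"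
  proof -
    have "((\<lambda>w. F w ** mat 1 ** transpose (F w)) has_derivative (\<lambda>_. 0)) (at w)" if w: "w \<in> \<Omega>" for w
      by (rule has_derivative_eq_rhs[OF conj_derivative[OF w dF[OF w] has_derivative_const]]) (simp add: mm_simps)
    from const[OF this] show ?thesis by (simp add: p(2))
  qed
  then have o': "transpose (F z) ** F z = mat 1" by (simp add: matrix_left_right_inverse)
  have comm: "F z ** Lmat (oct_unit i) = Lmat (oct_unit i) ** F z" if i: "i \<in> I" for i
  proof -
    have "((\<lambda>w. F w ** Lmat (oct_unit i) ** transpose (F w)) has_derivative (\<lambda>_. 0)) (at w)" if w: "w \<in> \<Omega>" for w
      by (rule has_derivative_eq_rhs[OF conj_derivative[OF w dF[OF w] has_derivative_const]])
        (simp add: g_linD(3)[OF A_g_lin[OF w] i] mm_simps)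
    from const[OF this] have "F z ** Lmat (oct_unit i) ** transpose (F z) = Lmat (oct_unit i)" by (simp add: p(2))
    then have "Lmat (oct_unit i) ** F z = F z ** Lmat (oct_unit i) ** (transpose (F z) ** F z)"
      by (metis matrix_mul_assoc)
    then show ?thesis by (simp add: o')
  qed
  define \<Phi> where "\<Phi> M = M - Lmat (M *v oct_unit 0)" for M
  have \<Phi>: "bounded_linear \<Phi>" unfolding \<Phi>_def
    by (intro bounded_linear_sub bounded_linear_ident bounded_linear_compose[OF bounded_linear_Lmat] mv.bounded_linear_left)
  define Y where "Y u w = \<Phi> (F w ** Lmat u ** transpose (F w))" for u w
  have Y_lin: "linear (\<lambda>u. Y u w)" for w
    unfolding Y_def
    by (intro bounded_linear.linear bounded_linear_compose[OF \<Phi>] bounded_linear_compose[OF mm.bounded_linear_left]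
        bounded_linear_compose[OF mm.bounded_linear_right] bounded_linear_Lmat)
  define N where "N w = (\<Sum>i\<in>{1..7}. Y (oct_unit i) w \<bullet> Y (oct_unit i) w)" for w
  have "(N has_derivative (\<lambda>_. 0)) (at w)" if w: "w \<in> \<Omega>" for w
  proof -
    have "\<exists>a. \<forall>u\<in>ImO. a u \<in> ImO \<and> A w \<xi> ** Lmat u - Lmat u ** A w \<xi> = Lmat (a u)" for \<xi>
      using g_linD(2)[OF A_g_lin[OF w]] by (intro bchoice) blast
    then obtain a where a: "\<And>\<xi> u. u \<in> ImO \<Longrightarrow> a \<xi> u \<in> ImO"
      "\<And>\<xi> u. u \<in> ImO \<Longrightarrow> A w \<xi> ** Lmat u - Lmat u ** A w \<xi> = Lmat (a \<xi> u)"
      by metis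
    have dY: "(Y u has_derivative (\<lambda>\<xi>. Y (a \<xi> u) w)) (at w)" if u: "u \<in> ImO" for u
      unfolding Y_def
      by (rule has_derivative_eq_rhs[OF bounded_linear.has_derivative[OF \<Phi> conj_derivative[OF w dF[OF w] has_derivative_const]]])
        (simp add: a(2)[OF u])
    have skew: "a \<xi> u \<bullet> v = - (a \<xi> v \<bullet> u)" if u: "u \<in> ImO" and v: "v \<in> ImO" for \<xi> u v
    proof -
      let ?B = "A w \<xi>"
      have "?B ** (Lmat u ** Lmat v + Lmat v ** Lmat u) - (Lmat u ** Lmat v + Lmat v ** Lmat u) ** ?B
          = (Lmat (a \<xi> u) ** Lmat v + Lmat v ** Lmat (a \<xi> u)) + (Lmat (a \<xi> v) ** Lmat u + Lmat u ** Lmat (a \<xi> v))"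
        unfolding a(2)[OF u, symmetric] a(2)[OF v, symmetric]
        by (simp add: mm_simps matrix_mul_assoc)
      then have "(- 2 * (a \<xi> u \<bullet> v)) *\<^sub>R mat 1 + (- 2 * (a \<xi> v \<bullet> u)) *\<^sub>R (mat 1 :: real ^ 8 ^ 8) = 0"
        unfolding clifford[OF u v] clifford[OF a(1)[OF u] v] clifford[OF a(1)[OF v] u] by (simp add: mm_simps)
      then have "(- 2 * (a \<xi> u \<bullet> v) + - 2 * (a \<xi> v \<bullet> u)) *\<^sub>R (mat 1 :: real ^ 8 ^ 8) = 0"
        by (simp only: scaleR_add_left)
      then show ?thesis using one_matrix_nonzero by simp
    qed
    define c where "c i j = Y (oct_unit i) w \<bullet> Y (oct_unit j) w" for i j
    have dN: "(N has_derivative (\<lambda>\<xi>. \<Sum>i\<in>{1..7}. Y (oct_unit i) w \<bullet> Y (a \<xi> (oct_unit i)) w + Y (a \<xi> (oct_unit i)) w \<bullet> Y (oct_unit i) w)) (at w)"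
      unfolding N_def by (intro has_derivative_sum has_derivative_inner dY ImO_units)
    have "(\<Sum>i\<in>{1..7}. Y (oct_unit i) w \<bullet> Y (a \<xi> (oct_unit i)) w + Y (a \<xi> (oct_unit i)) w \<bullet> Y (oct_unit i) w) = 0" for \<xi>
    proof -
      define b where "b i j = a \<xi> (oct_unit i) \<bullet> oct_unit j" for i j
      have Ya: "Y (a \<xi> (oct_unit i)) w = (\<Sum>j\<in>{1..7}. b i j *\<^sub>R Y (oct_unit j) w)" if "i \<in> {1..7}" for i
        by (subst ImO_expand[OF a(1)[OF ImO_units[OF that]]])
          (simp add: linear_sum[OF Y_lin] linear_cmul[OF Y_lin] b_def)
      have "(\<Sum>i\<in>{1..7}. Y (a \<xi> (oct_unit i)) w \<bullet> Y (oct_unit i) w) = (\<Sum>i\<in>{1..7}. \<Sum>j\<in>{1..7}. b i j * c j i)"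
        by (intro sum.cong refl) (simp add: Ya inner_sum_left c_def)
      moreover have "(\<Sum>i\<in>{1..7}. \<Sum>j\<in>{1..7}. b i j * c j i) = - (\<Sum>i\<in>{1..7}. \<Sum>j\<in>{1..7}. b i j * c j i)"
      proof -
        have "(\<Sum>i\<in>{1..7}. \<Sum>j\<in>{1..7}. b i j * c j i) = (\<Sum>i\<in>{1..7}. \<Sum>j\<in>{1..7}. - (b j i * c i j))"
        proof (intro sum.cong refl)
          fix i j :: nat assume "i \<in> {1..7}" "j \<in> {1..7}"
          then have "b i j = - b j i" unfolding b_def by (intro skew ImO_units)
          moreover have "c j i = c i j" by (simp add: c_def inner_commute)
          ultimately show "b i j * c j i = - (b j i * c i j)" by simp
        qed
        also have "\<dots> = - (\<Sum>i\<in>{1..7}. \<Sum>j\<in>{1..7}. b j i * c i j)" by (simp add: sum_negf)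
        also have "(\<Sum>i\<in>{1..7}. \<Sum>j\<in>{1..7}. b j i * c i j) = (\<Sum>j\<in>{1..7}. \<Sum>i\<in>{1..7}. b j i * c i j)"
          by (rule sum.swap)
        finally show ?thesis .
      qed
      ultimately have "(\<Sum>i\<in>{1..7}. Y (a \<xi> (oct_unit i)) w \<bullet> Y (oct_unit i) w) = 0" by simp
      then show ?thesis by (simp add: inner_commute[of "Y (oct_unit _) w"] flip: sum_distrib_left)
    qed
    then show ?thesis by (intro has_derivative_eq_rhs[OF dN]) simp
  qed
  from const[OF this] have "N z = N p" .
  also have "N p = 0" by (simp add: N_def Y_def \<Phi>_def p(2))
  finally have "\<forall>i\<in>{1..7}. Y (oct_unit i) z \<bullet> Y (oct_unit i) z = 0"
    unfolding N_def by (subst (asm) sum_nonneg_eq_0_iff) auto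
  then have Y0: "Y (oct_unit i) z = 0" if "i \<in> {1..7}" for i using that by auto
  have "spin_like (F z)"
    unfolding spin_like_def
  proof (intro conjI ballI)
    fix u assume u: "u \<in> ImO"
    define w where "w = (F z ** Lmat u ** transpose (F z)) *v oct_unit 0"
    have "Y u z = 0"
      by (subst ImO_expand[OF u]) (simp add: linear_sum[OF Y_lin] linear_cmul[OF Y_lin] Y0)
    then have L: "F z ** Lmat u ** transpose (F z) = Lmat w" by (simp add: Y_def \<Phi>_def w_def)
    have "transpose (Lmat w) = - Lmat w"
      unfolding L[symmetric] by (simp add: matrix_transpose_mul transpose_Lmat[OF u] mm_simps matrix_mul_assoc)
    then have "transpose (Lmat w) $ 0 $ 0 = - Lmat w $ 0 $ 0" by simp
    then have "Lmat w $ 0 $ 0 = 0" by (simp add: transpose_def)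
    then have "w \<in> ImO" by (simp add: ImO_iff Lmat_def matrix_def axis_def oct_mult_nth)
    then show "\<exists>w\<in>ImO. F z ** Lmat u ** transpose (F z) = Lmat w" using L by blast
  qed (rule o')
  then show ?thesis using comm by (simp add: G_grp_iff)
qed

lemma frame_exists:
  assumes MC: "MC_equation \<Omega> \<alpha>" and sc: "simply_connected \<Omega>" and ne: "\<Omega> \<noteq> {}"
  obtains F X where "frame I \<Omega> \<alpha> F X"
proof -
  define G where "G z = (\<alpha> z (1, 0), \<alpha> z (0, 1))" for z
  have G: "smooth_on \<Omega> G"
  proof -
    have "smooth_on \<Omega> (\<lambda>z. (\<alpha> z (1, 0), 0) + (0, \<alpha> z (0, 1)))"
      by (intro smooth_on_add[OF open_\<Omega>] smooth_on_bounded_linear[OF open_\<Omega> _ form_smooth]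
          bounded_linear_Pair bounded_linear_ident bounded_linear_zero)
    then show ?thesis by (simp add: G_def[abs_def])
  qed
  define a where "a z = covec (G z)" for z
  define a' where "a' z = Blinfun covec o\<^sub>L covec (du G z, dv G z)" for z
  have covL: "blinfun_apply (Blinfun covec) = (covec :: (real aff8 \<times> real aff8) \<Rightarrow> _)"
    by (rule bounded_linear_Blinfun_apply[OF bounded_linear_covec])
  have a: "a z \<xi> = \<alpha> z \<xi>" if "z \<in> \<Omega>" for z \<xi>
    by (simp add: a_def G_def flip: linear_R2[OF form_linear[OF that]])
  have a': "(a has_derivative blinfun_apply (a' z)) (at z)" if z: "z \<in> \<Omega>" for z
    unfolding a_def
    by (rule has_derivative_eq_rhs[OF bounded_linear.has_derivative[OF bounded_linear_covec smooth_on_has_covec_derivative[OF G z]]])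
      (simp add: a'_def covL fun_eq_iff)
  have "smooth_on \<Omega> (du G)" "smooth_on \<Omega> (dv G)"
    unfolding du_def dv_def by (rule smooth_on_frechet_derivative[OF G])+
  then have cont: "continuous_on \<Omega> a'"
    unfolding a'_def
    by (intro continuous_intros bounded_linear.continuous_on[OF bounded_linear_covec] smooth_on_continuous_on)
  have flat: "frame_act (a' z h k - a' z k h) y = frame_act (a z h) (frame_act (a z k) y) - frame_act (a z k) (frame_act (a z h) y)"
    if z: "z \<in> \<Omega>" for z h k y
  proof -
    have ev: "a' z h k = frechet_derivative (\<lambda>w. \<alpha> w k) (at z) h" for h k
    proof -
      have "((\<lambda>w. blinfun_apply (a w) k) has_derivative (\<lambda>h. a' z h k)) (at z)"
        by (rule bounded_linear.has_derivative[OF blinfun.bounded_linear_left a'[OF z]])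
      then have "((\<lambda>w. \<alpha> w k) has_derivative (\<lambda>h. a' z h k)) (at z)"
        by (rule has_derivative_transform_within_open[OF _ open_\<Omega> z]) (simp add: a)
      then show ?thesis by (simp add: frechet_derivative_at[symmetric])
    qed
    have "ext_d \<alpha> z h k + lie_bracket (\<alpha> z h) (\<alpha> z k) = 0"
      using MC z unfolding MC_equation_def wedge_self_def by blast
    then have "a' z h k - a' z k h = - lie_bracket (\<alpha> z h) (\<alpha> z k)"
      by (simp add: ev ext_d_def eq_neg_iff_add_eq_0)
    then show ?thesis
      by (simp add: frame_act_def prod_eq_iff fst_lie_bracket snd_lie_bracket a[OF z] mm_simps
          mv.minus_right mv.diff_right mv.zero_left matrix_mul_assoc matrix_vector_mul_assoc)
  qed
  obtain y p where p: "p \<in> \<Omega>" "y p = (mat 1, 0)"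
    and y: "\<And>z. z \<in> \<Omega> \<Longrightarrow> (y has_derivative (\<lambda>h. frame_act (a z h) (y z))) (at z)"
    using flat_system_simply_connected[OF bounded_bilinear_frame_act open_\<Omega> sc ne a' cont flat] by blast
  have dF: "((\<lambda>z. fst (y z)) has_derivative (\<lambda>\<xi>. fst (y z) ** A z \<xi>)) (at z)"
    and dX: "((\<lambda>z. snd (y z)) has_derivative (\<lambda>\<xi>. fst (y z) *v t z \<xi>)) (at z)" if z: "z \<in> \<Omega>" for z
    using has_derivative_fst[OF y[OF z]] has_derivative_snd[OF y[OF z]]
    by (simp_all add: frame_act_def a[OF z] A_def t_def)
  have "frame I \<Omega> \<alpha> (\<lambda>z. fst (y z)) (\<lambda>z. snd (y z))"
    by (unfold_locales)
      (use solution_in_group[OF simply_connected_imp_connected[OF sc] p(1), of "\<lambda>z. fst (y z)"] p(2) dF dX in auto)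
  then show ?thesis using that by blast
qed

end

section \<open>The tension field in a frame\<close>

definition lap :: "(real \<times> real \<Rightarrow> 'b::real_normed_vector) \<Rightarrow> real \<times> real \<Rightarrow> 'b" where
  "lap f z = du (du f) z + dv (dv f) z"

lemma frechet_derivative_cong:
  assumes "open S" "z \<in> S" and eq: "\<And>w. w \<in> S \<Longrightarrow> f w = g w"
  shows "frechet_derivative f (at z) = frechet_derivative g (at z)"
proof -
  have "(f has_derivative D) (at z) \<longleftrightarrow> (g has_derivative D) (at z)" for D
    using has_derivative_transform_within_open[OF _ assms(1,2), of f D UNIV g]
      has_derivative_transform_within_open[OF _ assms(1,2), of g D UNIV f] eq by metis
  then show ?thesis by (simp add: frechet_derivative_def)
qed

lemma du_cong: "open S \<Longrightarrow> z \<in> S \<Longrightarrow> (\<And>w. w \<in> S \<Longrightarrow> f w = g w) \<Longrightarrow> du f z = du g z"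
  and dv_cong: "open S \<Longrightarrow> z \<in> S \<Longrightarrow> (\<And>w. w \<in> S \<Longrightarrow> f w = g w) \<Longrightarrow> dv f z = dv g z"
  by (simp_all add: du_def dv_def frechet_derivative_cong[of S z f g])

lemma lap_cong:
  assumes "open S" "z \<in> S" "\<And>w. w \<in> S \<Longrightarrow> f w = g w"
  shows "lap f z = lap g z"
  unfolding lap_def
  by (intro arg_cong2[where f = "(+)"] du_cong[OF assms(1,2)] dv_cong[OF assms(1,2)])
    (use du_cong[OF assms(1)] dv_cong[OF assms(1)] assms(3) in metis)+

lemma du_bounded_linear: "bounded_linear L \<Longrightarrow> smooth_on S f \<Longrightarrow> z \<in> S \<Longrightarrow> du (\<lambda>w. L (f w)) z = L (du f z)"
  and dv_bounded_linear: "bounded_linear L \<Longrightarrow> smooth_on S f \<Longrightarrow> z \<in> S \<Longrightarrow> dv (\<lambda>w. L (f w)) z = L (dv f z)"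
  using has_derivative_du[OF bounded_linear.has_derivative[OF _ smooth_on_has_derivative]]
    has_derivative_dv[OF bounded_linear.has_derivative[OF _ smooth_on_has_derivative]]
  by (fastforce simp: du_def dv_def)+

lemma smooth_on_du: "smooth_on S f \<Longrightarrow> smooth_on S (du f)"
  and smooth_on_dv: "smooth_on S f \<Longrightarrow> smooth_on S (dv f)"
  unfolding du_def dv_def by (rule smooth_on_frechet_derivative, assumption)+

lemma lap_bounded_linear:
  assumes S: "open S" and L: "bounded_linear L" and f: "smooth_on S f" and z: "z \<in> S"
  shows "lap (\<lambda>w. L (f w)) z = L (lap f z)"
proof -
  have "du (du (\<lambda>w. L (f w))) z = du (\<lambda>w. L (du f w)) z"
    by (rule du_cong[OF S z]) (rule du_bounded_linear[OF L f])
  also have "\<dots> = L (du (du f) z)" by (rule du_bounded_linear[OF L smooth_on_du[OF f] z])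
  finally have 1: "du (du (\<lambda>w. L (f w))) z = L (du (du f) z)" .
  have "dv (dv (\<lambda>w. L (f w))) z = dv (\<lambda>w. L (dv f w)) z"
    by (rule dv_cong[OF S z]) (rule dv_bounded_linear[OF L f])
  also have "\<dots> = L (dv (dv f) z)" by (rule dv_bounded_linear[OF L smooth_on_dv[OF f] z])
  finally show ?thesis using 1 by (simp add: lap_def linear_add[OF bounded_linear.linear[OF L]])
qed

lemma (in isotropy_index) bounded_linear_P0: "bounded_linear P0"
  and bounded_linear_P2: "bounded_linear P2"
  unfolding linear_conv_bounded_linear[symmetric]
  by (rule linearI; simp add: P0_def P2_def mm_simps algebra_simps)+

context frame
begin

text \<open>The divergence of \<open>A\<^sub>2\<close> for the connection \<open>d + A\<^sub>0\<close>.\<close>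

definition H where
  "H z = P2 (du (\<lambda>w. A w (1, 0)) z) + P2 (dv (\<lambda>w. A w (0, 1)) z)
    + (P0 (A z (1, 0)) ** P2 (A z (1, 0)) - P2 (A z (1, 0)) ** P0 (A z (1, 0)))
    + (P0 (A z (0, 1)) ** P2 (A z (0, 1)) - P2 (A z (0, 1)) ** P0 (A z (0, 1)))"

definition R where "R z = F z ** J ** transpose (F z)"
definition Q where "Q \<xi> z = 2 *\<^sub>R (P2 (A z \<xi>) ** J)"

lemma commutator_J: "A z \<xi> ** J - J ** A z \<xi> = Q \<xi> z"
proof -
  have "(P0 (A z \<xi>) + P2 (A z \<xi>)) ** J - J ** (P0 (A z \<xi>) + P2 (A z \<xi>)) = Q \<xi> z"
    by (simp add: mm_simps P0_commutes P2_anticommutes Q_def scaleR_2)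
  then show ?thesis by (simp add: P0_P2_sum)
qed

lemma R_derivative: "z \<in> \<Omega> \<Longrightarrow> (R has_derivative (\<lambda>\<xi>. F z ** Q \<xi> z ** transpose (F z))) (at z)"
  unfolding R_def
  by (rule has_derivative_eq_rhs[OF conj_derivative[OF _ dF has_derivative_const]]) (simp_all add: commutator_J)

lemma Q_derivative:
  assumes z: "z \<in> \<Omega>"
  shows "(Q \<xi> has_derivative (\<lambda>h. 2 *\<^sub>R (P2 (frechet_derivative (\<lambda>w. A w \<xi>) (at z) h) ** J))) (at z)"
  unfolding Q_def
  by (intro has_derivative_scaleR_right bounded_linear.has_derivative[OF mm.bounded_linear_left]
      bounded_linear.has_derivative[OF bounded_linear_P2] A_deriv[OF z])

lemma lap_R:
  assumes z: "z \<in> \<Omega>"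
  shows "lap R z = F z ** (2 *\<^sub>R (P2 (du (\<lambda>w. A w (1, 0)) z) ** J) + (A z (1, 0) ** Q (1, 0) z - Q (1, 0) z ** A z (1, 0))
     + (2 *\<^sub>R (P2 (dv (\<lambda>w. A w (0, 1)) z) ** J) + (A z (0, 1) ** Q (0, 1) z - Q (0, 1) z ** A z (0, 1)))) ** transpose (F z)"
proof -
  have 1: "du R w = F w ** Q (1, 0) w ** transpose (F w)" "dv R w = F w ** Q (0, 1) w ** transpose (F w)" if "w \<in> \<Omega>" for w
    using has_derivative_du[OF R_derivative[OF that]] has_derivative_dv[OF R_derivative[OF that]] by simp_all
  note d = conj_derivative[OF z dF[OF z] Q_derivative[OF z]]
  have "du (du R) z = du (\<lambda>w. F w ** Q (1, 0) w ** transpose (F w)) z"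
    by (rule du_cong[OF open_\<Omega> z 1(1)])
  moreover have "dv (dv R) z = dv (\<lambda>w. F w ** Q (0, 1) w ** transpose (F w)) z"
    by (rule dv_cong[OF open_\<Omega> z 1(2)])
  ultimately show ?thesis
    unfolding lap_def has_derivative_du[OF d] has_derivative_dv[OF d]
    by (simp add: du_def dv_def mm_simps)
qed

lemma R_smooth: "smooth_on \<Omega> R"
  unfolding R_def
  by (intro smooth_on_bilinear[OF open_\<Omega> mm.bounded_bilinear_axioms] smooth_on_const[OF open_\<Omega>]
      F_smooth smooth_on_bounded_linear[OF open_\<Omega> bounded_linear_transpose])

lemma r_smooth: "smooth_on \<Omega> r"
proof (rule smooth_on_cong[OF open_\<Omega>])
  show "smooth_on \<Omega> (\<lambda>z. R z *v oct_unit 0)"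
    by (rule smooth_on_bounded_linear[OF open_\<Omega> mv.bounded_linear_left R_smooth])
  show "R z *v oct_unit 0 = r z" if "z \<in> \<Omega>" for z
    by (simp add: R_def flip: Lmat_r[OF that])
qed

lemma lap_r:
  assumes z: "z \<in> \<Omega>"
  shows "Lmat (lap r z) = lap R z" "lap r z \<in> ImO"
proof -
  have "lap R z = lap (\<lambda>w. Lmat (r w)) z"
    by (rule lap_cong[OF open_\<Omega> z]) (simp add: R_def Lmat_r)
  then show "Lmat (lap r z) = lap R z" by (simp add: lap_bounded_linear[OF open_\<Omega> bounded_linear_Lmat r_smooth z])
  have "lap r z $ 0 = lap (\<lambda>w. r w $ 0) z"
    by (rule lap_bounded_linear[OF open_\<Omega> bounded_linear_vec_nth r_smooth z, symmetric])
  also have "\<dots> = lap (\<lambda>w. 0 :: real) z"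
    by (rule lap_cong[OF open_\<Omega> z]) (use r_ImO ImO_iff in auto)
  also have "\<dots> = 0" by (simp add: lap_def du_def[abs_def] dv_def[abs_def])
  finally show "lap r z \<in> ImO" by (simp add: ImO_iff)
qed

text \<open>The Laplacian of \<open>F J F\<inverse>\<close> is \<open>F K F\<inverse>\<close>. Conjugated back by \<open>F\<close>, vectors normal to the sphere at \<open>r\<close> are
  the multiples of \<open>J\<close>, and tangential imaginary vectors correspond to matrices anticommuting with \<open>J\<close>. The part
  \<open>2 H J\<close> of \<open>K\<close> anticommutes with \<open>J\<close>; the rest \<open>Kn\<close> commutes with \<open>J\<close>, and the Clifford relations identify it
  with the normal component.\<close>

lemma tension_r:
  assumes z: "z \<in> \<Omega>"
  shows "Lmat (tension r z) = F z ** (2 *\<^sub>R (H z ** J)) ** transpose (F z)"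
proof -
  define a0 a2 b0 b2 where "a0 = P0 (A z (1, 0))" and "a2 = P2 (A z (1, 0))"
    and "b0 = P0 (A z (0, 1))" and "b2 = P2 (A z (0, 1))"
  have J0: "J ** a0 = a0 ** J" "J ** b0 = b0 ** J" by (simp_all add: a0_def b0_def P0_commutes)
  have J2: "J ** a2 = - (a2 ** J)" "J ** b2 = - (b2 ** J)" by (simp_all add: a2_def b2_def P2_anticommutes)
  have Jm: "M ** J ** a0 = M ** a0 ** J" "M ** J ** b0 = M ** b0 ** J"
     "M ** J ** a2 = - (M ** a2 ** J)" "M ** J ** b2 = - (M ** b2 ** J)" for M :: "real ^ 8 ^ 8"
    by (simp_all add: J0 J2 mm_simps flip: matrix_mul_assoc)
  \<comment> \<open>The commutator of \<open>a2\<close> with \<open>2 *\<^sub>R (a2 ** J)\<close> plus that of \<open>b2\<close> with \<open>2 *\<^sub>R (b2 ** J)\<close>.\<close>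
  define Kn where "Kn = 4 *\<^sub>R ((a2 ** a2 + b2 ** b2) ** J)"
  define K where "K = 2 *\<^sub>R (H z ** J) + Kn"
  have AA: "A z (1, 0) = a0 + a2" "A z (0, 1) = b0 + b2"
    by (simp_all add: a0_def a2_def b0_def b2_def P0_P2_sum)
  have lapR: "lap R z = F z ** K ** transpose (F z)"
  proof -
    have "2 *\<^sub>R (P2 (du (\<lambda>w. A w (1, 0)) z) ** J) + ((a0 + a2) ** (2 *\<^sub>R (a2 ** J)) - (2 *\<^sub>R (a2 ** J)) ** (a0 + a2))
      + (2 *\<^sub>R (P2 (dv (\<lambda>w. A w (0, 1)) z) ** J) + ((b0 + b2) ** (2 *\<^sub>R (b2 ** J)) - (2 *\<^sub>R (b2 ** J)) ** (b0 + b2))) = K"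
      unfolding K_def Kn_def H_def a0_def[symmetric] a2_def[symmetric] b0_def[symmetric] b2_def[symmetric]
      by (simp add: mm_simps matrix_mul_assoc Jm algebra_simps flip: scaleR_add_left)
    then show ?thesis
      unfolding lap_R[OF z] Q_def a2_def[symmetric] b2_def[symmetric] unfolding AA by simp
  qed
  define x where "x = lap r z"
  have x: "x \<in> ImO" "Lmat x = F z ** K ** transpose (F z)" using lap_r[OF z] lapR by (simp_all add: x_def)
  note o = F_orthogonal[OF z]
  have prod: "F z ** M ** transpose (F z) ** (F z ** N ** transpose (F z)) = F z ** (M ** N) ** transpose (F z)" for M N
  proof -
    have "F z ** M ** transpose (F z) ** (F z ** N ** transpose (F z)) = F z ** M ** (transpose (F z) ** F z) ** N ** transpose (F z)"
      by (simp add: matrix_mul_assoc)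
    then show ?thesis by (simp add: o matrix_mul_assoc)
  qed
  have HJ: "J ** H z = - (H z ** J)"
    unfolding H_def a0_def[symmetric] a2_def[symmetric] b0_def[symmetric] b2_def[symmetric]
    by (simp add: mm_simps matrix_mul_assoc Jm J0 J2 P2_anticommutes algebra_simps)
  have KnJ: "J ** Kn = Kn ** J"
    unfolding Kn_def by (simp add: mm_simps matrix_mul_assoc Jm J0 J2)
  have "J ** K + K ** J = 2 *\<^sub>R (Kn ** J)"
  proof -
    have W: "J ** (H z ** J) + H z ** J ** J = 0" by (simp add: matrix_mul_assoc HJ mm_simps)
    have "J ** K + K ** J = 2 *\<^sub>R (J ** (H z ** J) + H z ** J ** J) + (J ** Kn + Kn ** J)"
      unfolding K_def by (simp only: mm_simps scaleR_add_right add_ac)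
    then show ?thesis by (simp only: W KnJ scaleR_zero_right add_0_left scaleR_2)
  qed
  moreover have "Lmat (r z) ** Lmat x + Lmat x ** Lmat (r z) = F z ** (J ** K + K ** J) ** transpose (F z)"
    unfolding Lmat_r[OF z] x(2) prod by (simp add: mm_simps)
  ultimately have "F z ** (2 *\<^sub>R (Kn ** J)) ** transpose (F z) = (- 2 * (r z \<bullet> x)) *\<^sub>R mat 1"
    using clifford[OF r_ImO[OF z] x(1)] by simp
  also have "\<dots> = F z ** ((- 2 * (r z \<bullet> x)) *\<^sub>R mat 1) ** transpose (F z)"
    by (simp add: mm_simps transpose_right_inverse[OF o])
  finally have "2 *\<^sub>R (Kn ** J) = (- 2 * (r z \<bullet> x)) *\<^sub>R mat 1"
    unfolding orthogonal_matrix_cancel(4)[OF o] .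
  then have "2 *\<^sub>R (Kn ** J) ** J = ((- 2 * (r z \<bullet> x)) *\<^sub>R mat 1) ** J" by simp
  then have "2 *\<^sub>R Kn = 2 *\<^sub>R ((r z \<bullet> x) *\<^sub>R J)" by (simp add: mm_simps)
  then have Kn: "Kn = (r z \<bullet> x) *\<^sub>R J" by (simp only: scaleR_cancel_left) simp
  have "tension r z = x - (r z \<bullet> x) *\<^sub>R r z"
    by (simp add: tension_def tangential_def x_def lap_def inner_add_left inner_commute algebra_simps)
  then have "Lmat (tension r z) = F z ** K ** transpose (F z) - (r z \<bullet> x) *\<^sub>R (F z ** J ** transpose (F z))"
    by (simp add: Lmat_simps x(2) Lmat_r[OF z])
  also have "\<dots> = F z ** (K - Kn) ** transpose (F z)" unfolding Kn by (simp add: mm_simps)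
  finally show ?thesis by (simp add: K_def)
qed

lemma tension_r_eq_zero_iff: "z \<in> \<Omega> \<Longrightarrow> tension r z = 0 \<longleftrightarrow> H z = 0"
proof -
  assume z: "z \<in> \<Omega>"
  have "tension r z = 0 \<longleftrightarrow> Lmat (tension r z) = Lmat 0" by simp
  also have "\<dots> \<longleftrightarrow> F z ** (2 *\<^sub>R (H z ** J)) ** transpose (F z) = F z ** 0 ** transpose (F z)"
    by (simp add: tension_r[OF z] Lmat_simps mm_simps)
  also have "\<dots> \<longleftrightarrow> H z ** J = 0" unfolding orthogonal_matrix_cancel(4)[OF F_orthogonal[OF z]] by simp
  also have "\<dots> \<longleftrightarrow> H z = 0"
  proof
    assume e: "H z ** J = 0"
    have "H z ** J ** J = - H z" by (rule J_cancel(2))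
    then show "H z = 0" unfolding e mm.zero_left by simp
  qed (simp add: mm.zero_left)
  finally show ?thesis .
qed

lemma rho_harmonic_iff:
  assumes h: "\<And>z. z \<in> \<Omega> \<Longrightarrow> t z (0, 1) = J *v t z (1, 0)" and nz: "\<And>z. z \<in> \<Omega> \<Longrightarrow> t z (1, 0) \<noteq> 0"
  shows "rho_harmonic_on \<Omega> X \<longleftrightarrow> (\<forall>z\<in>\<Omega>. H z = 0)"
proof -
  have eq: "rho_map X z = r z" if "z \<in> \<Omega>" for z using holomorphic_imp_rho_map(4)[OF that h nz] that by blast
  have "smooth_on \<Omega> (rho_map X)" by (rule smooth_on_cong[OF open_\<Omega> _ r_smooth]) (simp add: eq)
  moreover have "rho_map X z \<in> ImO \<inter> sphere 0 1" if z: "z \<in> \<Omega>" for z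
  proof -
    have L: "F z ** Lmat (e_vec I) ** transpose (F z) = Lmat (r z)" by (simp only: Lmat_r[OF z] J_def)
    have "r z \<bullet> r z = e_vec I \<bullet> e_vec I"
      by (rule spin_like_norm[OF F_spin_like[OF z] e_ImO r_ImO[OF z] L e_ImO r_ImO[OF z] L])
    then have "norm (r z) = 1" using norm_e by (simp add: norm_eq_sqrt_inner)
    then show ?thesis using r_ImO[OF z] by (simp add: eq[OF z])
  qed
  moreover have "tension (rho_map X) z = tension r z" if z: "z \<in> \<Omega>" for z
  proof -
    have "du (du (rho_map X)) z = du (du r) z" "dv (dv (rho_map X)) z = dv (dv r) z"
      using du_cong[OF open_\<Omega>, of _ "rho_map X" r] dv_cong[OF open_\<Omega>, of _ "rho_map X" r] eq
      by (auto intro!: du_cong[OF open_\<Omega> z] dv_cong[OF open_\<Omega> z])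
    then show ?thesis by (simp add: tension_def eq[OF z])
  qed
  ultimately show ?thesis
    using tension_r_eq_zero_iff unfolding rho_harmonic_on_def harmonic_to_sphere_on_def by (auto simp: image_subset_iff)
qed

end

section \<open>The curvature of the extended form\<close>

lemma lie_bracket_cscale:
  "lie_bracket (cscale c v) w = cscale c (lie_bracket v w)" "lie_bracket v (cscale c w) = cscale c (lie_bracket v w)"
  by (simp_all add: aff8_eq_iff aff8_nth fst_lie_bracket snd_lie_bracket matrix_matrix_mult_def matrix_vector_mult_def
      sum_distrib_left algebra_simps)

lemma lie_bracket_cplx: "lie_bracket (cplx a) (cplx b) = cplx (lie_bracket a b)"
  by (simp add: aff8_eq_iff aff8_nth fst_lie_bracket snd_lie_bracket matrix_matrix_mult_def matrix_vector_mult_def)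

text \<open>The shape of the values of an extended form on \<open>\<partial>/\<partial>u\<close> and on \<open>\<partial>/\<partial>v\<close>: \<open>(c, s)\<close> and \<open>(c1, s1)\<close> are the complex
  cosine and sine of the angle for the matrix part and of half that angle for the vector part.\<close>

definition ext_comb :: "complex \<Rightarrow> complex \<Rightarrow> complex \<Rightarrow> complex \<Rightarrow>
    real ^ 8 ^ 8 \<Rightarrow> real ^ 8 ^ 8 \<Rightarrow> real ^ 8 ^ 8 \<Rightarrow> real ^ 8 \<Rightarrow> real ^ 8 \<Rightarrow> complex aff8" where
  "ext_comb c s c1 s1 M0 M1 M2 x y = cplx (M0, 0) + cscale c (cplx (M1, 0)) + cscale s (cplx (M2, 0))
     + cscale c1 (cplx (0, x)) + cscale s1 (cplx (0, y))"

lemma ext_comb_nth: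
  "fst (ext_comb c s c1 s1 M0 M1 M2 x y) $ i $ j = of_real (M0 $ i $ j) + c * of_real (M1 $ i $ j) + s * of_real (M2 $ i $ j)"
  "snd (ext_comb c s c1 s1 M0 M1 M2 x y) $ i = c1 * of_real (x $ i) + s1 * of_real (y $ i)"
  by (simp_all add: ext_comb_def aff8_nth)

lemma bracket_ext_comb:
  "lie_bracket (ext_comb c s c1 s1 p0 p2 q2 x y) (ext_comb c s c1 s1 q0 q2 (- p2) y (- x)) =
     cplx (p0 ** q0 - q0 ** p0, 0) + cscale (c * c + s * s) (cplx (p2 ** q2 - q2 ** p2, 0))
   + cscale c (cplx ((p0 ** q2 - q2 ** p0) + (p2 ** q0 - q0 ** p2), 0))
   - cscale s (cplx ((p0 ** p2 - p2 ** p0) + (q0 ** q2 - q2 ** q0), 0))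
   + cscale c1 (cplx (0, p0 *v y - q0 *v x)) - cscale s1 (cplx (0, p0 *v x + q0 *v y))
   + cscale (c * c1 + s * s1) (cplx (0, p2 *v y - q2 *v x)) + cscale (s * c1 - c * s1) (cplx (0, p2 *v x + q2 *v y))"
  unfolding ext_comb_def lie_bracket_bilinear lie_bracket_cscale lie_bracket_cplx
  by (simp add: aff8_eq_iff aff8_nth mm_simps mv.zero_left mv.zero_right mv.minus_left mv.minus_right fst_lie_bracket snd_lie_bracket)
    (simp add: algebra_simps)

text \<open>The hypotheses \<open>cs\<close> are the Pythagorean relation and the addition theorems for an angle and its half;
  \<open>m0\<close>, \<open>m2\<close> and \<open>mt\<close> are the components of the structure equation and \<open>mk\<close> is the image of \<open>mt\<close> under \<open>J\<close>.\<close>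

lemma ext_curvature:
  assumes cs: "c * c + s * s = 1" "c * c1 + s * s1 = c1" "s * c1 - c * s1 = s1"
    and m0: "d0 - e0 + (p0 ** q0 - q0 ** p0) + (p2 ** q2 - q2 ** p2) = 0"
    and m2: "d2 - e2 + (p0 ** q2 - q2 ** p0) + (p2 ** q0 - q0 ** p2) = 0"
    and mt: "dy - ex + (p0 *v y - q0 *v x) + (p2 *v y - q2 *v x) = 0"
    and mk: "- dx - ey - (p0 *v x + q0 *v y) + (p2 *v x + q2 *v y) = 0"
  shows "ext_comb c s c1 s1 d0 d2 (- dp2) dy (- dx) - ext_comb c s c1 s1 e0 e2 eq2 ex ey
    + lie_bracket (ext_comb c s c1 s1 p0 p2 q2 x y) (ext_comb c s c1 s1 q0 q2 (- p2) y (- x))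
    = cscale (- s) (cplx (dp2 + eq2 + (p0 ** p2 - p2 ** p0) + (q0 ** q2 - q2 ** q0), 0))"
proof -
  have 0: "d0 = e0 - (p0 ** q0 - q0 ** p0) - (p2 ** q2 - q2 ** p2)" using m0 by (simp add: algebra_simps)
  have 2: "d2 = e2 - (p0 ** q2 - q2 ** p0) - (p2 ** q0 - q0 ** p2)" using m2 by (simp add: algebra_simps)
  have t: "dy = ex - (p0 *v y - q0 *v x) - (p2 *v y - q2 *v x)" using mt by (simp add: algebra_simps)
  have k: "dx = - ey - (p0 *v x + q0 *v y) + (p2 *v x + q2 *v y)" using mk by (simp add: algebra_simps)
  show ?thesis
    unfolding bracket_ext_comb cs 0 2 t k
    by (simp add: aff8_eq_iff aff8_nth ext_comb_nth) (simp add: algebra_simps)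
qed

lemma ext_comb_has_derivative:
  assumes "(f0 has_derivative f0') F" "(f1 has_derivative f1') F" "(f2 has_derivative f2') F"
    "(g1 has_derivative g1') F" "(g2 has_derivative g2') F"
  shows "((\<lambda>w. ext_comb c s c1 s1 (f0 w) (f1 w) (f2 w) (g1 w) (g2 w)) has_derivative
    (\<lambda>h. ext_comb c s c1 s1 (f0' h) (f1' h) (f2' h) (g1' h) (g2' h))) F"
proof -
  have "bounded_linear (\<lambda>M. cplx (M, 0))" "bounded_linear (\<lambda>x. cplx (0, x))" "bounded_linear (\<lambda>v. cscale k v)" for k
    unfolding linear_conv_bounded_linear[symmetric]
    by (rule linearI; simp add: aff8_eq_iff aff8_nth scaleR_conv_of_real[where 'a = complex] algebra_simps)+
  note bl = this(1)[THEN bounded_linear.has_derivative] this(2)[THEN bounded_linear.has_derivative]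
    this(3)[THEN bounded_linear.has_derivative]
  show ?thesis unfolding ext_comb_def by (intro has_derivative_add bl assms)
qed

lemma (in isotropy_index) P0_eq: "J ** M = M ** J \<Longrightarrow> P0 M = M \<and> P2 M = 0"
  by (simp add: P0_def P2_def flip: scaleR_2)

lemma (in isotropy_index) P2_eq: "J ** M = - (M ** J) \<Longrightarrow> P0 M = 0 \<and> P2 M = M"
  by (simp add: P0_def P2_def mm_simps flip: scaleR_2)

context frame
begin

lemma extended_form_components:
  fixes l :: complex
  assumes z: "z \<in> \<Omega>" and h: "t z (0, 1) = J *v t z (1, 0)"
  defines "c \<equiv> (l powi 2 + l powi (-2)) / 2" and "s \<equiv> \<i> * (l powi 2 - l powi (-2)) / 2"
    and "c1 \<equiv> (l + l powi (-1)) / 2" and "s1 \<equiv> \<i> * (l - l powi (-1)) / 2"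
  shows "extended_form I \<alpha> l z (1, 0) =
      ext_comb c s c1 s1 (P0 (A z (1, 0))) (P2 (A z (1, 0))) (P2 (A z (0, 1))) (t z (1, 0)) (t z (0, 1))"
    "extended_form I \<alpha> l z (0, 1) =
      ext_comb c s c1 s1 (P0 (A z (0, 1))) (P2 (A z (0, 1))) (- P2 (A z (1, 0))) (t z (0, 1)) (- t z (1, 0))"
proof -
  have Jt: "J *v t z (0, 1) = - t z (1, 0)" "J *v t z (1, 0) = t z (0, 1)" by (simp_all add: h)
  have comps: "comp 0 (\<alpha> z \<xi>) = cplx (P0 (A z \<xi>), 0)" "comp 2 (\<alpha> z \<xi>) = cplx (P2 (A z \<xi>), 0)"
    "comp (-1) (\<alpha> z \<xi>) = cplx (0, (1 / 2) *\<^sub>R t z \<xi>) + cscale \<i> (cplx (0, (- 1 / 2) *\<^sub>R (J *v t z \<xi>)))"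
    "comp 1 (\<alpha> z \<xi>) = cplx (0, (1 / 2) *\<^sub>R t z \<xi>) + cscale \<i> (cplx (0, (1 / 2) *\<^sub>R (J *v t z \<xi>)))" for \<xi>
    by (simp_all add: comp_def A_def t_def)
  have one: "Complex 1 0 = 1" "Complex 0 1 = \<i>" "cnj 1 = 1" by (simp_all add: complex_eq_iff)
  define a b e where "a = l powi 2" and "b = l powi (-2)" and "e = l powi (-1)"
  show "extended_form I \<alpha> l z (1, 0) =
      ext_comb c s c1 s1 (P0 (A z (1, 0))) (P2 (A z (1, 0))) (P2 (A z (0, 1))) (t z (1, 0)) (t z (0, 1))"
    "extended_form I \<alpha> l z (0, 1) =
      ext_comb c s c1 s1 (P0 (A z (0, 1))) (P2 (A z (0, 1))) (- P2 (A z (1, 0))) (t z (0, 1)) (- t z (1, 0))"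
    unfolding extended_form_def dz_part_def dzbar_part_def c_def s_def c1_def s1_def
      a_def[symmetric] b_def[symmetric] e_def[symmetric]
    by (simp_all add: form_comp_eq[OF z] comps Jt one aff8_eq_iff aff8_nth ext_comb_nth)
      (simp_all add: field_simps)
qed


lemma extended_form_linear: "z \<in> \<Omega> \<Longrightarrow> linear (extended_form I \<alpha> l z)"
proof (rule linearI)
  assume z: "z \<in> \<Omega>"
  have c0: "form_comp I 0 \<alpha> z \<xi> = cplx (P0 (A z \<xi>), 0)" for \<xi>
    by (simp add: form_comp_eq[OF z] comp_def A_def)
  have A: "A z (\<xi> + \<eta>) = A z \<xi> + A z \<eta>" "A z (k *\<^sub>R \<xi>) = k *\<^sub>R A z \<xi>" for \<xi> \<eta> k
    by (simp_all add: A_def linear_add[OF form_linear[OF z]] linear_cmul[OF form_linear[OF z]])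
  have P0: "P0 (M + N) = P0 M + P0 N" "P0 (k *\<^sub>R M) = k *\<^sub>R P0 M" for M N k
    by (simp_all add: linear_add linear_cmul bounded_linear.linear[OF bounded_linear_P0])
  have C: "Complex (a + b) (c + d) = Complex a c + Complex b d" "Complex (k * a) (k * b) = of_real k * Complex a b" for a b c d k
    by (simp_all add: complex_eq_iff)
  have pair: "cplx (M + N, 0) = cplx (M, 0) + cplx (N, 0)" "cplx (k *\<^sub>R M, 0) = cscale (of_real k) (cplx (M, 0))" for M N k
    by (simp_all add: aff8_eq_iff aff8_nth)
  have scale: "k *\<^sub>R v = cscale (of_real k) v" for k and v :: "complex aff8"
    by (simp add: aff8_eq_iff aff8_nth scaleR_conv_of_real[where 'a = complex])
  show "extended_form I \<alpha> l z (\<xi> + \<eta>) = extended_form I \<alpha> l z \<xi> + extended_form I \<alpha> l z \<eta>" for \<xi> \<eta>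
    unfolding extended_form_def dz_part_def dzbar_part_def c0 A fst_add snd_add
    by (simp only: P0 pair C complex_cnj_add cscale_add_left cscale_add_right add_ac)
  show "extended_form I \<alpha> l z (k *\<^sub>R \<xi>) = k *\<^sub>R extended_form I \<alpha> l z \<xi>" for k \<xi>
    unfolding extended_form_def dz_part_def dzbar_part_def c0 A fst_scaleR snd_scaleR real_scaleR_def scale
    by (simp only: P0 pair C complex_cnj_mult complex_cnj_complex_of_real cscale_add_right cscale_cscale mult_ac)
qed

lemma structure_equation_components:
  assumes z: "z \<in> \<Omega>" and h: "\<And>z. z \<in> \<Omega> \<Longrightarrow> t z (0, 1) = J *v t z (1, 0)"
  defines "p0 \<equiv> P0 (A z (1, 0))" and "p2 \<equiv> P2 (A z (1, 0))" and "q0 \<equiv> P0 (A z (0, 1))" and "q2 \<equiv> P2 (A z (0, 1))"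
    and "x \<equiv> t z (1, 0)" and "y \<equiv> t z (0, 1)"
  shows "P0 (du (\<lambda>w. A w (0, 1)) z) - P0 (dv (\<lambda>w. A w (1, 0)) z) + (p0 ** q0 - q0 ** p0) + (p2 ** q2 - q2 ** p2) = 0"
    "P2 (du (\<lambda>w. A w (0, 1)) z) - P2 (dv (\<lambda>w. A w (1, 0)) z) + (p0 ** q2 - q2 ** p0) + (p2 ** q0 - q0 ** p2) = 0"
    "du (\<lambda>w. t w (0, 1)) z - dv (\<lambda>w. t w (1, 0)) z + (p0 *v y - q0 *v x) + (p2 *v y - q2 *v x) = 0"
    "- du (\<lambda>w. t w (1, 0)) z - dv (\<lambda>w. t w (0, 1)) z - (p0 *v x + q0 *v y) + (p2 *v x + q2 *v y) = 0"
proof -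
  have AA: "A z (1, 0) = p0 + p2" "A z (0, 1) = q0 + q2"
    by (simp_all add: p0_def p2_def q0_def q2_def P0_P2_sum)
  have J0: "J ** p0 = p0 ** J" "J ** q0 = q0 ** J" by (simp_all add: p0_def q0_def P0_commutes)
  have J2: "J ** p2 = - (p2 ** J)" "J ** q2 = - (q2 ** J)" by (simp_all add: p2_def q2_def P2_anticommutes)
  have Jm: "M ** J ** p0 = M ** p0 ** J" "M ** J ** q0 = M ** q0 ** J"
     "M ** J ** p2 = - (M ** p2 ** J)" "M ** J ** q2 = - (M ** q2 ** J)" for M :: "real ^ 8 ^ 8"
    by (simp_all add: J0 J2 mm_simps flip: matrix_mul_assoc)
  define X0 where "X0 = (p0 ** q0 - q0 ** p0) + (p2 ** q2 - q2 ** p2)"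
  define X2 where "X2 = (p0 ** q2 - q2 ** p0) + (p2 ** q0 - q0 ** p2)"
  have "J ** X0 = X0 ** J" unfolding X0_def by (simp add: mm_simps matrix_mul_assoc J0 J2 Jm)
  then have X0: "P0 X0 = X0" "P2 X0 = 0" using P0_eq by blast+
  have "J ** X2 = - (X2 ** J)" unfolding X2_def by (simp add: mm_simps matrix_mul_assoc J0 J2 Jm algebra_simps)
  then have X2: "P0 X2 = 0" "P2 X2 = X2" using P2_eq by blast+
  have MC: "du (\<lambda>w. A w (0, 1)) z - dv (\<lambda>w. A w (1, 0)) z + (X0 + X2) = 0"
    and MCt: "du (\<lambda>w. t w (0, 1)) z - dv (\<lambda>w. t w (1, 0)) z + ((p0 + p2) *v y - (q0 + q2) *v x) = 0"
  proof -
    have "(p0 + p2) ** (q0 + q2) - (q0 + q2) ** (p0 + p2) = X0 + X2"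
      by (simp add: X0_def X2_def mm_simps algebra_simps)
    then show "du (\<lambda>w. A w (0, 1)) z - dv (\<lambda>w. A w (1, 0)) z + (X0 + X2) = 0"
      "du (\<lambda>w. t w (0, 1)) z - dv (\<lambda>w. t w (1, 0)) z + ((p0 + p2) *v y - (q0 + q2) *v x) = 0"
      using structure_equation[unfolded MC_form_equations, rule_format, OF z, of "(0, 1)" "(1, 0)", unfolded AA]
      unfolding du_def dv_def x_def y_def by simp_all
  qed
  note P0l = bounded_linear.linear[OF bounded_linear_P0] and P2l = bounded_linear.linear[OF bounded_linear_P2]
  show "P0 (du (\<lambda>w. A w (0, 1)) z) - P0 (dv (\<lambda>w. A w (1, 0)) z) + (p0 ** q0 - q0 ** p0) + (p2 ** q2 - q2 ** p2) = 0"
    using arg_cong[OF MC, of P0]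
    by (simp add: linear_add[OF P0l] linear_diff[OF P0l] linear_0[OF P0l] X0 X2) (simp add: X0_def algebra_simps)
  show "P2 (du (\<lambda>w. A w (0, 1)) z) - P2 (dv (\<lambda>w. A w (1, 0)) z) + (p0 ** q2 - q2 ** p0) + (p2 ** q0 - q0 ** p2) = 0"
    using arg_cong[OF MC, of P2]
    by (simp add: linear_add[OF P2l] linear_diff[OF P2l] linear_0[OF P2l] X0 X2) (simp add: X2_def algebra_simps)
  show "du (\<lambda>w. t w (0, 1)) z - dv (\<lambda>w. t w (1, 0)) z + (p0 *v y - q0 *v x) + (p2 *v y - q2 *v x) = 0"
    using MCt by (simp add: mv.add_left algebra_simps)
  have y: "y = J *v x" and Jy: "J *v y = - x" using h[OF z] by (simp_all add: x_def y_def)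
  have ty: "du (\<lambda>w. t w (0, 1)) z = J *v du (\<lambda>w. t w (1, 0)) z" "dv (\<lambda>w. t w (0, 1)) z = J *v dv (\<lambda>w. t w (1, 0)) z"
    using du_cong[OF open_\<Omega> z h] dv_cong[OF open_\<Omega> z h]
    by (simp_all add: du_bounded_linear[OF mv.bounded_linear_right t_smooth z] dv_bounded_linear[OF mv.bounded_linear_right t_smooth z])
  have Jp: "J *v (p0 *v v) = p0 *v (J *v v)" "J *v (q0 *v v) = q0 *v (J *v v)"
    "J *v (p2 *v v) = - (p2 *v (J *v v))" "J *v (q2 *v v) = - (q2 *v (J *v v))" for v
    by (simp_all add: matrix_vector_mul_assoc J0 J2 mv.minus_left)
  have "J *v (du (\<lambda>w. t w (0, 1)) z - dv (\<lambda>w. t w (1, 0)) z + ((p0 + p2) *v y - (q0 + q2) *v x)) = 0"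
    unfolding MCt by (rule mv.zero_right)
  then show "- du (\<lambda>w. t w (1, 0)) z - dv (\<lambda>w. t w (0, 1)) z - (p0 *v x + q0 *v y) + (p2 *v x + q2 *v y) = 0"
    by (simp add: mv.add_left mv.add_right mv.diff_right Jp Jy ty y[symmetric] mv.minus_right) (simp add: algebra_simps)
qed

lemma extended_MC_iff:
  fixes l :: complex
  assumes h: "\<And>z. z \<in> \<Omega> \<Longrightarrow> t z (0, 1) = J *v t z (1, 0)" and l: "l \<noteq> 0"
  shows "MC_equation \<Omega> (extended_form I \<alpha> l) \<longleftrightarrow> (\<forall>z\<in>\<Omega>. l powi 2 = l powi (-2) \<or> H z = 0)"
proof -
  define c s c1 s1 where "c = (l powi 2 + l powi (-2)) / 2" and "s = \<i> * (l powi 2 - l powi (-2)) / 2"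
    and "c1 = (l + l powi (-1)) / 2" and "s1 = \<i> * (l - l powi (-1)) / 2"
  note E = extended_form_components[of _ l, folded c_def s_def c1_def s1_def]
  define e where "e = 1 / l"
  have le: "l * e = 1" using l by (simp add: e_def)
  have pw: "l powi 2 = l * l" "l powi (-2) = e * e" "l powi (-1) = e"
    by (simp_all add: power_int_def e_def power2_eq_square field_simps)
  define \<sigma> \<sigma>1 where "\<sigma> = (l * l - e * e) / 2" and "\<sigma>1 = (l - e) / 2"
  have half: "c = (l * l + e * e) / 2" "c1 = (l + e) / 2" by (simp_all only: c_def c1_def pw)
  have s: "s = \<i> * \<sigma>" "s1 = \<i> * \<sigma>1" by (simp_all only: s_def s1_def \<sigma>_def \<sigma>1_def pw times_divide_eq_right)
  have "c * c - \<sigma> * \<sigma> = (l * e) * (l * e)" "c * c1 - \<sigma> * \<sigma>1 = ((l * e) * l + (l * e) * e) / 2"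
    "\<sigma> * c1 - c * \<sigma>1 = ((l * e) * l - (l * e) * e) / 2"
    by (simp_all add: half \<sigma>_def \<sigma>1_def field_simps)
  then have r: "c * c - \<sigma> * \<sigma> = 1" "c * c1 - \<sigma> * \<sigma>1 = c1" "\<sigma> * c1 - c * \<sigma>1 = \<sigma>1"
    by (simp_all add: le half \<sigma>1_def)
  have "c * c + s * s = c * c - \<sigma> * \<sigma>" "c * c1 + s * s1 = c * c1 - \<sigma> * \<sigma>1" "s * c1 - c * s1 = \<i> * (\<sigma> * c1 - c * \<sigma>1)"
    by (simp_all add: s algebra_simps)
  then have cs: "c * c + s * s = 1" "c * c1 + s * s1 = c1" "s * c1 - c * s1 = s1"
    unfolding r s(2) by simp_all
  define DA where "DA \<xi> z = frechet_derivative (\<lambda>w. A w \<xi>) (at z)" for \<xi> z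
  define Dt where "Dt \<xi> z = frechet_derivative (\<lambda>w. t w \<xi>) (at z)" for \<xi> z
  let ?P0 = "\<lambda>\<xi> w. P0 (A w \<xi>)" and ?P2 = "\<lambda>\<xi> w. P2 (A w \<xi>)"
  have dP: "(?P0 \<xi> has_derivative (\<lambda>k. P0 (DA \<xi> z k))) (at z)"
    "(?P2 \<xi> has_derivative (\<lambda>k. P2 (DA \<xi> z k))) (at z)" if "z \<in> \<Omega>" for z \<xi>
    using bounded_linear.has_derivative[OF bounded_linear_P0 A_deriv[OF that, folded DA_def]]
      bounded_linear.has_derivative[OF bounded_linear_P2 A_deriv[OF that, folded DA_def]] by blast+
  have D1: "((\<lambda>w. extended_form I \<alpha> l w (1, 0)) has_derivative (\<lambda>k. ext_comb c s c1 s1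
      (P0 (DA (1, 0) z k)) (P2 (DA (1, 0) z k))
      (P2 (DA (0, 1) z k)) (Dt (1, 0) z k)
      (Dt (0, 1) z k))) (at z)" if z: "z \<in> \<Omega>" for z
    by (rule has_derivative_transform_within_open[OF ext_comb_has_derivative[OF dP(1)[OF z] dP(2)[OF z] dP(2)[OF z] t_deriv[OF z, folded Dt_def] t_deriv[OF z, folded Dt_def]] open_\<Omega> z])
      (simp add: E(1) h)
  have D2: "((\<lambda>w. extended_form I \<alpha> l w (0, 1)) has_derivative (\<lambda>k. ext_comb c s c1 s1
      (P0 (DA (0, 1) z k)) (P2 (DA (0, 1) z k))
      (- P2 (DA (1, 0) z k)) (Dt (0, 1) z k)
      (- Dt (1, 0) z k))) (at z)" if z: "z \<in> \<Omega>" for z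
    by (rule has_derivative_transform_within_open[OF ext_comb_has_derivative[OF dP(1)[OF z] dP(2)[OF z]
          has_derivative_minus[OF dP(2)[OF z]] t_deriv[OF z, folded Dt_def] has_derivative_minus[OF t_deriv[OF z, folded Dt_def]]] open_\<Omega> z])
      (simp add: E(2) h)
  have diff: "(\<lambda>w. extended_form I \<alpha> l w \<xi>) differentiable (at z)" if z: "z \<in> \<Omega>" for z \<xi>
  proof -
    have "((\<lambda>w. extended_form I \<alpha> l w \<xi>) has_derivative (\<lambda>k. fst \<xi> *\<^sub>R ext_comb c s c1 s1
      (P0 (DA (1, 0) z k)) (P2 (DA (1, 0) z k))
      (P2 (DA (0, 1) z k)) (Dt (1, 0) z k)
      (Dt (0, 1) z k) + snd \<xi> *\<^sub>R ext_comb c s c1 s1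
      (P0 (DA (0, 1) z k)) (P2 (DA (0, 1) z k))
      (- P2 (DA (1, 0) z k)) (Dt (0, 1) z k)
      (- Dt (1, 0) z k))) (at z)"
      by (rule has_derivative_transform_within_open[OF has_derivative_add[OF has_derivative_scaleR_right[OF D1[OF z]]
            has_derivative_scaleR_right[OF D2[OF z]]] open_\<Omega> z])
        (simp flip: linear_R2[OF extended_form_linear])
    then show ?thesis by (auto simp: differentiable_def)
  qed
  have curv: "du (\<lambda>w. extended_form I \<alpha> l w (0, 1)) z - dv (\<lambda>w. extended_form I \<alpha> l w (1, 0)) z
      + lie_bracket (extended_form I \<alpha> l z (1, 0)) (extended_form I \<alpha> l z (0, 1)) = cscale (- s) (cplx (H z, 0))"
    if z: "z \<in> \<Omega>" for z
    unfolding has_derivative_du[OF D2[OF z]] has_derivative_dv[OF D1[OF z]] E[OF z h[OF z]] H_def DA_def Dt_def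
    unfolding du_def[symmetric] dv_def[symmetric]
    by (rule ext_curvature[OF cs structure_equation_components[OF z h]])
  have "s = 0 \<longleftrightarrow> l powi 2 = l powi (-2)" by (simp add: s_def)
  moreover have "cplx (M, 0) = 0 \<longleftrightarrow> M = 0" for M
    using cplx_inject[of "(M, 0)" 0] by (simp only: cplx_zero) (simp add: zero_prod_def)
  moreover have "MC_equation \<Omega> (extended_form I \<alpha> l) \<longleftrightarrow> (\<forall>z\<in>\<Omega>. du (\<lambda>w. extended_form I \<alpha> l w (0, 1)) z
      - dv (\<lambda>w. extended_form I \<alpha> l w (1, 0)) z + lie_bracket (extended_form I \<alpha> l z (1, 0)) (extended_form I \<alpha> l z (0, 1)) = 0)"
    by (rule MC_equation_iff[OF open_\<Omega> extended_form_linear diff])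
  ultimately show ?thesis by (simp add: curv)
qed

lemma rho_harmonic_iff_extended_MC:
  assumes h: "\<And>z. z \<in> \<Omega> \<Longrightarrow> t z (0, 1) = J *v t z (1, 0)" and nz: "\<And>z. z \<in> \<Omega> \<Longrightarrow> t z (1, 0) \<noteq> 0"
  shows "rho_harmonic_on \<Omega> X \<longleftrightarrow> (\<forall>l. l \<noteq> 0 \<longrightarrow> MC_equation \<Omega> (extended_form I \<alpha> l))"
proof -
  \<comment> \<open>A value of the parameter at which the sine does not vanish.\<close>
  have "(2 :: complex) powi 2 \<noteq> 2 powi (-2)" by (simp add: power_int_def power_divide)
  then have "(\<forall>l. l \<noteq> 0 \<longrightarrow> MC_equation \<Omega> (extended_form I \<alpha> l)) \<longleftrightarrow> (\<forall>z\<in>\<Omega>. H z = 0)"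
    using extended_MC_iff[OF h] by (metis zero_neq_numeral)
  then show ?thesis using rho_harmonic_iff[OF h nz] by simp
qed

end

section \<open>Maurer-Cartan forms of isotropic lifts and of harmonic immersions\<close>

theorem mainTheorem17:
  fixes \<Omega> :: "(real \<times> real) set"
    and I :: "nat set"
    and \<alpha> :: "real \<times> real \<Rightarrow> real \<times> real \<Rightarrow> real aff8"
  assumes "I \<subset> {1..7}" and "I = {1..card I}"
    and "open \<Omega>" and "simply_connected \<Omega>"
    and "smooth_one_form \<Omega> (g_aff I) \<alpha>"
  shows "((\<exists>F X. isotropic_lift I \<Omega> F X \<and> is_MC_form_of \<Omega> \<alpha> F X) \<longleftrightarrow>
           MC_equation \<Omega> \<alpha> \<and>
           (\<forall>z\<in>\<Omega>. \<forall>\<xi>. dzbar_part (form_comp I (-1) \<alpha>) z \<xi> = 0) \<and>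
           (\<forall>z\<in>\<Omega>. \<exists>\<xi>. dz_part (form_comp I (-1) \<alpha>) z \<xi> \<noteq> 0)) \<and>
         (\<forall>F X. isotropic_lift I \<Omega> F X \<and> is_MC_form_of \<Omega> \<alpha> F X \<longrightarrow>
           (rho_harmonic_on \<Omega> X \<longleftrightarrow> (\<forall>l. l \<noteq> 0 \<longrightarrow> MC_equation \<Omega> (extended_form I \<alpha> l))))"
proof -
  interpret one_form_setting I \<Omega> \<alpha>
    by unfold_locales (fact assms)+
  have lift: "MC_equation \<Omega> \<alpha>" "\<And>z. z \<in> \<Omega> \<Longrightarrow> t z (0, 1) = J *v t z (1, 0)" "\<And>z. z \<in> \<Omega> \<Longrightarrow> t z (1, 0) \<noteq> 0"
    "rho_harmonic_on \<Omega> X \<longleftrightarrow> (\<forall>l. l \<noteq> 0 \<longrightarrow> MC_equation \<Omega> (extended_form I \<alpha> l))"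
    if FX: "isotropic_lift I \<Omega> F X" "is_MC_form_of \<Omega> \<alpha> F X" for F X
  proof -
    interpret frame I \<Omega> \<alpha> F X by (rule frameI[OF FX])
    show "MC_equation \<Omega> \<alpha>" by (rule structure_equation)
    show h: "t z (0, 1) = J *v t z (1, 0)" and nz: "t z (1, 0) \<noteq> 0" if "z \<in> \<Omega>" for z
      using lift_imp_holomorphic[OF FX(1) that] .
    show "rho_harmonic_on \<Omega> X \<longleftrightarrow> (\<forall>l. l \<noteq> 0 \<longrightarrow> MC_equation \<Omega> (extended_form I \<alpha> l))"
      by (rule rho_harmonic_iff_extended_MC[OF h nz])
  qed
  have exists: "\<exists>F X. isotropic_lift I \<Omega> F X \<and> is_MC_form_of \<Omega> \<alpha> F X"
    if MC: "MC_equation \<Omega> \<alpha>" and h: "\<And>z. z \<in> \<Omega> \<Longrightarrow> t z (0, 1) = J *v t z (1, 0)" and nz: "\<And>z. z \<in> \<Omega> \<Longrightarrow> t z (1, 0) \<noteq> 0"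
  proof (cases "\<Omega> = {}")
    case True
    have "frame I \<Omega> \<alpha> (\<lambda>_. mat 1) (\<lambda>_. 0)" by unfold_locales (simp_all add: True)
    from frame.holomorphic_imp_lift[OF this h nz] show ?thesis by blast
  next
    case False
    then obtain F X where "frame I \<Omega> \<alpha> F X" using frame_exists[OF MC assms(4)] by blast
    from frame.holomorphic_imp_lift[OF this h nz] show ?thesis by blast
  qed
  have "(\<forall>z\<in>\<Omega>. \<forall>\<xi>. dzbar_part (form_comp I (-1) \<alpha>) z \<xi> = 0) \<longleftrightarrow> (\<forall>z\<in>\<Omega>. t z (0, 1) = J *v t z (1, 0))"
    using dzbar_condition by blast
  moreover have "(\<forall>z\<in>\<Omega>. \<exists>\<xi>. dz_part (form_comp I (-1) \<alpha>) z \<xi> \<noteq> 0) \<longleftrightarrow> (\<forall>z\<in>\<Omega>. t z (1, 0) \<noteq> 0)"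
    if "\<forall>z\<in>\<Omega>. t z (0, 1) = J *v t z (1, 0)"
    using dz_condition that by blast
  ultimately show ?thesis using lift exists by metis
qed

end
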